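(* Let $\varphi$ be a Jacob's ladder and $\varphi_1(t)=\frac12\varphi(t)$. For every $n=1,2,\dots$ the following asymptotic formula holds: $$\int_{\varphi_1^{-1}(T)}^{\varphi_1^{-1}(T+2)}\frac{[\mathcal{T}_n(\varphi_1(t)-T-1)]^2}{\sqrt{1-(\varphi_1(t)-T-1)^2}}\left|\zeta\left(\tfrac12+it\right)\right|^2dt\sim\frac{\pi}{2}\ln T,\qquad T\to\infty,$$ where $\mathcal{T}_n(x)$, $x\in[-1,1]$, is the Chebyshev polynomial of the first kind. That is, $x(t)=\varphi_1(t)$ is an asymptotic solution (the ratio of the two sides tends to $1$ as $T\to\infty$) of the nonlinear integral equation $$\int_{x^{-1}(T)}^{x^{-1}(T+2)}\frac{[\mathcal{T}_n(x(t)-T-1)]^2}{\sqrt{1-(x(t)-T-1)^2}}\left|\zeta\left(\tfrac12+it\right)\right|^2dt=\frac{\pi}{2}\ln T.$$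
   Context: $Z(t)=e^{i\vartheta(t)}\zeta\left(\frac12+it\right)$ with $\vartheta(t)=-\frac t2\ln\pi+\operatorname{Im}\ln\Gamma\left(\frac14+i\frac t2\right)$, where $\zeta$ is the Riemann zeta-function; thus $Z^2(t)=|\zeta(\frac12+it)|^2$. Let $\mu(y)=a\,y\ln y$ with a fixed $a\in[7,8]$. The Jacob's ladder $\varphi(T)$ corresponding to $\mu$ is the (increasing, tending to infinity) solution $x(T)=\varphi(T)$, for sufficiently large $T$, of the nonlinear integral equation $$\int_0^{\mu[x(T)]}Z^2(t)e^{-\frac{2}{x(T)}t}\,dt=\int_0^T Z^2(t)\,dt .$$ $\varphi_1^{-1}$ denotes the inverse function of $\varphi_1$. Integrals with endpoint singularities are Lebesgue (or improper Riemann) integrals. *)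

theory Defs
  imports "HOL-Complex_Analysis.Complex_Analysis" "HOL-Library.Landau_Symbols"
begin

(* The clause f 1 = 0 only fixes the value of the total function at the pole, so that the
   meromorphic continuation of the Dirichlet series is uniquely determined. *)
definition riemann_zeta :: "complex \<Rightarrow> complex" where
  "riemann_zeta = (THE f. f holomorphic_on (- {1}) \<and> f 1 = 0 \<and>
     (\<forall>s. Re s > 1 \<longrightarrow> (\<lambda>n. 1 / of_nat (Suc n) powr s) sums f s))"

(* ln_Gamma is the branch of ln Gamma that is holomorphic off the non-positive real axis and
   real on the positive one, i.e. the branch obtained by continuous variation from t = 0. *)
definition vartheta :: "real \<Rightarrow> real" where
  "vartheta t = - (t / 2) * ln pi + Im (ln_Gamma (Complex (1/4) (t / 2)))"

(* The values are real by the functional equation, but the type is complex; the real square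
   Z^2(t) is therefore written as the squared modulus of hardy_Z t below. *)
definition hardy_Z :: "real \<Rightarrow> complex" where
  "hardy_Z t = cis (vartheta t) * riemann_zeta (Complex (1/2) t)"

lemma norm_hardy_Z_squared: "(norm (hardy_Z t))\<^sup>2 = (norm (riemann_zeta (Complex (1/2) t)))\<^sup>2"
  by (simp add: hardy_Z_def norm_mult)

definition ladder_mu :: "real \<Rightarrow> real \<Rightarrow> real" where
  "ladder_mu a y = a * y * ln y"

(* "For sufficiently large T": the ladder is a function on the half-line {T0..}; its values
   outside that half-line are irrelevant.  Positivity keeps it in the domain of ladder_mu. *)
definition jacobs_ladder :: "real \<Rightarrow> real \<Rightarrow> (real \<Rightarrow> real) \<Rightarrow> bool" where
  "jacobs_ladder a T0 \<phi> \<longleftrightarrow>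
     T0 > 0 \<and> (\<forall>T\<ge>T0. \<phi> T > 0) \<and>
     strict_mono_on {T0..} \<phi> \<and> filterlim \<phi> at_top at_top \<and>
     (\<forall>T\<ge>T0. (LBINT t=0..ladder_mu a (\<phi> T). (norm (hardy_Z t))\<^sup>2 * exp (- (2 / \<phi> T) * t))
            = (LBINT t=0..T. (norm (hardy_Z t))\<^sup>2))"

fun chebyshev_T :: "nat \<Rightarrow> real poly" where
  "chebyshev_T 0 = 1"
| "chebyshev_T (Suc 0) = [:0, 1:]"
| "chebyshev_T (Suc (Suc n)) = [:0, 2:] * chebyshev_T (Suc n) - chebyshev_T n"

(* The left-hand side of the integral equation for an unknown x with domain {T0..}. *)
definition chebyshev_zeta_integral :: "nat \<Rightarrow> real \<Rightarrow> (real \<Rightarrow> real) \<Rightarrow> real \<Rightarrow> real" where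
  "chebyshev_zeta_integral n T0 x T =
     (LBINT t=inv_into {T0..} x T..inv_into {T0..} x (T + 2).
        (poly (chebyshev_T n) (x t - T - 1))\<^sup>2 / sqrt (1 - (x t - T - 1)\<^sup>2)
          * (norm (riemann_zeta (Complex (1/2) t)))\<^sup>2)"

end

theory Submission
  imports Defs "HOL-Probability.Characteristic_Functions"
begin

text \<open>
  Write \<open>Z\<^sup>2(t) = |\<zeta>(1/2 + it)|\<^sup>2\<close> and let \<open>G(x)\<close> be the integral of
  \<open>Z\<^sup>2(t) exp(-2t/x)\<close> over \<open>[0, a x ln x]\<close>, so that the ladder satisfies
  \<open>G(\<phi>(t)) = \<integral>\<^sub>0\<^sup>t Z\<^sup>2\<close>. Differentiating this gives \<open>Z\<^sup>2 = G'(\<phi>) \<phi>' = 2 G'(2 \<phi>\<^sub>1) \<phi>\<^sub>1'\<close>. The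
  substitution \<open>u = \<phi>\<^sub>1(t) - T - 1\<close> therefore turns the left-hand side into the integral of
  \<open>T\<^sub>n(u)\<^sup>2 / sqrt(1 - u\<^sup>2)\<close> over \<open>[-1, 1]\<close>, which is \<open>\<pi>/2\<close>, weighted by \<open>2 G'(2(u + T + 1))\<close>.
  Everything rests on \<open>2 G'(x) \<sim> ln x\<close>: on the window \<open>x \<in> [2T, 2T + 4]\<close> the factor \<open>2 G'\<close> is then
  uniformly asymptotic to \<open>ln T\<close> (lemma \<open>ladder_dens_uniform\<close>).

  Up to a boundary term, which is negligible because \<open>exp(-2 a ln x)\<close> beats the polynomial bound
  for \<open>Z\<^sup>2\<close>, \<open>G'(x)\<close> equals \<open>(2/x\<^sup>2)\<close> times the integral of \<open>t Z\<^sup>2(t) exp(-2t/x)\<close>. Its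
  size follows from the theorem of Hardy and Littlewood that
  \<open>L(\<delta>) = \<integral>\<^sub>0\<^sup>\<infinity> Z\<^sup>2(t) exp(-2\<delta>t) dt \<sim> ln(1/\<delta>) / (2\<delta>)\<close> as \<open>\<delta> \<rightarrow> 0\<close>: since \<open>exp\<close> is convex, difference
  quotients of \<open>L\<close> enclose \<open>-L'\<close> (lemmas \<open>zeta_laplace_diff_bounds\<close> and \<open>zeta_laplace1_asymp\<close>).

  The Hardy--Littlewood theorem is proved by Mellin transforms. For \<open>0 < Re s < 1\<close>, \<open>\<Gamma>(s)\<zeta>(s)\<close> is the
  Mellin transform of \<open>b(x) = 1/(e\<^sup>x - 1) - 1/x\<close>. Replacing \<open>b(x)\<close> by \<open>b(\<omega>x)\<close> with
  \<open>\<omega> = i exp(-i\<delta>)\<close> multiplies the transform by \<open>\<omega>\<^sup>-\<^sup>s\<close>, of modulus \<open>exp((\<pi>/2 - \<delta>)t)\<close> at \<open>s = 1/2 + it\<close>. On the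
  critical line the Mellin transform is a Fourier transform in \<open>ln x\<close>, and Plancherel's identity together with \<open>|\<Gamma>(1/2 + it)|\<^sup>2 = \<pi>/cosh(\<pi>t)\<close> yields the exact formula
  \<open>\<integral> Z\<^sup>2(t) exp(-2\<delta>t) / (1 + exp(-2\<pi>t)) dt = \<integral>\<^sub>0\<^sup>\<infinity> |b(\<omega>x)|\<^sup>2 dx\<close> (lemma \<open>zeta_energy_eq\<close>). On the right,
  \<open>1/|e\<^sup>w - 1|\<^sup>2\<close> with \<open>w = \<omega>x\<close> is \<open>1/(r\<^sup>2 - 1)\<close> times a Poisson kernel with slowly growing radius
  \<open>r = exp(x sin \<delta>)\<close>. Freezing \<open>r\<close> on each period
  and integrating the Poisson kernel reduces the integral to a sum that telescopes against the
  primitive of \<open>1/(exp(2 x sin \<delta>) - 1)\<close> (lemmas \<open>poisson_integral_bounds\<close> and \<open>bose_energy_asymp\<close>).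

  Finally, the zeta function is given only as the unique meromorphic continuation of its Dirichlet
  series, so its existence has to be shown too. The Mellin integral is split at \<open>1\<close>: the part over
  \<open>[1, \<infinity>)\<close> is entire, and the part over \<open>[0, 1]\<close> is a series of simple fractions whose poles are
  cancelled by \<open>1/\<Gamma>\<close> (theorem \<open>riemann_zeta_eq_zeta_ext\<close>).
\<close>

section \<open>Exponential substitution and Plancherel identity\<close>

lemma nn_integral_exp_substitution:
  fixes f :: "real \<Rightarrow> ennreal"
  assumes [measurable]: "f \<in> borel_measurable borel"
  shows "(\<integral>\<^sup>+x. f x * indicator {0<..} x \<partial>lborel) = (\<integral>\<^sup>+u. f (exp u) * ennreal (exp u) \<partial>lborel)"
proof -
  have U1: "(\<Union>n. {exp (- real (Suc n))..exp (real (Suc n))}) = {0<..}"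
  proof (intro set_eqI iffI)
    fix x :: real assume x: "x \<in> {0<..}"
    obtain n :: nat where n: "\<bar>ln x\<bar> < real n" using reals_Archimedean2 by blast
    have "exp (- real (Suc n)) \<le> exp (ln x)" "exp (ln x) \<le> exp (real (Suc n))" using n by auto
    with x show "x \<in> (\<Union>n. {exp (- real (Suc n))..exp (real (Suc n))})" by auto
  qed (auto intro: less_le_trans[OF exp_gt_zero])
  have U2: "(\<Union>n. {- real (Suc n)..real (Suc n)}) = UNIV"
  proof (intro set_eqI iffI)
    fix x :: real
    obtain n :: nat where n: "\<bar>x\<bar> < real n" using reals_Archimedean2 by blast
    then show "x \<in> (\<Union>n. {- real (Suc n)..real (Suc n)})" by (auto intro!: exI[of _ n])
  qed auto
  have I1: "incseq (\<lambda>n. {exp (- real (Suc n))..exp (real (Suc n))})"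
    by (rule incseq_SucI) (auto intro: order_trans[rotated])
  have I2: "incseq (\<lambda>n. {- real (Suc n)..real (Suc n)})" by (rule incseq_SucI) auto
  have "(\<integral>\<^sup>+x. f x * indicator {0<..} x \<partial>lborel) = emeasure (density lborel f) {0<..}"
    by (simp add: emeasure_density)
  also have "\<dots> = (SUP n. emeasure (density lborel f) {exp (- real (Suc n))..exp (real (Suc n))})"
    using I1 by (subst SUP_emeasure_incseq) (auto simp flip: U1)
  also have "\<dots> = (SUP n. emeasure (density lborel (\<lambda>u. f (exp u) * ennreal (exp u))) {- real (Suc n)..real (Suc n)})"
  proof (rule SUP_cong)
    fix n
    show "emeasure (density lborel f) {exp (- real (Suc n))..exp (real (Suc n))} =
      emeasure (density lborel (\<lambda>u. f (exp u) * ennreal (exp u))) {- real (Suc n)..real (Suc n)}"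
      by (simp add: emeasure_density del: of_nat_Suc)
         (rule nn_integral_substitution_aux, auto intro!: derivative_eq_intros continuous_intros)
  qed simp
  also have "\<dots> = emeasure (density lborel (\<lambda>u. f (exp u) * ennreal (exp u))) UNIV"
    using I2 by (subst SUP_emeasure_incseq) (auto simp flip: U2)
  finally show ?thesis by (simp add: emeasure_density)
qed

text \<open>Stating the substitution \<open>x = exp u\<close> as an identity of measures transfers integrability and integrals
of vector-valued functions at once.\<close>

lemma density_eq_distr_exp:
  "density lborel (indicator {0<..}) = distr (density lborel (\<lambda>u. ennreal (exp u))) borel (exp :: real \<Rightarrow> real)"
proof (rule measure_eqI)
  fix A assume "A \<in> sets (density lborel (indicator {0<..} :: real \<Rightarrow> ennreal))"
  then have [measurable]: "A \<in> sets borel" by simp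
  have "emeasure (density lborel (indicator {0<..})) A = (\<integral>\<^sup>+x. indicator A x * indicator {0<..} x \<partial>lborel)"
    by (simp add: emeasure_density mult.commute)
  also have "\<dots> = (\<integral>\<^sup>+u. indicator A (exp u) * ennreal (exp u) \<partial>lborel)"
    by (rule nn_integral_exp_substitution) simp
  also have "\<dots> = emeasure (distr (density lborel (\<lambda>u. ennreal (exp u))) borel exp) A"
    using measurable_sets[of exp borel borel A]
    by (subst emeasure_distr, simp, simp, subst emeasure_density)
       (auto intro!: nn_integral_cong simp: mult.commute split: split_indicator)
  finally show "emeasure (density lborel (indicator {0<..})) A =
      emeasure (distr (density lborel (\<lambda>u. ennreal (exp u))) borel exp) A" .
qed simp

lemma
  fixes f :: "real \<Rightarrow> 'a :: {banach, second_countable_topology}"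
  assumes [measurable]: "f \<in> borel_measurable borel"
  shows integrable_exp_substitution:
      "set_integrable lborel {0<..} f \<longleftrightarrow> integrable lborel (\<lambda>u. exp u *\<^sub>R f (exp u))"
    and integral_exp_substitution:
      "(LBINT x:{0<..}. f x) = (LBINT u. exp u *\<^sub>R f (exp u))"
proof -
  have eq: "density lborel (\<lambda>x. ennreal (indicator {0<..} x)) =
      distr (density lborel (\<lambda>u. ennreal (exp u))) borel (exp :: real \<Rightarrow> real)"
    using density_eq_distr_exp by (simp add: ennreal_indicator)
  have "set_integrable lborel {0<..} f \<longleftrightarrow> integrable (density lborel (\<lambda>x. ennreal (indicator {0<..} x))) f"
    unfolding set_integrable_def by (subst integrable_density) auto
  also have "\<dots> \<longleftrightarrow> integrable lborel (\<lambda>u. exp u *\<^sub>R f (exp u))"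
    unfolding eq by (subst integrable_distr_eq, simp, simp, subst integrable_density) auto
  finally show "set_integrable lborel {0<..} f \<longleftrightarrow> integrable lborel (\<lambda>u. exp u *\<^sub>R f (exp u))" .
  have "(LBINT x:{0<..}. f x) = integral\<^sup>L (density lborel (\<lambda>x. ennreal (indicator {0<..} x))) f"
    unfolding set_lebesgue_integral_def by (subst integral_density) auto
  also have "\<dots> = (LBINT u. exp u *\<^sub>R f (exp u))"
    unfolding eq by (subst integral_distr, simp, simp, subst integral_density) auto
  finally show "(LBINT x:{0<..}. f x) = (LBINT u. exp u *\<^sub>R f (exp u))" .
qed

lemma borel_measurable_cnj [measurable]:
  "f \<in> borel_measurable M \<Longrightarrow> (\<lambda>x. cnj (f x)) \<in> borel_measurable M"
  by (rule measurable_compose[OF _ borel_measurable_continuous_onI]) (auto intro!: continuous_intros)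

lemma integral_swap_prob:
  fixes g :: "real \<Rightarrow> complex" and k :: "real \<Rightarrow> real \<Rightarrow> complex"
  assumes N: "prob_space N" "sets N = sets borel"
  assumes g: "integrable lborel g"
  assumes k[measurable]: "(\<lambda>(t,u). k t u) \<in> borel_measurable (borel \<Otimes>\<^sub>M borel)" and B: "\<And>t u. norm (k t u) \<le> B"
  shows "(LINT t|N. (LBINT u. g u * k t u)) = (LBINT u. g u * (LINT t|N. k t u))"
proof -
  interpret N: prob_space N by fact
  interpret P: pair_sigma_finite N lborel
    by unfold_locales
  have [measurable]: "g \<in> borel_measurable borel" using g by auto
  note [measurable_cong] = N(2)
  have B0: "0 \<le> B" using B[of 0 0] norm_ge_zero[of "k 0 0"] by linarith
  have G: "integrable (N \<Otimes>\<^sub>M lborel) (\<lambda>(t,u). g u)"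
  proof (rule P.Fubini_integrable)
    show "AE x in N. integrable lborel (\<lambda>y. case (x, y) of (t, u) \<Rightarrow> g u)" using g by simp
  qed (simp_all)
  have I: "integrable (N \<Otimes>\<^sub>M lborel) (\<lambda>(t,u). g u * k t u)"
  proof (rule Bochner_Integration.integrable_bound)
    show "integrable (N \<Otimes>\<^sub>M lborel) (\<lambda>(t,u). of_real B * g u)"
      using integrable_mult_right[OF G, of "of_real B"] by (simp add: case_prod_unfold)
    show "AE x in N \<Otimes>\<^sub>M lborel. norm (case x of (t, u) \<Rightarrow> g u * k t u) \<le> norm (case x of (t, u) \<Rightarrow> of_real B * g u)"
      using B B0 by (intro AE_I2) (auto simp: norm_mult mult.commute[of B] intro!: mult_left_mono)
  qed simp
  have "(LINT t|N. (LBINT u. g u * k t u)) = (LBINT u. (LINT t|N. g u * k t u))"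
    by (rule P.Fubini_integral[symmetric, OF I])
  then show ?thesis by simp
qed

lemma std_normal_char: "(LINT t|std_normal_distribution. iexp (t * x)) = exp (- (x\<^sup>2) / 2)"
  using fun_cong[OF char_std_normal_distribution, of x] by (simp add: char_def mult.commute)

lemma plancherel_gauss:
  fixes g :: "real \<Rightarrow> complex" and \<sigma> :: real
  assumes g: "integrable lborel g"
  defines "G \<equiv> (\<lambda>t. LBINT u. g u * iexp (t * u))"
  shows "(LINT t|std_normal_distribution. complex_of_real ((norm (G (\<sigma> * t)))\<^sup>2)) =
    (LBINT u. g u * cnj (LBINT v. g v * of_real (exp (- (\<sigma> * (u - v))\<^sup>2 / 2))))"
proof -
  have [measurable]: "g \<in> borel_measurable borel" using g by auto
  have N: "prob_space std_normal_distribution" "sets std_normal_distribution = sets borel"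
    by (auto simp: prob_space_normal_density)
  have [measurable]: "G \<in> borel_measurable borel" unfolding G_def by measurable
  have B: "norm (G t) \<le> (LBINT u. norm (g u))" for t
    unfolding G_def by (rule order_trans[OF integral_norm_bound]) (simp add: norm_mult)
  have "(LINT t|std_normal_distribution. complex_of_real ((norm (G (\<sigma> * t)))\<^sup>2)) =
     (LINT t|std_normal_distribution. (LBINT u. g u * (iexp (\<sigma> * t * u) * cnj (G (\<sigma> * t)))))"
  proof (rule Bochner_Integration.integral_cong[OF refl])
    fix t
    have "complex_of_real ((norm (G (\<sigma> * t)))\<^sup>2) = G (\<sigma> * t) * cnj (G (\<sigma> * t))"
      by (rule complex_norm_square)
    also have "\<dots> = (LBINT u. g u * iexp (\<sigma> * t * u) * cnj (G (\<sigma> * t)))"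
      unfolding G_def by simp
    finally show "complex_of_real ((norm (G (\<sigma> * t)))\<^sup>2) =
      (LBINT u. g u * (iexp (\<sigma> * t * u) * cnj (G (\<sigma> * t))))" by (simp add: mult.assoc)
  qed
  also have "\<dots> = (LBINT u. g u * (LINT t|std_normal_distribution. iexp (\<sigma> * t * u) * cnj (G (\<sigma> * t))))"
    by (rule integral_swap_prob[OF N g, where B = "(LBINT u. norm (g u))"])
       (use B in \<open>auto simp: norm_mult\<close>)
  also have "\<dots> = (LBINT u. g u * cnj (LBINT v. g v * of_real (exp (- (\<sigma> * (u - v))\<^sup>2 / 2))))"
  proof (rule Bochner_Integration.integral_cong[OF refl])
    fix u
    have "(LINT t|std_normal_distribution. iexp (\<sigma> * t * u) * cnj (G (\<sigma> * t))) =
      cnj (LINT t|std_normal_distribution. iexp (- \<sigma> * t * u) * G (\<sigma> * t))"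
      unfolding Bochner_Integration.integral_cnj[symmetric]
      by (simp add: exp_cnj del: Bochner_Integration.integral_cnj)
    also have "(LINT t|std_normal_distribution. iexp (- \<sigma> * t * u) * G (\<sigma> * t)) =
       (LINT t|std_normal_distribution. (LBINT v. g v * iexp (- \<sigma> * t * u + \<sigma> * t * v)))"
      unfolding G_def by (subst integral_mult_right_zero[symmetric]) (simp add: mult_exp_exp algebra_simps)
    also have "\<dots> = (LBINT v. g v * (LINT t|std_normal_distribution. iexp (- \<sigma> * t * u + \<sigma> * t * v)))"
      by (rule integral_swap_prob[OF N g, where B = 1]) (auto simp: norm_mult)
    also have "\<dots> = (LBINT v. g v * of_real (exp (- (\<sigma> * (u - v))\<^sup>2 / 2)))"
    proof (rule Bochner_Integration.integral_cong[OF refl])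
      fix v
      have "(LINT t|std_normal_distribution. iexp (- \<sigma> * t * u + \<sigma> * t * v)) =
            (LINT t|std_normal_distribution. iexp (t * (\<sigma> * (v - u))))"
        by (simp add: algebra_simps)
      then show "g v * (LINT t|std_normal_distribution. iexp (- \<sigma> * t * u + \<sigma> * t * v)) =
          g v * of_real (exp (- (\<sigma> * (u - v))\<^sup>2 / 2))"
        unfolding std_normal_char by (simp add: power_mult_distrib power2_commute)
    qed
    finally show "g u * (LINT t|std_normal_distribution. iexp (\<sigma> * t * u) * cnj (G (\<sigma> * t))) =
       g u * cnj (LBINT v. g v * of_real (exp (- (\<sigma> * (u - v))\<^sup>2 / 2)))" by simp
  qed
  finally show ?thesis .
qed


text \<open>The Gaussian factor in \<open>plancherel_gauss\<close> makes Fubini applicable; multiplying by \<open>\<sigma> sqrt(2\<pi>)\<close> and letting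
the width \<open>\<sigma>\<close> tend to infinity, the left-hand side converges monotonically to the energy of the transform, while after the rescaling
\<open>v = u + y/\<sigma>\<close> the right-hand side averages \<open>g(u + y/\<sigma>)\<close> against a fixed normal density and converges
to \<open>|g(u)|\<^sup>2\<close> by continuity.\<close>

theorem plancherel:
  fixes g :: "real \<Rightarrow> complex"
  assumes g: "integrable lborel g" and cont: "\<And>u. isCont g u" and B: "\<And>u. norm (g u) \<le> B"
  defines "G \<equiv> (\<lambda>t. LBINT u. g u * iexp (t * u))"
  shows "integrable lborel (\<lambda>t. (norm (G t))\<^sup>2)"
    and "(LBINT t. (norm (G t))\<^sup>2) = 2 * pi * (LBINT u. (norm (g u))\<^sup>2)"
proof -
  have [measurable]: "g \<in> borel_measurable borel" using g by auto
  have [measurable]: "G \<in> borel_measurable borel" unfolding G_def by measurable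
  have BG: "norm (G t) \<le> (LBINT u. norm (g u))" for t
    unfolding G_def by (rule order_trans[OF integral_norm_bound]) (simp add: norm_mult)
  define \<sigma> :: "nat \<Rightarrow> real" where "\<sigma> n = real (Suc n)" for n
  have \<sigma>: "\<sigma> n > 0" for n by (simp add: \<sigma>_def)
  have \<sigma>_lim: "filterlim \<sigma> at_top sequentially"
    unfolding \<sigma>_def using filterlim_Suc filterlim_compose filterlim_real_sequentially by blast
  define F where "F n t = (norm (G t))\<^sup>2 * exp (- (t / \<sigma> n)\<^sup>2 / 2)" for n t
  define H where "H n u = (LBINT y. of_real (std_normal_density y) * g (u + y / \<sigma> n))" for n u
  have [measurable]: "H n \<in> borel_measurable borel" for n unfolding H_def by measurable
  have dens_int: "integrable lborel (\<lambda>y. complex_of_real (std_normal_density y))"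
    by (rule integrable_of_real) simp
  have dens_one: "(LBINT y. complex_of_real (std_normal_density y)) = 1"
    by (simp only: integral_complex_of_real) simp
  have A: "complex_of_real (LBINT t. F n t) = 2 * pi * (LBINT u. g u * cnj (H n u))" for n
  proof -
    have "(LBINT t. F n t) = \<sigma> n * (LBINT t. F n (\<sigma> n * t))"
      using lborel_integral_real_affine[of "\<sigma> n" "F n" 0] \<sigma>[of n] by simp
    also have "(LBINT t. F n (\<sigma> n * t)) =
        sqrt (2 * pi) * (LBINT t. std_normal_density t *\<^sub>R (norm (G (\<sigma> n * t)))\<^sup>2)"
      unfolding integral_mult_right_zero[symmetric] using \<sigma>[of n]
      by (intro Bochner_Integration.integral_cong) (auto simp: F_def normal_density_def)
    also have "(LBINT t. std_normal_density t *\<^sub>R (norm (G (\<sigma> n * t)))\<^sup>2) =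
        (LINT t|std_normal_distribution. (norm (G (\<sigma> n * t)))\<^sup>2)"
      by (rule integral_density[symmetric]) auto
    finally have "complex_of_real (LBINT t. F n t) = \<sigma> n * sqrt (2 * pi) *
       (LINT t|std_normal_distribution. complex_of_real ((norm (G (\<sigma> n * t)))\<^sup>2))"
      by (simp only: integral_complex_of_real of_real_mult mult.assoc)
    also have "\<dots> = \<sigma> n * sqrt (2 * pi) *
      (LBINT u. g u * cnj (LBINT v. g v * of_real (exp (- (\<sigma> n * (u - v))\<^sup>2 / 2))))"
      unfolding G_def plancherel_gauss[OF g] ..
    also have "(\<lambda>u. (LBINT v. g v * of_real (exp (- (\<sigma> n * (u - v))\<^sup>2 / 2)))) =
       (\<lambda>u. sqrt (2 * pi) / \<sigma> n * H n u)"
    proof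
      fix u
      have "(LBINT v. g v * of_real (exp (- (\<sigma> n * (u - v))\<^sup>2 / 2))) =
         (1 / \<sigma> n) *\<^sub>R (LBINT y. g (u + (1 / \<sigma> n) * y) * of_real (exp (- (\<sigma> n * (u - (u + (1 / \<sigma> n) * y)))\<^sup>2 / 2)))"
        using lborel_integral_real_affine[of "1 / \<sigma> n" "\<lambda>v. g v * of_real (exp (- (\<sigma> n * (u - v))\<^sup>2 / 2))" u] \<sigma>[of n]
        by simp
      also have "(LBINT y. g (u + (1 / \<sigma> n) * y) * of_real (exp (- (\<sigma> n * (u - (u + (1 / \<sigma> n) * y)))\<^sup>2 / 2)))
         = (LBINT y. sqrt (2 * pi) * (of_real (std_normal_density y) * g (u + y / \<sigma> n)))"
        using \<sigma>[of n] by (intro Bochner_Integration.integral_cong) (auto simp: normal_density_def)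
      also have "\<dots> = sqrt (2 * pi) * H n u" unfolding H_def by simp
      finally show "(LBINT v. g v * of_real (exp (- (\<sigma> n * (u - v))\<^sup>2 / 2))) = sqrt (2 * pi) / \<sigma> n * H n u"
        by (simp add: scaleR_conv_of_real)
    qed
    also have "(\<lambda>u. g u * cnj (sqrt (2 * pi) / \<sigma> n * H n u)) = (\<lambda>u. (sqrt (2 * pi) / \<sigma> n) * (g u * cnj (H n u)))"
      by (simp add: fun_eq_iff)
    also have "\<sigma> n * sqrt (2 * pi) * (LBINT u. (sqrt (2 * pi) / \<sigma> n) * (g u * cnj (H n u))) =
       (complex_of_real (\<sigma> n * sqrt (2 * pi) * (sqrt (2 * pi) / \<sigma> n))) * (LBINT u. g u * cnj (H n u))"
      by (simp only: integral_mult_right_zero of_real_mult mult.assoc)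
    also have "\<sigma> n * sqrt (2 * pi) * (sqrt (2 * pi) / \<sigma> n) = 2 * pi"
      using \<sigma>[of n] by simp
    finally show ?thesis by simp
  qed
  have H_bd: "norm (H n u) \<le> B" for n u
  proof -
    have "norm (H n u) \<le> (LBINT y. std_normal_density y * norm (g (u + y / \<sigma> n)))"
      unfolding H_def by (rule order_trans[OF integral_norm_bound]) (simp add: norm_mult)
    also have "\<dots> \<le> (LBINT y. std_normal_density y * B)"
    proof (rule integral_mono)
      show "integrable lborel (\<lambda>y. std_normal_density y * norm (g (u + y / \<sigma> n)))"
        by (rule Bochner_Integration.integrable_bound[of _ "\<lambda>y. std_normal_density y * B"])
           (use B in \<open>auto simp: abs_mult intro!: mult_left_mono order_trans[OF _ abs_ge_self]\<close>)
    qed (use B in \<open>auto intro!: mult_left_mono\<close>)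
    also have "\<dots> = B" by (simp add: integral_normal_density)
    finally show ?thesis .
  qed
  have H_lim: "(\<lambda>n. H n u) \<longlonglongrightarrow> g u" for u
  proof -
    have "(\<lambda>n. H n u) \<longlonglongrightarrow> (LBINT y. of_real (std_normal_density y) * g u)"
      unfolding H_def
    proof (rule integral_dominated_convergence)
      show "integrable lborel (\<lambda>y. std_normal_density y * B)" by simp
      show "AE y in lborel. (\<lambda>n. complex_of_real (std_normal_density y) * g (u + y / \<sigma> n)) \<longlonglongrightarrow>
          complex_of_real (std_normal_density y) * g u"
      proof (intro AE_I2 tendsto_mult tendsto_const)
        fix y
        have "(\<lambda>n. u + y / \<sigma> n) \<longlonglongrightarrow> u + 0"
          by (intro tendsto_add tendsto_const tendsto_divide_0[OF tendsto_const]
               filterlim_at_top_imp_at_infinity \<sigma>_lim)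
        then show "(\<lambda>n. g (u + y / \<sigma> n)) \<longlonglongrightarrow> g u"
          by (intro isCont_tendsto_compose[OF cont]) simp
      qed
    qed (use B in \<open>auto simp: norm_mult intro!: mult_left_mono\<close>)
    then show ?thesis using dens_one by simp
  qed
  have lim1: "(\<lambda>n. LBINT u. g u * cnj (H n u)) \<longlonglongrightarrow> (LBINT u. g u * cnj (g u))"
  proof (rule integral_dominated_convergence)
    show "integrable lborel (\<lambda>u. norm (g u) * B)" using g by simp
    show "AE u in lborel. (\<lambda>n. g u * cnj (H n u)) \<longlonglongrightarrow> g u * cnj (g u)"
      by (intro AE_I2 tendsto_intros H_lim)
  qed (use H_bd in \<open>auto simp: norm_mult intro!: mult_left_mono\<close>)
  also have "(LBINT u. g u * cnj (g u)) = complex_of_real (LBINT u. (norm (g u))\<^sup>2)"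
    by (simp only: complex_norm_square flip: integral_complex_of_real)
  finally have "(\<lambda>n. complex_of_real (LBINT t. F n t)) \<longlonglongrightarrow> 2 * pi * complex_of_real (LBINT u. (norm (g u))\<^sup>2)"
    unfolding A by (intro tendsto_intros)
  then have "(\<lambda>n. complex_of_real (LBINT t. F n t)) \<longlonglongrightarrow> complex_of_real (2 * pi * (LBINT u. (norm (g u))\<^sup>2))"
    by simp
  then have lim: "(\<lambda>n. LBINT t. F n t) \<longlonglongrightarrow> 2 * pi * (LBINT u. (norm (g u))\<^sup>2)"
    unfolding tendsto_of_real_iff .
  have Fint: "integrable lborel (F n)" for n
  proof (rule Bochner_Integration.integrable_bound)
    define C where "C = (LBINT u. norm (g u))\<^sup>2"
    show "integrable lborel (\<lambda>t. (sqrt (2 * pi) * \<sigma> n * C) * normal_density 0 (\<sigma> n) t)" using \<sigma>[of n] by simp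
    have "F n t \<le> (sqrt (2 * pi) * \<sigma> n * C) * normal_density 0 (\<sigma> n) t" for t
    proof -
      have "F n t \<le> C * exp (- (t / \<sigma> n)\<^sup>2 / 2)"
        unfolding F_def C_def by (intro mult_right_mono power_mono BG) auto
      also have "\<dots> = (sqrt (2 * pi) * \<sigma> n * C) * normal_density 0 (\<sigma> n) t"
        using \<sigma>[of n] by (simp add: normal_density_def real_sqrt_mult power_divide)
      finally show ?thesis .
    qed
    then show "AE t in lborel. norm (F n t) \<le> norm ((sqrt (2 * pi) * \<sigma> n * C) * normal_density 0 (\<sigma> n) t)"
      by (intro AE_I2) (auto simp: F_def intro: order_trans[OF _ abs_ge_self])
  qed (unfold F_def, measurable)
  have mono: "mono (\<lambda>n. F n t)" for t
  proof (rule monoI)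
    fix m n :: nat assume "m \<le> n"
    then have "\<bar>t / \<sigma> n\<bar> \<le> \<bar>t / \<sigma> m\<bar>" by (simp add: \<sigma>_def divide_left_mono del: of_nat_Suc)
    then have "(t / \<sigma> n)\<^sup>2 \<le> (t / \<sigma> m)\<^sup>2" by (simp only: abs_le_square_iff)
    then show "F m t \<le> F n t" unfolding F_def by (intro mult_left_mono) auto
  qed
  have Flim: "(\<lambda>n. F n t) \<longlonglongrightarrow> (norm (G t))\<^sup>2" for t
  proof -
    have "(\<lambda>n. t / \<sigma> n) \<longlonglongrightarrow> 0"
      by (intro tendsto_divide_0[OF tendsto_const] filterlim_at_top_imp_at_infinity \<sigma>_lim)
    then have "(\<lambda>n. F n t) \<longlonglongrightarrow> (norm (G t))\<^sup>2 * exp (- (0\<^sup>2) / 2)"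
      unfolding F_def by (intro tendsto_intros) auto
    then show ?thesis by simp
  qed
  show "integrable lborel (\<lambda>t. (norm (G t))\<^sup>2)"
    by (rule integrable_monotone_convergence[OF Fint _ _ lim]) (use mono Flim in auto)
  show "(LBINT t. (norm (G t))\<^sup>2) = 2 * pi * (LBINT u. (norm (g u))\<^sup>2)"
    by (rule integral_monotone_convergence[OF Fint _ _ lim]) (use mono Flim in auto)
qed

section \<open>The kernel \<open>1/(e\<^sup>z - 1) - 1/z\<close>\<close>

lemma integrable_exp_abs:
  assumes "c > 0"
  shows "integrable lborel (\<lambda>u::real. exp (- c * \<bar>u\<bar>))"
proof -
  have 1: "set_integrable lborel {0..} (\<lambda>u. exp (- c * u))"
  proof -
    have "(\<lambda>u. exp (- c * u)) absolutely_integrable_on {0..}"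
      using integrable_on_exp_minus_to_infinity[OF assms, of 0]
      by (intro nonnegative_absolutely_integrable_1) auto
    then show ?thesis
      unfolding set_integrable_def by (subst (asm) integrable_completion) auto
  qed
  have 2: "set_integrable lborel {..0} (\<lambda>u. exp (c * u))"
    using lborel_integrable_real_affine[of "\<lambda>u. indicator {0..} u *\<^sub>R exp (- c * u)" "-1" 0] 1
    unfolding set_integrable_def by (simp add: indicator_def)
  have "set_integrable lborel ({0..} \<union> {..0}) (\<lambda>u. exp (- c * \<bar>u\<bar>))"
  proof (rule set_integrable_Un)
    show "set_integrable lborel {0..} (\<lambda>u. exp (- c * \<bar>u\<bar>))"
      by (subst set_integrable_cong[OF refl refl, of _ _ "\<lambda>u. exp (- c * u)"]) (use 1 in auto)
    show "set_integrable lborel {..0} (\<lambda>u. exp (- c * \<bar>u\<bar>))"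
      by (subst set_integrable_cong[OF refl refl, of _ _ "\<lambda>u. exp (c * u)"]) (use 2 in auto)
  qed auto
  moreover have "{0::real..} \<union> {..0} = UNIV" by auto
  ultimately show ?thesis by (simp add: set_integrable_def)
qed

lemma holomorphic_on_balls:
  assumes "\<And>n::nat. f holomorphic_on ball 0 (real n)"
  shows "f holomorphic_on A"
proof -
  have "f holomorphic_on (\<Union>n\<in>UNIV. ball 0 (real n))"
    using assms by (subst holomorphic_on_UN_open) auto
  moreover have "A \<subseteq> (\<Union>n\<in>UNIV. ball 0 (real n))"
    using reals_Archimedean2 by auto
  ultimately show ?thesis by (rule holomorphic_on_subset)
qed

text \<open>The entire function \<open>(e\<^sup>z - 1 - z)/z\<^sup>2\<close>. Written through it, the kernel is a quotient of entire functions
whose denominator \<open>(e\<^sup>z - 1)/z\<close> does not vanish at \<open>0\<close>, so no removable singularity has to be treated.\<close>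

definition exp_tail2 :: "complex \<Rightarrow> complex" where
  "exp_tail2 z = (\<Sum>n. z ^ n / fact (n + 2))"

definition bose :: "complex \<Rightarrow> complex" where
  "bose z = - exp_tail2 z / (1 + z * exp_tail2 z)"

lemma exp_tail2_sums: "(\<lambda>n. z ^ n / fact (n + 2)) sums exp_tail2 z"
proof -
  have "summable (\<lambda>n. norm z ^ n / fact n)" using summable_exp_generic[of "norm z"]
    by (simp add: field_simps)
  then have "summable (\<lambda>n. z ^ n / fact (n + 2))"
    by (rule summable_comparison_test'[of _ 0])
       (auto simp: norm_divide norm_power norm_fact simp del: fact_Suc add_2_eq_Suc'
          intro!: divide_left_mono fact_mono)
  then show ?thesis unfolding exp_tail2_def by (rule summable_sums)
qed

lemma exp_tail2_eq: "z\<^sup>2 * exp_tail2 z = exp z - 1 - z"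
proof -
  have "(\<lambda>n. z ^ n / fact n) sums exp z" using exp_converges[of z] by (simp add: scaleR_conv_of_real field_simps)
  then have "(\<lambda>n. z ^ (n + 2) / fact (n + 2)) sums (exp z - (\<Sum>n<2. z ^ n / fact n))"
    by (rule sums_split_initial_segment)
  moreover have "(\<lambda>n. z\<^sup>2 * (z ^ n / fact (n + 2))) sums (z\<^sup>2 * exp_tail2 z)"
    by (intro sums_mult exp_tail2_sums)
  ultimately have "exp z - (\<Sum>n<2. z ^ n / fact n) = z\<^sup>2 * exp_tail2 z"
    by (intro sums_unique2) (simp_all add: power_add mult_ac del: fact_Suc add_2_eq_Suc')
  moreover have "(\<Sum>n<2. z ^ n / fact n) = 1 + z" by (simp add: numeral_2_eq_2)
  ultimately show ?thesis by (simp add: diff_diff_eq)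
qed

lemma holomorphic_exp_tail2: "exp_tail2 holomorphic_on A"
  by (rule holomorphic_on_balls, rule power_series_holomorphic[of _ _ "\<lambda>n. 1 / fact (n + 2)"])
     (simp add: exp_tail2_sums del: fact_Suc add_2_eq_Suc')

lemma bose_eq:
  assumes "z \<noteq> 0" "exp z \<noteq> 1"
  shows "bose z = 1 / (exp z - 1) - 1 / z"
proof -
  have 1: "exp_tail2 z = (exp z - 1 - z) / z\<^sup>2"
    using exp_tail2_eq[of z] assms by (simp add: field_simps)
  have 2: "1 + z * exp_tail2 z = (exp z - 1) / z"
    unfolding 1 using assms by (simp add: field_simps power2_eq_square)
  show ?thesis unfolding bose_def 2 unfolding 1 using assms
    by (simp add: divide_simps power2_eq_square)
qed

lemma exp_ne_1:
  fixes z :: complex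
  assumes "z \<noteq> 0" "Re z > 0 \<or> norm z < 2 * pi"
  shows "exp z \<noteq> 1"
proof
  assume "exp z = 1"
  then obtain n :: int where n: "Re z = 0" "Im z = of_int (2 * n) * pi" by (auto simp: exp_eq_1)
  with assms have "norm z < 2 * pi" by auto
  then have "\<bar>Im z\<bar> < 2 * pi" using abs_Im_le_cmod[of z] by linarith
  then have "n = 0" using n by (simp add: abs_mult)
  with n assms show False by (auto simp: complex_eq_iff)
qed

lemma holomorphic_bose: "bose holomorphic_on {z. Re z > 0 \<or> norm z < 2 * pi}"
proof -
  have "1 + z * exp_tail2 z \<noteq> 0" if "Re z > 0 \<or> norm z < 2 * pi" for z
  proof (cases "z = 0")
    case False
    have "z * (1 + z * exp_tail2 z) = exp z - 1"
      using exp_tail2_eq[of z] by (simp add: algebra_simps power2_eq_square)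
    then show ?thesis using exp_ne_1[OF False that] by auto
  qed auto
  then show ?thesis unfolding bose_def
    by (auto intro!: holomorphic_intros holomorphic_exp_tail2)
qed

lemma bose_bound_ball: obtains C where "C > 0" "\<And>z. norm z \<le> 2 \<Longrightarrow> norm (bose z) \<le> C"
proof -
  have "cball 0 2 \<subseteq> {z::complex. Re z > 0 \<or> norm z < 2 * pi}" using pi_gt3 by auto
  then have "continuous_on (cball 0 2) bose"
    using holomorphic_bose holomorphic_on_imp_continuous_on continuous_on_subset by blast
  then have "bounded (bose ` cball 0 2)" by (intro compact_imp_bounded compact_continuous_image) auto
  then obtain C where "C > 0" "\<forall>x\<in>bose ` cball 0 2. norm x \<le> C" using bounded_pos by blast
  then show ?thesis by (intro that) auto
qed

lemma norm_exp_minus_1_ge: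
  fixes w :: complex
  shows "exp (Re w) - 1 \<le> norm (exp w - 1)"
  using norm_triangle_ineq2[of "exp w" 1] by simp

text \<open>In a sector around the positive axis both \<open>|e\<^sup>w - 1| \<ge> e\<^bsup>Re w\<^esup> - 1 \<ge> Re w\<close> and \<open>|w|\<close> dominate \<open>\<kappa>|w|\<close>. The explicit
dependence on \<open>\<kappa>\<close> is what later yields a polynomial bound for zeta.\<close>

lemma bose_bound_sector:
  fixes w :: complex
  assumes w: "w \<noteq> 0" "\<kappa> * norm w \<le> Re w" and \<kappa>: "0 < \<kappa>" "\<kappa> \<le> 1"
  shows "norm (bose w) \<le> 2 / (\<kappa> * norm w)"
proof -
  have pos: "0 < \<kappa> * norm w" using w \<kappa> by simp
  then have "0 < Re w" using w by linarith
  then have "exp w \<noteq> 1" using exp_ne_1[of w] w by auto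
  have "\<kappa> * norm w \<le> exp (Re w) - 1" using w exp_ge_add_one_self[of "Re w"] by linarith
  then have ge: "\<kappa> * norm w \<le> norm (exp w - 1)" using norm_exp_minus_1_ge[of w] by linarith
  have "norm (bose w) \<le> norm (1 / (exp w - 1)) + norm (1 / w)"
    unfolding bose_eq[OF w(1) \<open>exp w \<noteq> 1\<close>] by (rule norm_triangle_ineq4)
  also have "\<dots> \<le> 1 / (\<kappa> * norm w) + 1 / (\<kappa> * norm w)"
  proof (rule add_mono)
    show "norm (1 / (exp w - 1)) \<le> 1 / (\<kappa> * norm w)"
      unfolding norm_divide norm_one using ge pos by (intro frac_le) auto
    have "\<kappa> * norm w \<le> norm w" using \<kappa> by (simp add: mult_left_le_one_le)
    then show "norm (1 / w) \<le> 1 / (\<kappa> * norm w)"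
      unfolding norm_divide norm_one using pos by (intro frac_le) auto
  qed
  finally show ?thesis by simp
qed

lemma bose_exp_bound:
  obtains C0 where "C0 > 0" "\<And>\<kappa> z. 0 < \<kappa> \<Longrightarrow> \<kappa> \<le> cos (Im z) \<Longrightarrow>
    norm (bose (exp z)) * exp (Re z / 2) \<le> (C0 + 2 / \<kappa>) * exp (- \<bar>Re z\<bar> / 2)"
proof -
  obtain C0 where C0: "C0 > 0" "\<And>z. norm z \<le> 2 \<Longrightarrow> norm (bose z) \<le> C0" by (rule bose_bound_ball) blast
  show ?thesis
  proof (rule that[OF C0(1)])
    fix \<kappa> :: real and z assume "0 < \<kappa>" and z: "\<kappa> \<le> cos (Im z)"
    then have \<kappa>: "0 < \<kappa>" "\<kappa> \<le> 1" using cos_le_one[of "Im z"] by linarith+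
    show "norm (bose (exp z)) * exp (Re z / 2) \<le> (C0 + 2 / \<kappa>) * exp (- \<bar>Re z\<bar> / 2)"
    proof (cases "Re z \<le> 0")
      case True
      then have "norm (exp z) \<le> 2" by (simp add: order_trans[of _ 1])
      then have "norm (bose (exp z)) \<le> C0 + 2 / \<kappa>" using C0 \<kappa> by (simp add: add_increasing2)
      then show ?thesis using True by simp
    next
      case False
      have "norm (bose (exp z)) \<le> 2 / (\<kappa> * norm (exp z))"
        using z \<kappa> by (intro bose_bound_sector) (auto simp: Re_exp mult.commute)
      also have "\<dots> = 2 / \<kappa> * exp (- Re z)" by (simp add: exp_minus divide_simps)
      also have "\<dots> \<le> (C0 + 2 / \<kappa>) * exp (- Re z)" using C0 by (intro mult_right_mono) auto
      finally have "norm (bose (exp z)) * exp (Re z / 2) \<le> (C0 + 2 / \<kappa>) * exp (- Re z) * exp (Re z / 2)"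
        by (rule mult_right_mono) simp
      also have "\<dots> = (C0 + 2 / \<kappa>) * exp (- Re z / 2)" 
        unfolding mult.assoc exp_add[symmetric] by simp
      finally show ?thesis using False by simp
    qed
  qed
qed

section \<open>Two-sided Laplace transforms\<close>

lemma exp_power_le:
  fixes x :: real assumes "0 \<le> x" shows "x ^ n / fact n \<le> exp x"
  using sum_le_suminf[OF summable_exp_generic[of x], of "{n}"] assms
  by (simp add: exp_def field_simps)

text \<open>Expanding \<open>exp (s u)\<close> and integrating termwise gives a power series in \<open>s\<close>; the two-sided
exponential moment of \<open>k\<close> dominates all partial sums.\<close>

lemma holomorphic_laplace:
  fixes k :: "real \<Rightarrow> complex"
  assumes [measurable]: "k \<in> borel_measurable borel"
    and int: "\<And>r. r < R \<Longrightarrow> integrable lborel (\<lambda>u. exp (r * \<bar>u\<bar>) * norm (k u))"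
  shows "(\<lambda>s. LBINT u. k u * exp (s * of_real u)) holomorphic_on ball 0 R"
proof (rule power_series_holomorphic[of _ _ "\<lambda>n. LBINT u. k u * (of_real u ^ n / fact n)"])
  fix s :: complex assume s: "s \<in> ball 0 R"
  define f where "f n u = k u * (of_real u ^ n / fact n) * s ^ n" for n and u :: real
  have [measurable]: "f n \<in> borel_measurable borel" for n unfolding f_def by measurable
  have I: "integrable lborel (\<lambda>u. exp (norm s * \<bar>u\<bar>) * norm (k u))" using s by (intro int) auto
  have nf: "norm (f n u) = norm (k u) * ((norm s * \<bar>u\<bar>) ^ n / fact n)" for n u
    by (simp add: f_def norm_mult norm_divide norm_power power_mult_distrib)
  have expsums: "(\<lambda>n. (norm s * \<bar>u\<bar>) ^ n / fact n) sums exp (norm s * \<bar>u\<bar>)" for u :: real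
    using exp_converges[of "norm s * \<bar>u\<bar>"] by (simp add: field_simps)
  have fi: "integrable lborel (f n)" for n
    by (rule Bochner_Integration.integrable_bound[OF I])
       (auto simp: nf mult.commute[of "exp _"] simp del: times_divide_eq_right
          intro!: mult_left_mono exp_power_le)
  have s1: "(\<lambda>n. f n u) sums (k u * exp (s * of_real u))" for u
  proof -
    have "(\<lambda>n. (s * of_real u) ^ n / fact n) sums exp (s * of_real u)"
      using exp_converges[of "s * of_real u"] by (simp add: scaleR_conv_of_real field_simps)
    from sums_mult[OF this, of "k u"] show ?thesis by (simp add: f_def power_mult_distrib mult_ac)
  qed
  have "(\<lambda>n. integral\<^sup>L lborel (f n)) sums (LBINT u. (\<Sum>n. f n u))"
  proof (rule sums_integral[OF fi])
    show "AE u in lborel. summable (\<lambda>n. norm (f n u))"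
      unfolding nf using expsums by (intro AE_I2 summable_mult) (auto simp: sums_iff)
    show "summable (\<lambda>n. LBINT u. norm (f n u))"
    proof (rule summableI_nonneg_bounded)
      fix N
      have "(\<Sum>n<N. LBINT u. norm (f n u)) = (LBINT u. (\<Sum>n<N. norm (f n u)))"
        using fi by (subst Bochner_Integration.integral_sum) auto
      also have "\<dots> \<le> (LBINT u. exp (norm s * \<bar>u\<bar>) * norm (k u))"
      proof (rule integral_mono[OF _ I])
        show "integrable lborel (\<lambda>u. \<Sum>n<N. norm (f n u))" using fi by auto
        fix u
        have "(\<Sum>n<N. (norm s * \<bar>u\<bar>) ^ n / fact n) \<le> exp (norm s * \<bar>u\<bar>)"
          using expsums[of u] sum_le_suminf[of "\<lambda>n. (norm s * \<bar>u\<bar>) ^ n / fact n" "{..<N}"] by (auto simp: sums_iff)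
        from mult_left_mono[OF this, of "norm (k u)"]
        show "(\<Sum>n<N. norm (f n u)) \<le> exp (norm s * \<bar>u\<bar>) * norm (k u)"
          by (simp add: nf sum_distrib_left mult_ac)
      qed
      finally show "(\<Sum>n<N. LBINT u. norm (f n u)) \<le> (LBINT u. exp (norm s * \<bar>u\<bar>) * norm (k u))" .
    qed simp
  qed
  also have "(\<lambda>u. \<Sum>n. f n u) = (\<lambda>u. k u * exp (s * of_real u))" using s1 by (simp add: sums_iff fun_eq_iff)
  also have "(\<lambda>n. integral\<^sup>L lborel (f n)) = (\<lambda>n. (LBINT u. k u * (of_real u ^ n / fact n)) * (s - 0) ^ n)"
    unfolding f_def by (subst Bochner_Integration.integral_mult_left_zero) simp
  finally show "(\<lambda>n. (LBINT u. k u * (of_real u ^ n / fact n)) * (s - 0) ^ n) sums (LBINT u. k u * exp (s * of_real u))" .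
qed

section \<open>Continuation of the zeta function\<close>

lemma exp_lower_integral:
  fixes z :: complex
  assumes z: "Re z > 0"
  shows "set_integrable lborel {..<0} (\<lambda>u. exp (z * of_real u))"
    and "(LBINT u:{..<0}. exp (z * of_real u)) = 1 / z"
proof -
  have z0: "z \<noteq> 0" using z by auto
  have int: "integrable lborel (\<lambda>u. exp (- Re z * \<bar>u\<bar>))" by (rule integrable_exp_abs[OF z])
  show si: "set_integrable lborel {..<0} (\<lambda>u. exp (z * of_real u))"
    unfolding set_integrable_def
    by (rule Bochner_Integration.integrable_bound[OF int]) (auto simp: indicator_def)
  have ei: "einterval (-\<infinity>) 0 = {..<0}" by (auto simp: einterval_def)
  have "(LBINT u=-\<infinity>..0. exp (z * of_real u)) = 1 / z - 0"
  proof (rule interval_integral_FTC_integrable[where F = "\<lambda>u. exp (z * of_real u) / z"])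
    show "((\<lambda>u. exp (z * of_real u) / z) has_vector_derivative exp (z * of_real x)) (at x)" for x :: real
    proof -
      have "((\<lambda>u. exp (z * u) / z) has_field_derivative exp (z * of_real x)) (at (of_real x))"
        using z0 by (auto intro!: derivative_eq_intros)
      from field_vector_diff_chain_at[OF has_vector_derivative_of_real[OF DERIV_ident] this]
      show ?thesis by (simp add: o_def)
    qed
    show "set_integrable lborel (einterval (-\<infinity>) 0) (\<lambda>u. exp (z * of_real u))" using si by (simp add: ei)
    have "((\<lambda>u. exp (Re z * u) / norm z) \<longlongrightarrow> 0) at_bot" using z z0 by real_asymp
    then have "((\<lambda>u. exp (z * of_real u) / z) \<longlongrightarrow> 0) at_bot"
      by (subst tendsto_norm_zero_iff[symmetric]) (simp add: norm_divide)
    then show "(((\<lambda>u. exp (z * of_real u) / z) \<circ> real_of_ereal) \<longlongrightarrow> 0) (at_right (-\<infinity>))"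
      by (simp add: ereal_tendsto_simps)
    have "((\<lambda>u. exp (z * of_real u) / z) \<longlongrightarrow> exp (z * of_real 0) / z) (at_left (0::real))"
      using z0 by (intro tendsto_intros) 
    then show "(((\<lambda>u. exp (z * of_real u) / z) \<circ> real_of_ereal) \<longlongrightarrow> 1 / z) (at_left 0)"
      unfolding zero_ereal_def ereal_tendsto_simps by simp
  qed (auto intro!: continuous_intros)
  then show "(LBINT u:{..<0}. exp (z * of_real u)) = 1 / z"
    by (simp add: interval_lebesgue_integral_def ei)
qed

lemma exp_upper_integral:
  fixes z :: complex
  assumes z: "Re z > 0"
  shows "set_integrable lborel {0..} (\<lambda>u. exp (- z * of_real u))"
    and "(LBINT u:{0..}. exp (- z * of_real u)) = 1 / z"
proof -
  have int: "integrable lborel (\<lambda>u. exp (- Re z * \<bar>u\<bar>))" by (rule integrable_exp_abs[OF z])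
  show "set_integrable lborel {0..} (\<lambda>u. exp (- z * of_real u))"
    unfolding set_integrable_def
    by (rule Bochner_Integration.integrable_bound[OF int]) (auto simp: indicator_def)
  have "(LBINT u:{0..}. exp (- z * of_real u)) = (LBINT u:{..0}. exp (z * of_real u))"
    using lborel_integral_real_affine[of "-1" "\<lambda>u. indicator {0..} u *\<^sub>R exp (- z * of_real u)" 0]
    unfolding set_lebesgue_integral_def by (simp add: indicator_def)
  also have "\<dots> = (LBINT u:{..<0}. exp (z * of_real u))"
    unfolding set_lebesgue_integral_def
    by (rule integral_cong_AE, simp, simp)
       (use AE_lborel_singleton[of 0] in \<open>eventually_elim, auto simp: indicator_def\<close>)
  finally show "(LBINT u:{0..}. exp (- z * of_real u)) = 1 / z"
    using exp_lower_integral(2)[OF z] by simp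
qed

text \<open>In the logarithmic variable \<open>x = exp u\<close> Mellin transforms become two-sided Laplace transforms, and
\<open>b(exp u)\<close> is this function minus \<open>exp (- u)\<close>.\<close>

definition planck :: "real \<Rightarrow> complex" where
  "planck u = 1 / (exp (of_real (exp u)) - 1)"

lemma planck_measurable [measurable]: "planck \<in> borel_measurable borel"
  unfolding planck_def by measurable

lemma bose_exp_of_real: "bose (exp (of_real u)) = planck u - exp (- of_real u)"
  by (subst bose_eq) (auto intro!: exp_ne_1 simp: planck_def exp_of_real exp_minus divide_simps simp flip: of_real_exp)

lemma power_le_exp_minus_1:
  fixes x :: real assumes "0 \<le> x" shows "x ^ Suc n / fact (Suc n) \<le> exp x - 1"
  using sum_le_suminf[OF summable_exp_generic[of x], of "{0, Suc n}"] assms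
  by (simp add: exp_def divide_inverse mult.commute del: fact_Suc power_Suc)

lemma planck_bound: "norm (planck u) \<le> fact (Suc n) * exp (- real (Suc n) * u)"
proof -
  have ge: "exp u ^ Suc n / fact (Suc n) \<le> exp (exp u) - 1" by (rule power_le_exp_minus_1) simp
  have pos: "exp u ^ Suc n / fact (Suc n) > 0" by simp
  have "norm (planck u) = 1 / (exp (exp u) - 1)"
  proof -
    have "planck u = of_real (1 / (exp (exp u) - 1))" by (simp add: planck_def exp_of_real)
    then show ?thesis by (simp only: norm_of_real) simp
  qed
  also have "\<dots> \<le> 1 / (exp u ^ Suc n / fact (Suc n))"
    using ge pos by (intro frac_le) (auto simp del: fact_Suc power_Suc)
  also have "\<dots> = fact (Suc n) * exp (- real (Suc n) * u)"
    by (simp add: exp_minus exp_of_nat_mult divide_inverse del: fact_Suc power_Suc of_nat_Suc)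
  finally show ?thesis .
qed

lemma planck_exp_integrable:
  "integrable lborel (\<lambda>u. exp (r * \<bar>u\<bar>) * norm (indicator {0..} u *\<^sub>R planck u))"
proof -
  obtain n :: nat where n: "r < real n" using reals_Archimedean2 by blast
  have int: "integrable lborel (\<lambda>u::real. fact (Suc n) * exp (- 1 * \<bar>u\<bar>))"
    by (intro integrable_mult_right integrable_exp_abs[OF zero_less_one])
  show ?thesis
  proof (rule Bochner_Integration.integrable_bound[OF int])
    have "exp (r * \<bar>u\<bar>) * norm (indicator {0..} u *\<^sub>R planck u) \<le> fact (Suc n) * exp (- 1 * \<bar>u\<bar>)" for u
    proof (cases "u \<ge> 0")
      case True
      have "exp (r * \<bar>u\<bar>) * norm (indicator {0..} u *\<^sub>R planck u) \<le> exp (r * u) * (fact (Suc n) * exp (- real (Suc n) * u))"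
        using True mult_left_mono[OF planck_bound[of u n], of "exp (r * u)"] by (simp del: fact_Suc of_nat_Suc)
      also have "\<dots> = fact (Suc n) * exp ((r - real (Suc n)) * u)"
        by (simp add: mult_exp_exp algebra_simps del: fact_Suc)
      also have "\<dots> \<le> fact (Suc n) * exp (- 1 * u)"
        using n True by (intro mult_left_mono iffD2[OF exp_le_cancel_iff] mult_right_mono) auto
      finally show ?thesis using True by simp
    qed auto
    then show "AE u in lborel. norm (exp (r * \<bar>u\<bar>) * norm (indicator {0..} u *\<^sub>R planck u))
        \<le> norm (fact (Suc n) * exp (- 1 * \<bar>u\<bar>))"
      by (intro AE_I2) (auto simp del: fact_Suc intro: order_trans[OF _ abs_ge_self])
  qed simp
qed

text \<open>The part of the Mellin integral \<open>\<Gamma>(s)\<zeta>(s) = \<integral>\<^sub>0\<^sup>\<infinity> x\<^bsup>s-1\<^esup>/(e\<^sup>x - 1) dx\<close> over \<open>x \<ge> 1\<close>.\<close>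

definition zeta_upper :: "complex \<Rightarrow> complex" where
  "zeta_upper s = (LBINT u:{0..}. planck u * exp (s * of_real u))"

lemma zeta_upper_integrable: "set_integrable lborel {0..} (\<lambda>u. planck u * exp (s * of_real u))"
  unfolding set_integrable_def
proof (rule Bochner_Integration.integrable_bound[OF planck_exp_integrable[of "\<bar>Re s\<bar>"]])
  show "AE u in lborel. norm (indicator {0..} u *\<^sub>R (planck u * exp (s * of_real u)))
      \<le> norm (exp (\<bar>Re s\<bar> * \<bar>u\<bar>) * norm (indicator {0..} u *\<^sub>R planck u))"
    by (intro AE_I2) (auto simp: indicator_def norm_mult mult.commute[of _ "norm (planck _)"] 
        intro!: mult_left_mono mult_right_mono)
qed simp

lemma holomorphic_zeta_upper: "zeta_upper holomorphic_on A"
proof (rule holomorphic_on_balls)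
  fix n :: nat
  have "(\<lambda>s. LBINT u. (indicator {0..} u *\<^sub>R planck u) * exp (s * of_real u)) holomorphic_on ball 0 (real n)"
    by (intro holomorphic_laplace planck_exp_integrable) simp
  then show "zeta_upper holomorphic_on ball 0 (real n)"
    by (simp add: zeta_upper_def[abs_def] set_lebesgue_integral_def)
qed

definition bose_coeff :: "nat \<Rightarrow> complex" where
  "bose_coeff k = (deriv ^^ k) bose 0 / fact k"

lemma bose_sums: "norm z < 2 * pi \<Longrightarrow> (\<lambda>k. bose_coeff k * z ^ k) sums bose z"
  using holomorphic_power_series[OF holomorphic_on_subset[OF holomorphic_bose, of "ball 0 (2 * pi)"], of z]
  by (auto simp: bose_coeff_def subset_iff)

lemma summable_bose_coeff: "summable (\<lambda>k. norm (bose_coeff k))"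
proof -
  have "norm (2::complex) < 2 * pi" using pi_gt3 by simp
  then have "summable (\<lambda>k. bose_coeff k * 2 ^ k)" using bose_sums sums_summable by blast
  then have "summable (\<lambda>k. norm (bose_coeff k * 1 ^ k))" by (rule powser_insidea) simp
  then show ?thesis by simp
qed

text \<open>The entire extension of \<open>1 / (\<Gamma>(s)(s + k))\<close>: the zero of \<open>1/\<Gamma>\<close> at \<open>-k\<close> removes the pole.\<close>

definition rGamma_quot :: "nat \<Rightarrow> complex \<Rightarrow> complex" where
  "rGamma_quot k s = pochhammer s k * rGamma (s + of_nat k + 1)"

lemma rGamma_quot_eq: "s + of_nat k \<noteq> 0 \<Longrightarrow> rGamma_quot k s = rGamma s / (s + of_nat k)"
  using pochhammer_rGamma[of s "Suc k"] by (simp add: rGamma_quot_def pochhammer_Suc field_simps add_ac)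

lemma holomorphic_pochhammer: "(\<lambda>s::complex. pochhammer s k) holomorphic_on A"
  by (induction k) (auto simp: pochhammer_Suc intro!: holomorphic_intros)

lemma holomorphic_rGamma_quot: "rGamma_quot k holomorphic_on A"
  unfolding rGamma_quot_def by (intro holomorphic_intros holomorphic_pochhammer)

text \<open>Termwise integration of the Taylor series of \<open>b\<close> over \<open>[0, 1]\<close> gives \<open>\<Sum>\<^sub>k c\<^sub>k / (s + k)\<close>; this is that series
divided by \<open>\<Gamma>(s)\<close>, in a form that makes sense for every \<open>s\<close>. It converges since the Taylor series has
radius \<open>2\<pi> > 1\<close>.\<close>

definition zeta_lower :: "complex \<Rightarrow> complex" where
  "zeta_lower s = (\<Sum>k. bose_coeff k * rGamma_quot k s)"

text \<open>On a disc of radius \<open>K\<close> only the terms with \<open>k \<le> K\<close> can have poles; they are entire after division by \<open>\<Gamma>\<close>,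
and the remaining series of fractions converges uniformly.\<close>

lemma holomorphic_zeta_lower_ball: "zeta_lower holomorphic_on ball 0 (real K)"
proof -
  define T where "T s = (\<Sum>k. bose_coeff (k + Suc K) / (s + of_nat (k + Suc K)))" for s
  have ge: "1 \<le> norm (s + of_nat (k + Suc K))" if "s \<in> ball 0 (real K)" for s :: complex and k
    using that norm_diff_ineq[of "of_nat (k + Suc K)" s] by (simp add: add.commute del: of_nat_add of_nat_Suc) 
  have sumK: "summable (\<lambda>k. norm (bose_coeff (k + Suc K)))"
    using summable_bose_coeff by (rule summable_ignore_initial_segment)
  have bd: "norm (bose_coeff (k + Suc K) / (s + of_nat (k + Suc K))) \<le> norm (bose_coeff (k + Suc K))"
    if "s \<in> ball 0 (real K)" for s k
    unfolding norm_divide using frac_le[OF norm_ge_zero order_refl zero_less_one ge[OF that, of k], of "bose_coeff (k + Suc K)"] by simp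
  have nz: "s + of_nat (k + Suc K) \<noteq> 0" if "s \<in> ball 0 (real K)" for s :: complex and k
    using ge[OF that, of k] by force
  have "T holomorphic_on ball 0 (real K)"
  proof (rule holomorphic_uniform_sequence[where f = "\<lambda>n s. \<Sum>k<n. bose_coeff (k + Suc K) / (s + of_nat (k + Suc K))"])
    show "(\<lambda>s. \<Sum>k<n. bose_coeff (k + Suc K) / (s + of_nat (k + Suc K))) holomorphic_on ball 0 (real K)" for n
      using nz by (auto intro!: holomorphic_intros simp del: of_nat_add of_nat_Suc)
    fix s :: complex assume s: "s \<in> ball 0 (real K)"
    then obtain d where d: "d > 0" "cball s d \<subseteq> ball 0 (real K)" using open_contains_cball open_ball by meson
    have "uniform_limit (cball s d) (\<lambda>n s. \<Sum>k<n. bose_coeff (k + Suc K) / (s + of_nat (k + Suc K))) T sequentially"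
      unfolding T_def[abs_def] using d bd by (intro Weierstrass_m_test[OF _ sumK]) blast
    with d show "\<exists>d>0. cball s d \<subseteq> ball 0 (real K) \<and> uniform_limit (cball s d) (\<lambda>n s. \<Sum>k<n. bose_coeff (k + Suc K) / (s + of_nat (k + Suc K))) T sequentially"
      by blast
  qed simp
  then have "(\<lambda>s. rGamma s * T s + (\<Sum>k<Suc K. bose_coeff k * rGamma_quot k s)) holomorphic_on ball 0 (real K)"
    by (intro holomorphic_intros holomorphic_rGamma_quot)
  moreover have "rGamma s * T s + (\<Sum>k<Suc K. bose_coeff k * rGamma_quot k s) = zeta_lower s" if s: "s \<in> ball 0 (real K)" for s
  proof -
    have sm: "summable (\<lambda>k. bose_coeff (k + Suc K) / (s + of_nat (k + Suc K)))"
      by (rule summable_comparison_test'[OF sumK]) (use bd[OF s] in auto)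
    have eq: "(\<lambda>k. bose_coeff (k + Suc K) * rGamma_quot (k + Suc K) s) = (\<lambda>k. rGamma s * (bose_coeff (k + Suc K) / (s + of_nat (k + Suc K))))"
      by (intro ext, subst rGamma_quot_eq[OF nz[OF s]]) (simp only: times_divide_eq_right mult.commute)
    have "summable (\<lambda>k. bose_coeff (k + Suc K) * rGamma_quot (k + Suc K) s)"
      unfolding eq by (intro summable_mult sm)
    then have "summable (\<lambda>k. bose_coeff k * rGamma_quot k s)" by (subst (asm) summable_iff_shift)
    then have "zeta_lower s = (\<Sum>k. bose_coeff (k + Suc K) * rGamma_quot (k + Suc K) s) + (\<Sum>k<Suc K. bose_coeff k * rGamma_quot k s)"
      unfolding zeta_lower_def by (rule suminf_split_initial_segment)
    then show ?thesis unfolding eq by (simp only: suminf_mult[OF sm] T_def)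
  qed
  ultimately show ?thesis by (rule holomorphic_transform)
qed

lemma holomorphic_zeta_lower: "zeta_lower holomorphic_on A"
  by (rule holomorphic_on_balls) (rule holomorphic_zeta_lower_ball)

lemma bose_measurable [measurable]: "(\<lambda>u. bose (exp (complex_of_real u))) \<in> borel_measurable borel"
  unfolding bose_exp_of_real by measurable

lemma
  assumes s: "Re s > 0"
  shows bose_lower_integrable: "set_integrable lborel {..<0} (\<lambda>u. bose (exp (of_real u)) * exp (s * of_real u))"
    and zeta_lower_eq: "zeta_lower s = rGamma s * (LBINT u:{..<0}. bose (exp (of_real u)) * exp (s * of_real u))"
proof -
  define f where "f k u = indicator {..<0::real} u *\<^sub>R (bose_coeff k * exp ((s + of_nat k) * of_real u))" for k u
  have re: "Re (s + of_nat k) > 0" for k using s by simp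
  have fi: "integrable lborel (f k)" for k
    using exp_lower_integral(1)[OF re, of k] unfolding f_def set_integrable_def
    by (simp add: scaleR_conv_of_real mult.left_commute)
  have fint: "integral\<^sup>L lborel (f k) = bose_coeff k * (1 / (s + of_nat k))" for k
    using exp_lower_integral(2)[OF re, of k] unfolding f_def set_lebesgue_integral_def
    by (simp add: scaleR_conv_of_real mult.left_commute)
  have nf: "norm (f k u) = norm (bose_coeff k) * Re (indicator {..<0::real} u *\<^sub>R exp (of_real (Re s + real k) * of_real u))" for k u
    by (simp add: f_def norm_mult indicator_def Re_exp)
  have re': "Re (complex_of_real (Re s + real k)) > 0" for k using s by simp
  have nfint: "(LBINT u. norm (f k u)) = norm (bose_coeff k) * (1 / (Re s + real k))" for k
    unfolding nf integral_mult_right_zero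
    using exp_lower_integral[OF re', of k] unfolding set_lebesgue_integral_def set_integrable_def
    by (subst integral_Re) (auto simp del: of_real_add simp: Re_divide_of_real)
  have fsum: "f k u = indicator {..<0} u *\<^sub>R (exp (s * of_real u) * (bose_coeff k * exp (of_real u) ^ k))" for k u
    by (simp add: f_def ring_distribs exp_add exp_of_nat_mult mult_ac)
  have small: "norm (exp (complex_of_real u)) < 2 * pi" if "u < 0" for u
    using that pi_gt3 by (simp add: less_trans[of _ 1])
  have fsums: "(\<lambda>k. f k u) sums (indicator {..<0} u *\<^sub>R (bose (exp (of_real u)) * exp (s * of_real u)))" for u
    unfolding fsum using sums_mult[OF bose_sums[OF small]] by (cases "u < 0") (auto simp: mult.commute[of "bose _"])
  have AE: "AE u in lborel. summable (\<lambda>k. norm (f k u))"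
  proof (intro AE_I2)
    fix u :: real
    show "summable (\<lambda>k. norm (f k u))"
    proof (rule summable_comparison_test'[of "\<lambda>k. norm (exp (s * of_real u)) * norm (bose_coeff k)" 0])
      show "summable (\<lambda>k. norm (exp (s * of_real u)) * norm (bose_coeff k))"
        by (intro summable_mult summable_bose_coeff)
      fix k
      show "norm (norm (f k u)) \<le> norm (exp (s * of_real u)) * norm (bose_coeff k)"
        unfolding fsum by (auto simp: indicator_def norm_mult norm_power power_le_one intro!: mult_left_mono mult_left_le)
    qed
  qed
  have sn: "summable (\<lambda>k. LBINT u. norm (f k u))"
    unfolding nfint
  proof (rule summable_comparison_test'[of "\<lambda>k. norm (bose_coeff k) * (1 / Re s)" 0])
    show "summable (\<lambda>k. norm (bose_coeff k) * (1 / Re s))" by (intro summable_mult2 summable_bose_coeff)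
    show "norm (norm (bose_coeff n) * (1 / (Re s + real n))) \<le> norm (bose_coeff n) * (1 / Re s)" for n
      using s by (auto simp: abs_mult intro!: mult_left_mono divide_left_mono simp del: times_divide_eq_right)
  qed
  have eq: "(\<lambda>u. \<Sum>k. f k u) = (\<lambda>u. indicator {..<0} u *\<^sub>R (bose (exp (of_real u)) * exp (s * of_real u)))"
    using fsums by (simp add: sums_iff fun_eq_iff)
  show "set_integrable lborel {..<0} (\<lambda>u. bose (exp (of_real u)) * exp (s * of_real u))"
    using integrable_suminf[OF fi AE sn] unfolding eq set_integrable_def .
  have S: "(\<lambda>k. bose_coeff k * (1 / (s + of_nat k))) sums (LBINT u:{..<0}. bose (exp (of_real u)) * exp (s * of_real u))"
    using sums_integral[OF fi AE sn] unfolding eq fint set_lebesgue_integral_def .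
  have "s + of_nat k \<noteq> 0" for k using re[of k] by fastforce
  then have "(\<lambda>k. bose_coeff k * rGamma_quot k s) = (\<lambda>k. rGamma s * (bose_coeff k * (1 / (s + of_nat k))))"
    by (simp add: rGamma_quot_eq mult_ac)
  with sums_mult[OF S, of "rGamma s"]
  show "zeta_lower s = rGamma s * (LBINT u:{..<0}. bose (exp (of_real u)) * exp (s * of_real u))"
    unfolding zeta_lower_def by (simp add: sums_iff)
qed


section \<open>The Mellin transform of the kernel\<close>

lemma
  assumes s: "Re s > 0"
  shows Gamma_exp_integrable: "integrable lborel (\<lambda>u. exp (s * of_real u) * exp (- of_real (exp u)))"
    and Gamma_exp_integral: "(LBINT u. exp (s * of_real u) * exp (- of_real (exp u))) = Gamma s"
proof -
  define f where "f t = complex_of_real t powr (s - 1) / of_real (exp t)" for t :: real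
  have [measurable]: "f \<in> borel_measurable borel" unfolding f_def by measurable
  have ai: "f absolutely_integrable_on {0<..}"
    unfolding f_def[abs_def] by (rule absolutely_integrable_Gamma_integral'[OF s])
  have si: "set_integrable lborel {0<..} f"
    using ai unfolding set_integrable_def by (subst (asm) integrable_completion) auto
  have "(LBINT t:{0<..}. f t) = integral {0<..} f"
    by (rule set_borel_integral_eq_integral(2)[OF si])
  also have "\<dots> = Gamma s"
    using Gamma_integral_complex'[OF s] unfolding f_def[abs_def] by (rule integral_unique)
  finally have val: "(LBINT t:{0<..}. f t) = Gamma s" .
  have eq: "(\<lambda>u. exp u *\<^sub>R f (exp u)) = (\<lambda>u. exp (s * of_real u) * exp (- of_real (exp u)))"
  proof
    fix u :: real
    have "complex_of_real (exp u) powr (s - 1) = exp ((s - 1) * of_real u)"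
      by (simp add: powr_def Ln_of_real)
    then have "exp u *\<^sub>R f (exp u) = exp (of_real u) * exp ((s - 1) * of_real u) * exp (- of_real (exp u))"
      by (simp add: f_def scaleR_conv_of_real exp_minus divide_inverse exp_of_real)
    then show "exp u *\<^sub>R f (exp u) = exp (s * of_real u) * exp (- of_real (exp u))"
      by (simp add: mult_exp_exp algebra_simps)
  qed
  show "integrable lborel (\<lambda>u. exp (s * of_real u) * exp (- of_real (exp u)))"
    using si integrable_exp_substitution[of f] eq by simp
  show "(LBINT u. exp (s * of_real u) * exp (- of_real (exp u))) = Gamma s"
    using val integral_exp_substitution[of f] eq by simp
qed

lemma
  assumes s: "Re s > 0" and n: "n > 0"
  defines "f \<equiv> \<lambda>u. exp (s * of_real u) * exp (- (of_nat n * of_real (exp u)))"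
  shows Gamma_exp_scaled_integrable: "integrable lborel f"
    and Gamma_exp_scaled_integral: "integral\<^sup>L lborel f = Gamma s / of_nat n powr s"
proof -
  define g where "g u = exp (s * of_real u) * exp (- complex_of_real (exp u))" for u
  have fg: "f u = (1 / of_nat n powr s) * g (ln (real n) + 1 * u)" for u
    using n by (simp add: f_def g_def powr_def exp_add ring_distribs exp_minus Ln_of_nat exp_of_real)
  have g: "integrable lborel g" "integral\<^sup>L lborel g = Gamma s"
    using Gamma_exp_integrable[OF s] Gamma_exp_integral[OF s] by (simp_all add: g_def[abs_def])
  have "integrable lborel (\<lambda>u. g (ln (real n) + 1 * u))"
    by (rule lborel_integrable_real_affine[OF g(1)]) simp
  then show "integrable lborel f" unfolding fg[abs_def] by simp
  show "integral\<^sup>L lborel f = Gamma s / of_nat n powr s"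
    using lborel_integral_real_affine[of 1 g "ln (real n)"] g(2) unfolding fg[abs_def] by simp
qed

text \<open>The geometric series \<open>1/(e\<^sup>x - 1) = \<Sum>\<^sub>n\<^sub>\<ge>\<^sub>1 e\<^bsup>-nx\<^esup>\<close> integrated termwise; each term contributes \<open>\<Gamma>(s) n\<^bsup>-s\<^esup>\<close>.\<close>

lemma zeta_dirichlet_sums:
  assumes s: "Re s > 1"
  shows "(\<lambda>n. 1 / of_nat (Suc n) powr s) sums (rGamma s * (LBINT u. planck u * exp (s * of_real u)))"
proof -
  define f where "f n u = exp (s * of_real u) * exp (- (of_nat (Suc n) * of_real (exp u)))" for n :: nat and u :: real
  have s0: "Re s > 0" "Re (complex_of_real (Re s)) > 0" using s by auto
  have fi: "integrable lborel (f n)" and fint: "integral\<^sup>L lborel (f n) = Gamma s / of_nat (Suc n) powr s" for n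
    using Gamma_exp_scaled_integrable[OF s0(1), of "Suc n"] Gamma_exp_scaled_integral[OF s0(1), of "Suc n"]
    by (simp_all add: f_def[abs_def] del: of_nat_Suc)
  have nf: "norm (f n u) = Re (exp (of_real (Re s) * of_real u) * exp (- (of_nat (Suc n) * of_real (exp u))))" for n u
    by (simp add: f_def norm_mult Re_exp mult_exp_exp exp_add flip: of_real_mult)
  have nfint: "(LBINT u. norm (f n u)) = Re (Gamma (of_real (Re s))) * (1 / real (Suc n) powr Re s)" for n
  proof -
    have "(LBINT u. norm (f n u)) = Re (Gamma (of_real (Re s)) / of_nat (Suc n) powr (of_real (Re s)))"
      unfolding nf using Gamma_exp_scaled_integrable[OF s0(2), of "Suc n"] Gamma_exp_scaled_integral[OF s0(2), of "Suc n"]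
      by (subst integral_Re) (simp_all del: of_nat_Suc)
    also have "of_nat (Suc n) powr (complex_of_real (Re s)) = of_real (real (Suc n) powr Re s)"
      using powr_of_real[of "real (Suc n)" "Re s"] by (simp del: of_nat_Suc)
    finally show ?thesis by (simp add: Re_divide_of_real)
  qed
  have ex: "norm (exp (- complex_of_real (exp u))) < 1" for u :: real by simp
  have fsum: "f n u = exp (s * of_real u) * (exp (- of_real (exp u)) * exp (- of_real (exp u)) ^ n)" for n u
    using exp_of_nat_mult[of "Suc n" "- complex_of_real (exp u)"] by (simp add: f_def del: of_nat_Suc)
  have fsums: "(\<lambda>n. f n u) sums (planck u * exp (s * of_real u))" for u
  proof -
    have "(\<lambda>n. exp (- of_real (exp u)) ^ n) sums (1 / (1 - exp (- complex_of_real (exp u))))"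
      by (rule geometric_sums[OF ex])
    then have "(\<lambda>n. f n u) sums (exp (s * of_real u) * (exp (- of_real (exp u)) * (1 / (1 - exp (- complex_of_real (exp u))))))"
      unfolding fsum by (intro sums_mult)
    moreover have "exp (- of_real (exp u)) * (1 / (1 - exp (- complex_of_real (exp u)))) = planck u"
    proof -
      have "exp (complex_of_real (exp u)) \<noteq> 1" by (rule exp_ne_1) auto
      then show ?thesis by (simp add: planck_def exp_minus divide_simps)
    qed
    ultimately have "(\<lambda>n. f n u) sums (exp (s * of_real u) * planck u)" by (simp only:)
    then show ?thesis by (simp only: mult.commute[of "planck u"])
  qed
  have AE: "AE u in lborel. summable (\<lambda>n. norm (f n u))"
    unfolding fsum norm_mult norm_power by (intro AE_I2 summable_mult summable_geometric) simp
  have sn: "summable (\<lambda>n. LBINT u. norm (f n u))"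
  proof -
    have "summable (\<lambda>n. 1 / real n powr Re s)"
      using s summable_real_powr_iff[of "- Re s"] by (simp add: powr_minus divide_inverse)
    then have "summable (\<lambda>n. 1 / real (Suc n) powr Re s)"
      using summable_iff_shift[of "\<lambda>n. 1 / real n powr Re s" 1] by simp
    then show ?thesis unfolding nfint by (rule summable_mult)
  qed
  have "(\<lambda>n. integral\<^sup>L lborel (f n)) sums (LBINT u. (\<Sum>n. f n u))"
    by (rule sums_integral[OF fi AE sn])
  also have "(\<lambda>u. \<Sum>n. f n u) = (\<lambda>u. planck u * exp (s * of_real u))"
    using fsums by (simp add: sums_iff fun_eq_iff)
  finally have "(\<lambda>n. rGamma s * (Gamma s / of_nat (Suc n) powr s)) sums (rGamma s * (LBINT u. planck u * exp (s * of_real u)))"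
    unfolding fint by (rule sums_mult)
  moreover have "s \<notin> \<int>\<^sub>\<le>\<^sub>0" using s0 by (auto elim!: nonpos_Ints_cases)
  then have "rGamma s * Gamma s = 1" by (simp add: rGamma_inverse_Gamma Gamma_eq_zero_iff)
  then have "(\<lambda>n. rGamma s * (Gamma s / of_nat (Suc n) powr s)) = (\<lambda>n. 1 / of_nat (Suc n) powr s)"
    by (simp del: of_nat_Suc)
  ultimately show ?thesis by simp
qed

lemma integral_split_at_zero:
  fixes f :: "real \<Rightarrow> complex"
  assumes "set_integrable lborel {..<0} f" "set_integrable lborel {0..} f"
  shows "integral\<^sup>L lborel f = (LBINT u:{..<0}. f u) + (LBINT u:{0..}. f u)"
proof -
  have U: "{..<0::real} \<union> {0..} = UNIV" by auto
  show "integral\<^sup>L lborel f = (LBINT u:{..<0}. f u) + (LBINT u:{0..}. f u)"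
    using set_integral_Un[OF _ assms] unfolding U by (simp add: set_lebesgue_integral_def disjoint_iff)
qed

text \<open>The third summand is \<open>1/\<Gamma>(s)\<close> times \<open>\<integral>\<^sub>0\<^sup>1 x\<^bsup>s-2\<^esup> dx\<close>, the contribution of the pole of \<open>1/(e\<^sup>x - 1)\<close> at \<open>0\<close>.
For \<open>0 < Re s < 1\<close> the same fraction is \<open>-\<integral>\<^sub>1\<^sup>\<infinity> x\<^bsup>s-2\<^esup> dx\<close>, which turns \<open>1/(e\<^sup>x - 1)\<close> into \<open>b(x)\<close> on
all of \<open>(0, \<infinity>)\<close>; hence the two representations of \<open>\<Gamma>\<zeta>\<close> below.
The value at \<open>1\<close> follows the convention in the definition of \<open>riemann_zeta\<close>.\<close>

definition zeta_ext :: "complex \<Rightarrow> complex" where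
  "zeta_ext s = (if s = 1 then 0 else rGamma s * zeta_upper s + zeta_lower s + rGamma s / (s - 1))"

lemma holomorphic_zeta_ext: "zeta_ext holomorphic_on (- {1})"
proof -
  have "(\<lambda>s. rGamma s * zeta_upper s + zeta_lower s + rGamma s / (s - 1)) holomorphic_on (- {1})"
    by (intro holomorphic_intros holomorphic_zeta_upper holomorphic_zeta_lower) auto
  then show ?thesis by (rule holomorphic_transform) (auto simp: zeta_ext_def)
qed

lemma zeta_ext_dirichlet:
  assumes s: "Re s > 1"
  shows "(\<lambda>n. 1 / of_nat (Suc n) powr s) sums zeta_ext s"
proof -
  have s1: "s \<noteq> 1" and re: "Re (s - 1) > 0" and s0: "Re s > 0" using s by auto
  have split: "bose (exp (of_real u)) * exp (s * of_real u) + exp ((s - 1) * of_real u) = planck u * exp (s * of_real u)" for u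
    by (simp add: bose_exp_of_real ring_distribs left_diff_distrib exp_diff exp_minus divide_inverse)
  note lo = set_integral_add[OF bose_lower_integrable[OF s0] exp_lower_integral(1)[OF re], unfolded split]
  have "(LBINT u. planck u * exp (s * of_real u)) =
      (LBINT u:{..<0}. bose (exp (of_real u)) * exp (s * of_real u)) + 1 / (s - 1) + zeta_upper s"
    using integral_split_at_zero[OF lo(1) zeta_upper_integrable] lo(2) exp_lower_integral(2)[OF re]
    by (simp add: zeta_upper_def)
  then have "zeta_ext s = rGamma s * (LBINT u. planck u * exp (s * of_real u))"
    using s1 by (simp add: zeta_ext_def zeta_lower_eq[OF s0] algebra_simps)
  then show ?thesis using zeta_dirichlet_sums[OF s] by simp
qed

lemma bose_exp_integral:
  assumes s: "0 < Re s" "Re s < 1"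
  shows "(LBINT u. bose (exp (of_real u)) * exp (s * of_real u)) = Gamma s * zeta_ext s"
proof -
  have s1: "s \<noteq> 1" and re: "Re (1 - s) > 0" using s by auto
  have split: "planck u * exp (s * of_real u) - exp (- (1 - s) * of_real u) = bose (exp (of_real u)) * exp (s * of_real u)" for u
    by (simp add: bose_exp_of_real algebra_simps mult_exp_exp)
  note up = set_integral_diff[OF zeta_upper_integrable exp_upper_integral(1)[OF re], of s, unfolded split]
  have I: "(LBINT u. bose (exp (of_real u)) * exp (s * of_real u)) =
      (LBINT u:{..<0}. bose (exp (of_real u)) * exp (s * of_real u)) + (zeta_upper s - 1 / (1 - s))"
    using integral_split_at_zero[OF bose_lower_integrable[OF s(1)] up(1)] up(2) exp_upper_integral(2)[OF re]
    by (simp add: zeta_upper_def)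
  have "s \<notin> \<int>\<^sub>\<le>\<^sub>0" using s by (auto elim!: nonpos_Ints_cases)
  then have G: "Gamma s * rGamma s = 1" by (simp add: rGamma_inverse_Gamma Gamma_eq_zero_iff)
  have "1 / (s - 1) = - (1 / (1 - s))" by (simp add: minus_divide_right)
  then have "zeta_ext s = rGamma s * (LBINT u. bose (exp (of_real u)) * exp (s * of_real u))"
    unfolding I using s1 by (simp add: zeta_ext_def zeta_lower_eq[OF s(1)] ring_distribs divide_inverse right_diff_distrib)
  with G show "(LBINT u. bose (exp (of_real u)) * exp (s * of_real u)) = Gamma s * zeta_ext s"
    by (simp add: mult.assoc[symmetric])
qed

theorem riemann_zeta_eq_zeta_ext: "riemann_zeta = zeta_ext"
  unfolding riemann_zeta_def
proof (rule the_equality)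
  show "zeta_ext holomorphic_on - {1} \<and> zeta_ext 1 = 0 \<and>
    (\<forall>s. 1 < Re s \<longrightarrow> (\<lambda>n. 1 / complex_of_nat (Suc n) powr s) sums zeta_ext s)"
    using holomorphic_zeta_ext zeta_ext_dirichlet by (simp add: zeta_ext_def del: of_nat_Suc)
  fix f
  assume f: "f holomorphic_on - {1} \<and> f 1 = 0 \<and>
    (\<forall>s. 1 < Re s \<longrightarrow> (\<lambda>n. 1 / complex_of_nat (Suc n) powr s) sums f s)"
  show "f = zeta_ext"
  proof
    fix z
    show "f z = zeta_ext z"
    proof (cases "z = 1")
      case False
      have "connected (UNIV - {1::complex})"
        by (rule connected_punctured_convex) auto
      then have conn: "connected (- {1::complex})" by (simp add: Compl_eq_Diff_UNIV)
      show ?thesis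
      proof (rule analytic_continuation_open[of "{s. Re s > 1}" "- {1}" f zeta_ext])
        show "{s. Re s > 1} \<noteq> {}" by (auto intro!: exI[of _ 2])
        show "f s = zeta_ext s" if "s \<in> {s. Re s > 1}" for s
          using f zeta_ext_dirichlet[of s] that sums_unique2 by blast
      qed (use f conn False holomorphic_zeta_ext in \<open>auto simp: open_halfspace_Re_gt\<close>)
    qed (use f in \<open>simp add: zeta_ext_def\<close>)
  qed
qed

section \<open>The mean square of zeta as an energy integral\<close>

text \<open>Rotating the ray in a Mellin integral is a vertical shift of the line of integration in the
logarithmic variable. On the strip \<open>f\<close> has a primitive, so the two truncated integrals differ by
increments of the primitive along the short vertical sides, where \<open>f\<close> is small.\<close>

lemma integral_horizontal_shift:
  fixes f :: "complex \<Rightarrow> complex"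
  assumes holo: "f holomorphic_on {z. \<bar>Im z\<bar> < B}" and \<alpha>: "\<bar>\<alpha>\<bar> < B" and c: "c > 0"
    and bd: "\<And>z. \<bar>Im z\<bar> \<le> \<bar>\<alpha>\<bar> \<Longrightarrow> norm (f z) \<le> C * exp (- c * \<bar>Re z\<bar>)"
  shows "(LBINT u. f (of_real u + \<i> * of_real \<alpha>)) = (LBINT u. f (of_real u))"
proof -
  define S where "S = {z::complex. \<bar>Im z\<bar> < B}"
  have S_eq: "S = {z. Im z < B} \<inter> {z. Im z > -B}" by (auto simp: S_def)
  have S: "convex S" "open S" unfolding S_eq
    by (auto intro!: convex_Int convex_halfspace_Im_lt convex_halfspace_Im_gt open_Int open_halfspace_Im_lt open_halfspace_Im_gt)
  obtain P where P0: "\<And>z. z \<in> S \<Longrightarrow> (P has_field_derivative f z) (at z within S)"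
    using holomorphic_convex_primitive'[OF S] holo unfolding S_def by blast
  have P: "(P has_field_derivative f z) (at z)" if "z \<in> S" for z
    using P0[OF that] at_within_open[OF that S(2)] by simp
  have "norm (f 0) \<le> C" using bd[of 0] by simp
  then have C0: "0 \<le> C" using norm_ge_zero[of "f 0"] by linarith
  have contf: "continuous_on S f" using holo unfolding S_def by (rule holomorphic_on_imp_continuous_on)
  define Q where "Q \<beta> n = P (of_real (real n) + \<i> * of_real \<beta>) - P (of_real (- real n) + \<i> * of_real \<beta>)" for \<beta> and n :: nat
  have lim: "Q \<beta> \<longlonglongrightarrow> (LBINT u. f (of_real u + \<i> * of_real \<beta>))"
    if \<beta>: "\<bar>\<beta>\<bar> \<le> \<bar>\<alpha>\<bar>" for \<beta>
  proof -
    have inS: "of_real u + \<i> * of_real \<beta> \<in> S" for u using \<alpha> \<beta> by (auto simp: S_def)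
    have cont: "continuous_on A (\<lambda>u. f (of_real u + \<i> * of_real \<beta>))" for A
      by (rule continuous_on_compose2[OF contf]) (use inS in \<open>auto intro!: continuous_intros\<close>)
    have [measurable]: "(\<lambda>u. f (of_real u + \<i> * of_real \<beta>)) \<in> borel_measurable borel"
      by (rule borel_measurable_continuous_onI[OF cont])
    have dom: "integrable lborel (\<lambda>u. C * exp (- c * \<bar>u\<bar>))" by (intro integrable_mult_right integrable_exp_abs c)
    have bd': "norm (f (of_real u + \<i> * of_real \<beta>)) \<le> C * exp (- c * \<bar>u\<bar>)" for u
      using bd[of "of_real u + \<i> * of_real \<beta>"] \<beta> by simp
    have eq: "(LBINT u. indicator {- real n..real n} u *\<^sub>R f (of_real u + \<i> * of_real \<beta>)) = Q \<beta> n" for n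
      unfolding Q_def
    proof (rule integral_FTC_Icc)
      fix x :: real
      have "((\<lambda>u. of_real u + \<i> * of_real \<beta>) has_vector_derivative 1) (at x within {- real n..real n})"
        by (auto intro!: derivative_eq_intros)
      from field_vector_diff_chain_within[OF this DERIV_subset[OF P[OF inS]]]
      show "((\<lambda>u. P (of_real u + \<i> * of_real \<beta>)) has_vector_derivative f (of_real x + \<i> * of_real \<beta>)) (at x within {- real n..real n})"
        by (simp add: o_def)
    qed (use cont in auto)
    have "(\<lambda>n. LBINT u. indicator {- real n..real n} u *\<^sub>R f (of_real u + \<i> * of_real \<beta>))
        \<longlonglongrightarrow> (LBINT u. f (of_real u + \<i> * of_real \<beta>))"
    proof (rule integral_dominated_convergence[OF _ _ dom])
      show "AE u in lborel. (\<lambda>n. indicator {- real n..real n} u *\<^sub>R f (of_real u + \<i> * of_real \<beta>)) \<longlonglongrightarrow> f (of_real u + \<i> * of_real \<beta>)"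
      proof (intro AE_I2 tendsto_eventually)
        fix u :: real
        obtain n0 :: nat where "\<bar>u\<bar> < real n0" using reals_Archimedean2 by blast
        then show "\<forall>\<^sub>F n in sequentially. indicator {- real n..real n} u *\<^sub>R f (of_real u + \<i> * of_real \<beta>) = f (of_real u + \<i> * of_real \<beta>)"
          by (intro eventually_sequentiallyI[of n0]) (auto simp: indicator_def)
      qed
      show "AE u in lborel. norm (indicator {- real n..real n} u *\<^sub>R f (of_real u + \<i> * of_real \<beta>)) \<le> C * exp (- c * \<bar>u\<bar>)" for n
        using bd' C0 by (intro AE_I2) (auto simp: indicator_def)
    qed simp_all
    then show "Q \<beta> \<longlonglongrightarrow> (LBINT u. f (of_real u + \<i> * of_real \<beta>))" unfolding eq .
  qed
  have side: "norm (P (of_real x + \<i> * of_real \<alpha>) - P (of_real x)) \<le> C * exp (- c * \<bar>x\<bar>) * \<bar>\<alpha>\<bar>" for x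
  proof -
    define L where "L = closed_segment (complex_of_real x) (of_real x + \<i> * of_real \<alpha>)"
    have L: "Re z = x \<and> \<bar>Im z\<bar> \<le> \<bar>\<alpha>\<bar>" if "z \<in> L" for z
      using that by (auto simp: L_def closed_segment_def algebra_simps abs_mult mult_left_le_one_le)
    have "norm (P (of_real x + \<i> * of_real \<alpha>) - P (of_real x)) \<le> C * exp (- c * \<bar>x\<bar>) * norm ((of_real x + \<i> * of_real \<alpha>) - complex_of_real x)"
    proof (rule field_differentiable_bound[where S = L and f' = f])
      show "(P has_field_derivative f z) (at z within L)" if "z \<in> L" for z
        using L[OF that] \<alpha> by (intro DERIV_subset[OF P]) (auto simp: S_def)
      show "norm (f z) \<le> C * exp (- c * \<bar>x\<bar>)" if "z \<in> L" for z
        using L[OF that] bd[of z] by auto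
    qed (auto simp: L_def)
    then show ?thesis by (simp add: norm_mult)
  qed
  have "(\<lambda>n. Q \<alpha> n - Q 0 n) \<longlonglongrightarrow> 0"
  proof (rule Lim_null_comparison)
    show "\<forall>\<^sub>F n in sequentially. norm (Q \<alpha> n - Q 0 n) \<le> 2 * C * exp (- c * real n) * \<bar>\<alpha>\<bar>"
    proof (intro always_eventually allI)
      fix n
      have eq: "a - b - (a' - b') = (a - a') - (b - b')" for a b a' b' :: complex by simp
      have "norm (Q \<alpha> n - Q 0 n) \<le> C * exp (- c * real n) * \<bar>\<alpha>\<bar> + C * exp (- c * real n) * \<bar>\<alpha>\<bar>"
        unfolding Q_def eq
        using norm_triangle_le_diff[OF add_mono[OF side[of "real n"] side[of "- real n"]]] by simp
      then show "norm (Q \<alpha> n - Q 0 n) \<le> 2 * C * exp (- c * real n) * \<bar>\<alpha>\<bar>"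
        by (simp only: mult_2[symmetric] mult.assoc)
    qed
    show "(\<lambda>n. 2 * C * exp (- c * real n) * \<bar>\<alpha>\<bar>) \<longlonglongrightarrow> 0" using c by real_asymp
  qed
  moreover have "(\<lambda>n. Q \<alpha> n - Q 0 n) \<longlonglongrightarrow>
      (LBINT u. f (of_real u + \<i> * of_real \<alpha>)) - (LBINT u. f (of_real u))"
    using tendsto_diff[OF lim[of \<alpha>] lim[of 0]] by simp
  ultimately show "(LBINT u. f (of_real u + \<i> * of_real \<alpha>)) = (LBINT u. f (of_real u))"
    using LIMSEQ_unique by fastforce
qed

definition zeta_sq :: "real \<Rightarrow> real" where
  "zeta_sq t = (norm (riemann_zeta (Complex (1/2) t)))\<^sup>2"

lemma zeta_sq_nonneg [simp]: "zeta_sq t \<ge> 0" by (simp add: zeta_sq_def)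

lemma continuous_zeta_sq: "continuous_on A zeta_sq"
proof -
  have "continuous_on (- {1}) riemann_zeta"
    unfolding riemann_zeta_eq_zeta_ext by (intro holomorphic_on_imp_continuous_on holomorphic_zeta_ext)
  then have "continuous_on A (\<lambda>t. riemann_zeta (Complex (1/2) t))"
    by (rule continuous_on_compose2) (auto intro!: continuous_intros simp: complex_eq_iff)
  then show ?thesis unfolding zeta_sq_def[abs_def] by (intro continuous_intros)
qed

lemma zeta_sq_measurable [measurable]: "zeta_sq \<in> borel_measurable borel"
  by (rule borel_measurable_continuous_onI[OF continuous_zeta_sq])

text \<open>The reflection formula at \<open>s\<close> and \<open>1 - s = cnj s\<close>. The right-hand side is \<open>\<pi>/cosh(\<pi>t)\<close>, arranged so that the factor
\<open>exp((\<pi> - 2\<delta>)t)\<close> coming from the rotation leaves \<open>exp(-2\<delta>t)\<close>.\<close>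

lemma norm_Gamma_half: "(norm (Gamma (Complex (1/2) t)))\<^sup>2 = 2 * pi * exp (- pi * t) / (1 + exp (- 2 * pi * t))"
proof -
  define s where "s = Complex (1/2) t"
  have c: "1 - s = cnj s" by (simp add: s_def complex_eq_iff)
  have sn: "sin (of_real pi * s) = of_real ((exp (pi * t) + exp (- pi * t)) / 2)"
  proof -
    have "of_real pi * s = of_real (pi * t) * \<i> + of_real (pi / 2)"
      by (simp add: s_def complex_eq_iff)
    then have "sin (of_real pi * s) = cos (of_real (pi * t) * \<i>)"
      by (simp add: sin_add)
    also have "\<dots> = (exp (of_real (pi * t)) + exp (of_real (- pi * t))) / 2"
    proof -
      have a: "\<i> * (of_real (pi * t) * \<i>) = of_real (- pi * t)" by (simp add: complex_eq_iff)
      show ?thesis unfolding cos_exp_eq a by simp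
    qed
    also have "\<dots> = of_real ((exp (pi * t) + exp (- pi * t)) / 2)"
      by (simp only: exp_of_real of_real_add of_real_divide of_real_numeral)
    finally show ?thesis .
  qed
  have "complex_of_real ((norm (Gamma s))\<^sup>2) = Gamma s * Gamma (1 - s)"
    unfolding c complex_norm_square cnj_Gamma ..
  also have "\<dots> = of_real (pi / ((exp (pi * t) + exp (- pi * t)) / 2))"
    unfolding Gamma_reflection_complex sn by simp
  finally have "(norm (Gamma s))\<^sup>2 = pi / ((exp (pi * t) + exp (- pi * t)) / 2)"
    unfolding of_real_eq_iff .
  also have "\<dots> = 2 * pi * exp (- pi * t) / (1 + exp (- 2 * pi * t))"
  proof -
    have "1 + exp (- 2 * pi * t) = (exp (pi * t) + exp (- pi * t)) * exp (- pi * t)"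
      by (simp add: ring_distribs mult_exp_exp)
    then show ?thesis by (simp only: mult_divide_mult_cancel_right[OF exp_not_eq_zero]) simp
  qed
  finally show ?thesis by (simp add: s_def)
qed

text \<open>The kernel on the ray through \<open>\<omega> = i exp(-i\<delta>)\<close> in the logarithmic variable; the factor \<open>exp(u/2)\<close>
belongs to the line \<open>Re s = 1/2\<close>.\<close>

definition rot_bose :: "real \<Rightarrow> real \<Rightarrow> complex" where
  "rot_bose \<delta> u = bose (exp (of_real u + \<i> * of_real (pi / 2 - \<delta>))) * of_real (exp (u / 2))"

lemma rot_bose_cont:
  assumes \<delta>: "0 < \<delta>" "\<delta> < pi / 2"
  shows "continuous_on A (rot_bose \<delta>)"
proof -
  have "cos (pi / 2 - \<delta>) > 0" using \<delta> by (intro cos_gt_zero_pi) auto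
  then have "Re (exp (of_real u + \<i> * of_real (pi / 2 - \<delta>))) > 0" for u by (simp add: Re_exp)
  then have "continuous_on A (\<lambda>u. bose (exp (of_real u + \<i> * of_real (pi / 2 - \<delta>))))"
    by (intro continuous_on_compose2[OF holomorphic_on_imp_continuous_on[OF holomorphic_bose]])
       (auto intro!: continuous_intros)
  then show ?thesis unfolding rot_bose_def by (intro continuous_intros) auto
qed

lemma bose_exp_strip_bound:
  obtains C where "C > 0" "\<And>\<delta> z. 0 < \<delta> \<Longrightarrow> \<delta> < pi / 2 \<Longrightarrow> \<bar>Im z\<bar> \<le> pi / 2 - \<delta> \<Longrightarrow>
    norm (bose (exp z)) * exp (Re z / 2) \<le> C * (1 + 1 / sin \<delta>) * exp (- (1/2) * \<bar>Re z\<bar>)"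
proof -
  obtain C0 where C0: "C0 > 0" "\<And>\<kappa> z. 0 < \<kappa> \<Longrightarrow> \<kappa> \<le> cos (Im z) \<Longrightarrow>
    norm (bose (exp z)) * exp (Re z / 2) \<le> (C0 + 2 / \<kappa>) * exp (- \<bar>Re z\<bar> / 2)" by (rule bose_exp_bound) blast
  show ?thesis
  proof (rule that[of "C0 + 2"])
    fix \<delta> and z :: complex assume \<delta>: "0 < \<delta>" "\<delta> < pi / 2" and z: "\<bar>Im z\<bar> \<le> pi / 2 - \<delta>"
    have "cos (pi / 2 - \<delta>) \<le> cos \<bar>Im z\<bar>" using \<delta> z by (intro cos_monotone_0_pi_le) auto
    then have c: "sin \<delta> \<le> cos (Im z)" by (simp add: cos_diff)
    have s: "sin \<delta> > 0" using \<delta> by (intro sin_gt_zero) auto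
    have "norm (bose (exp z)) * exp (Re z / 2) \<le> (C0 + 2 / sin \<delta>) * exp (- \<bar>Re z\<bar> / 2)"
      by (rule C0(2)[OF s c])
    also have "\<dots> \<le> ((C0 + 2) * (1 + 1 / sin \<delta>)) * exp (- \<bar>Re z\<bar> / 2)"
      using C0(1) s by (intro mult_right_mono) (auto simp: field_simps)
    finally show "norm (bose (exp z)) * exp (Re z / 2) \<le> (C0 + 2) * (1 + 1 / sin \<delta>) * exp (- (1/2) * \<bar>Re z\<bar>)" by simp
  qed (use C0 in auto)
qed

lemma rot_bose_bound:
  obtains C where "C > 0" "\<And>\<delta> u. 0 < \<delta> \<Longrightarrow> \<delta> < pi / 2 \<Longrightarrow>
    norm (rot_bose \<delta> u) \<le> C * (1 + 1 / sin \<delta>) * exp (- (1/2) * \<bar>u\<bar>)"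
proof -
  obtain C where C: "C > 0" "\<And>\<delta> z. 0 < \<delta> \<Longrightarrow> \<delta> < pi / 2 \<Longrightarrow> \<bar>Im z\<bar> \<le> pi / 2 - \<delta> \<Longrightarrow>
    norm (bose (exp z)) * exp (Re z / 2) \<le> C * (1 + 1 / sin \<delta>) * exp (- (1/2) * \<bar>Re z\<bar>)"
    by (rule bose_exp_strip_bound) blast
  show ?thesis
  proof (rule that[OF C(1)])
    fix \<delta> u :: real assume \<delta>: "0 < \<delta>" "\<delta> < pi / 2"
    then show "norm (rot_bose \<delta> u) \<le> C * (1 + 1 / sin \<delta>) * exp (- (1/2) * \<bar>u\<bar>)"
      using C(2)[OF \<delta>, of "of_real u + \<i> * of_real (pi / 2 - \<delta>)"] by (simp add: rot_bose_def norm_mult)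
  qed
qed

lemma rot_bose_integrable:
  assumes \<delta>: "0 < \<delta>" "\<delta> < pi / 2"
  shows "integrable lborel (rot_bose \<delta>)"
proof -
  obtain C where C: "C > 0" "\<And>\<delta> u. 0 < \<delta> \<Longrightarrow> \<delta> < pi / 2 \<Longrightarrow>
    norm (rot_bose \<delta> u) \<le> C * (1 + 1 / sin \<delta>) * exp (- (1/2) * \<bar>u\<bar>)" by (rule rot_bose_bound) blast
  have dom: "integrable lborel (\<lambda>u::real. C * (1 + 1 / sin \<delta>) * exp (- (1/2) * \<bar>u\<bar>))"
    by (intro integrable_mult_right integrable_exp_abs) auto
  show ?thesis
  proof (rule Bochner_Integration.integrable_bound[OF dom])
    show "rot_bose \<delta> \<in> borel_measurable lborel"
      using borel_measurable_continuous_onI[OF rot_bose_cont[OF \<delta>]] by simp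
  qed (use C(2)[OF \<delta>] in \<open>auto intro: order_trans[OF _ abs_ge_self]\<close>)
qed

text \<open>Shifting the line of integration by \<open>\<alpha> = \<pi>/2 - \<delta>\<close> shows that this Fourier transform is \<open>\<Gamma>(s)\<zeta>(s) exp(-i\<alpha>s)\<close>
at \<open>s = 1/2 + it\<close>, and \<open>|exp(-i\<alpha>s)|\<^sup>2 = exp(2\<alpha>t)\<close>.\<close>

lemma rot_bose_fourier:
  assumes \<delta>: "0 < \<delta>" "\<delta> < pi / 2"
  shows "(norm (LBINT u. rot_bose \<delta> u * iexp (t * u)))\<^sup>2 =
    2 * pi * (zeta_sq t * exp (- 2 * \<delta> * t) / (1 + exp (- 2 * pi * t)))"
proof -
  define \<alpha> where "\<alpha> = pi / 2 - \<delta>"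
  define s where "s = Complex (1/2) t"
  have \<alpha>: "\<bar>\<alpha>\<bar> = \<alpha>" "\<bar>\<alpha>\<bar> < pi / 2" using \<delta> by (auto simp: \<alpha>_def)
  define f where "f z = bose (exp z) * exp (s * z)" for z
  obtain C where C: "C > 0" "\<And>\<delta> z. 0 < \<delta> \<Longrightarrow> \<delta> < pi / 2 \<Longrightarrow> \<bar>Im z\<bar> \<le> pi / 2 - \<delta> \<Longrightarrow>
    norm (bose (exp z)) * exp (Re z / 2) \<le> C * (1 + 1 / sin \<delta>) * exp (- (1/2) * \<bar>Re z\<bar>)"
    by (rule bose_exp_strip_bound) blast
  define C' where "C' = C * (1 + 1 / sin \<delta>)"
  have sn: "sin \<delta> > 0" using \<delta> by (intro sin_gt_zero) auto
  then have C': "C' > 0" using C by (simp add: C'_def add_pos_pos)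
  have holo: "f holomorphic_on {z. \<bar>Im z\<bar> < pi / 2}"
  proof -
    have "(bose \<circ> exp) holomorphic_on {z. \<bar>Im z\<bar> < pi / 2}"
      by (rule holomorphic_on_compose_gen[OF _ holomorphic_bose])
         (auto intro!: holomorphic_intros simp: Re_exp cos_gt_zero_pi)
    then show ?thesis unfolding f_def o_def by (intro holomorphic_intros)
  qed
  have bd: "norm (f z) \<le> (C' * exp (\<bar>t\<bar> * \<bar>\<alpha>\<bar>)) * exp (- (1/2) * \<bar>Re z\<bar>)" if z: "\<bar>Im z\<bar> \<le> \<bar>\<alpha>\<bar>" for z
  proof -
    have "norm (f z) = norm (bose (exp z)) * exp (Re z / 2) * exp (- t * Im z)"
    proof -
      have "norm (exp (s * z)) = exp (Re z / 2) * exp (- t * Im z)"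
        unfolding norm_exp_eq_Re mult_exp_exp by (simp add: s_def)
      then show ?thesis by (simp only: f_def norm_mult mult.assoc)
    qed
    also have "\<dots> \<le> (C' * exp (- (1/2) * \<bar>Re z\<bar>)) * exp (\<bar>t\<bar> * \<bar>\<alpha>\<bar>)"
    proof (rule mult_mono)
      show "norm (bose (exp z)) * exp (Re z / 2) \<le> C' * exp (- (1/2) * \<bar>Re z\<bar>)"
        unfolding C'_def using C(2)[OF \<delta>] z \<alpha>(1) by (simp add: \<alpha>_def)
      have "- t * Im z \<le> \<bar>t\<bar> * \<bar>Im z\<bar>" using abs_ge_self[of "- t * Im z"] by (simp add: abs_mult)
      also have "\<dots> \<le> \<bar>t\<bar> * \<bar>\<alpha>\<bar>" using z by (intro mult_left_mono) auto
      finally show "exp (- t * Im z) \<le> exp (\<bar>t\<bar> * \<bar>\<alpha>\<bar>)" by simp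
    qed (use C' in auto)
    finally show ?thesis by (simp add: mult_ac)
  qed
  have "(LBINT u. f (of_real u + \<i> * of_real \<alpha>)) = (LBINT u. f (of_real u))"
    by (rule integral_horizontal_shift[OF holo \<alpha>(2) _ bd]) auto
  also have "\<dots> = Gamma s * riemann_zeta s"
    unfolding f_def riemann_zeta_eq_zeta_ext by (rule bose_exp_integral) (auto simp: s_def)
  also have "(\<lambda>u. f (of_real u + \<i> * of_real \<alpha>)) = (\<lambda>u. exp (s * \<i> * of_real \<alpha>) * (rot_bose \<delta> u * iexp (t * u)))"
  proof
    fix u :: real
    have "exp (s * (of_real u + \<i> * of_real \<alpha>)) = exp (s * \<i> * of_real \<alpha>) * (exp (of_real (u / 2)) * iexp (t * u))"
      by (simp add: mult_exp_exp s_def complex_eq_iff[of "_ * _"] complex_eq_iff[of "_ + _"] algebra_simps Complex_eq)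
    then show "f (of_real u + \<i> * of_real \<alpha>) = exp (s * \<i> * of_real \<alpha>) * (rot_bose \<delta> u * iexp (t * u))"
      by (simp only: f_def rot_bose_def \<alpha>_def[symmetric] exp_of_real mult_ac)
  qed
  finally have eq: "exp (s * \<i> * of_real \<alpha>) * (LBINT u. rot_bose \<delta> u * iexp (t * u)) = Gamma s * riemann_zeta s"
    by simp
  have "exp (- 2 * t * \<alpha>) * (norm (LBINT u. rot_bose \<delta> u * iexp (t * u)))\<^sup>2 = (norm (Gamma s))\<^sup>2 * zeta_sq t"
  proof -
    have "(norm (exp (s * \<i> * of_real \<alpha>) * (LBINT u. rot_bose \<delta> u * iexp (t * u))))\<^sup>2 = (norm (Gamma s * riemann_zeta s))\<^sup>2"
      unfolding eq ..
    moreover have "(norm (exp (s * \<i> * of_real \<alpha>)))\<^sup>2 = exp (- 2 * t * \<alpha>)"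
    proof -
      have "Re (s * \<i> * of_real \<alpha>) = - t * \<alpha>" by (simp add: s_def)
      then show ?thesis unfolding norm_exp_eq_Re by (simp add: exp_double[symmetric] mult.assoc)
    qed
    ultimately show ?thesis
      by (simp only: norm_mult power_mult_distrib zeta_sq_def s_def)
  qed
  then have "(norm (LBINT u. rot_bose \<delta> u * iexp (t * u)))\<^sup>2 = exp (2 * t * \<alpha>) * ((norm (Gamma s))\<^sup>2 * zeta_sq t)"
    by (simp add: exp_minus field_simps)
  also have "\<dots> = 2 * pi * (zeta_sq t * (exp (2 * t * \<alpha>) * exp (- pi * t)) / (1 + exp (- 2 * pi * t)))"
    unfolding s_def norm_Gamma_half by simp
  also have "exp (2 * t * \<alpha>) * exp (- pi * t) = exp (- 2 * \<delta> * t)"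
    unfolding mult_exp_exp by (simp add: \<alpha>_def algebra_simps)
  finally show ?thesis .
qed

definition bose_energy :: "real \<Rightarrow> real" where
  "bose_energy \<delta> = (LBINT x:{0<..}. (norm (bose (of_real x * cis (pi / 2 - \<delta>))))\<^sup>2)"

text \<open>Plancherel's identity for \<open>rot_bose\<close>, whose transform is known from \<open>rot_bose_fourier\<close>; the substitution
\<open>x = exp u\<close> absorbs the factor \<open>exp(u/2)\<^sup>2\<close> into the measure.\<close>

theorem
  assumes \<delta>: "0 < \<delta>" "\<delta> < pi / 2"
  shows zeta_energy_integrable: "integrable lborel (\<lambda>t. zeta_sq t * exp (- 2 * \<delta> * t) / (1 + exp (- 2 * pi * t)))"
    and zeta_energy_eq: "(LBINT t. zeta_sq t * exp (- 2 * \<delta> * t) / (1 + exp (- 2 * pi * t))) = bose_energy \<delta>"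
    and bose_energy_integrable: "set_integrable lborel {0<..} (\<lambda>x. (norm (bose (of_real x * cis (pi / 2 - \<delta>))))\<^sup>2)"
proof -
  define C where "C = cis (pi / 2 - \<delta>)"
  have cont: "isCont (rot_bose \<delta>) u" for u
    using rot_bose_cont[OF \<delta>, of UNIV] by (simp add: continuous_on_eq_continuous_at)
  obtain C1 where C1: "C1 > 0" "\<And>\<delta> u. 0 < \<delta> \<Longrightarrow> \<delta> < pi / 2 \<Longrightarrow>
    norm (rot_bose \<delta> u) \<le> C1 * (1 + 1 / sin \<delta>) * exp (- (1/2) * \<bar>u\<bar>)" by (rule rot_bose_bound) blast
  have sn: "sin \<delta> > 0" using \<delta> by (intro sin_gt_zero) auto
  have bdd: "norm (rot_bose \<delta> u) \<le> C1 * (1 + 1 / sin \<delta>)" for u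
    by (rule order_trans[OF C1(2)[OF \<delta>]]) (use C1(1) sn in \<open>auto intro!: mult_left_le add_nonneg_nonneg mult_nonneg_nonneg\<close>)
  note pl = plancherel[OF rot_bose_integrable[OF \<delta>] cont bdd, unfolded rot_bose_fourier[OF \<delta>]]
  show "integrable lborel (\<lambda>t. zeta_sq t * exp (- 2 * \<delta> * t) / (1 + exp (- 2 * pi * t)))"
    using integrable_mult_right[OF pl(1), of "1 / (2 * pi)"] by simp
  have meas: "(\<lambda>x. (norm (bose (of_real x * C)))\<^sup>2) \<in> borel_measurable borel"
    unfolding bose_def exp_tail2_def by measurable
  have eq: "(\<lambda>u. exp u *\<^sub>R (norm (bose (of_real (exp u) * C)))\<^sup>2) = (\<lambda>u. (norm (rot_bose \<delta> u))\<^sup>2)"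
    by (auto simp: rot_bose_def norm_mult power_mult_distrib C_def exp_add cis_conv_exp exp_of_real simp flip: exp_double)
  have sqint: "integrable lborel (\<lambda>u. (norm (rot_bose \<delta> u))\<^sup>2)"
  proof (rule Bochner_Integration.integrable_bound)
    show "integrable lborel (\<lambda>u. (C1 * (1 + 1 / sin \<delta>)) *\<^sub>R rot_bose \<delta> u)"
      by (intro integrable_scaleR_right rot_bose_integrable \<delta>)
    have "(norm (rot_bose \<delta> u))\<^sup>2 \<le> (C1 * (1 + 1 / sin \<delta>)) * norm (rot_bose \<delta> u)" for u
      unfolding power2_eq_square by (intro mult_right_mono bdd) auto
    then show "AE u in lborel. norm ((norm (rot_bose \<delta> u))\<^sup>2) \<le> norm ((C1 * (1 + 1 / sin \<delta>)) *\<^sub>R rot_bose \<delta> u)"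
      using abs_of_nonneg[of "C1 * (1 + 1 / sin \<delta>)"] C1(1) sn
      by (intro AE_I2) (simp only: norm_scaleR real_norm_def abs_power2 mult_nonneg_nonneg add_nonneg_nonneg
          zero_le_one divide_nonneg_pos less_imp_le)
  qed (use rot_bose_integrable[OF \<delta>] in measurable)
  show "set_integrable lborel {0<..} (\<lambda>x. (norm (bose (of_real x * cis (pi / 2 - \<delta>))))\<^sup>2)"
    using sqint integrable_exp_substitution[OF meas, unfolded eq, unfolded C_def] by simp
  have "bose_energy \<delta> = (LBINT u. (norm (rot_bose \<delta> u))\<^sup>2)"
    using integral_exp_substitution[OF meas, unfolded eq, unfolded C_def] unfolding bose_energy_def by simp
  with pl(2)[unfolded integral_mult_right_zero] show "(LBINT t. zeta_sq t * exp (- 2 * \<delta> * t) / (1 + exp (- 2 * pi * t))) = bose_energy \<delta>"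
    by simp
qed

text \<open>The trivial bound of the Fourier transform \<open>rot_bose_fourier\<close> by the integral of the modulus, with \<open>\<delta> = 1/t\<close>: the factor
\<open>exp(-2\<delta>t)\<close> is then constant, and the modulus costs only \<open>O(1/sin \<delta>) = O(t)\<close>.\<close>

lemma zeta_sq_poly_bound:
  obtains C where "C > 0" "\<And>t. t \<ge> 1 \<Longrightarrow> zeta_sq t \<le> C * t\<^sup>2"
proof -
  obtain C1 where C1: "C1 > 0" "\<And>\<delta> u. 0 < \<delta> \<Longrightarrow> \<delta> < pi / 2 \<Longrightarrow>
    norm (rot_bose \<delta> u) \<le> C1 * (1 + 1 / sin \<delta>) * exp (- (1/2) * \<bar>u\<bar>)" by (rule rot_bose_bound) blast
  define J where "J = (LBINT u. exp (- (1/2) * \<bar>u::real\<bar>))"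
  have J0: "J \<ge> 0" unfolding J_def by (intro integral_nonneg_AE) auto
  define C where "C = exp 2 * (C1 * 3 * J)\<^sup>2 + 1"
  show ?thesis
  proof (rule that[of C])
    show "C > 0" unfolding C_def by (intro add_nonneg_pos mult_nonneg_nonneg) auto
    fix t :: real assume t: "t \<ge> 1"
    define \<delta> where "\<delta> = 1 / t"
    have "0 < \<delta>" "\<delta> \<le> 1" using t by (auto simp: \<delta>_def)
    then have \<delta>: "0 < \<delta>" "\<delta> \<le> 1" "\<delta> < pi / 2" using pi_gt3 by auto
    have sn: "sin \<delta> \<ge> \<delta> / 2"
    proof -
      have "\<bar>sin \<delta> - \<delta>\<bar> \<le> \<delta>\<^sup>2 / 2"
        using Maclaurin_sin_bound[of \<delta> 2] by (simp add: numeral_2_eq_2 sin_coeff_def)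
      moreover have "\<delta>\<^sup>2 \<le> \<delta>" using \<delta> by (simp add: power2_eq_square mult_left_le)
      ultimately show ?thesis by linarith
    qed
    have "1 / sin \<delta> \<le> 1 / (\<delta> / 2)" using sn \<delta> by (intro frac_le) auto
    then have "1 + 1 / sin \<delta> \<le> 3 * t" using t by (simp add: \<delta>_def)
    have "norm (LBINT u. rot_bose \<delta> u * iexp (t * u)) \<le> (LBINT u. norm (rot_bose \<delta> u * iexp (t * u)))"
      by (rule integral_norm_bound)
    also have "\<dots> \<le> (LBINT u. C1 * (3 * t) * exp (- (1/2) * \<bar>u\<bar>))"
    proof (rule integral_mono)
      show "integrable lborel (\<lambda>u. norm (rot_bose \<delta> u * iexp (t * u)))"
        using rot_bose_integrable[OF \<delta>(1,3)] by (simp add: norm_mult)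
      show "integrable lborel (\<lambda>u::real. C1 * (3 * t) * exp (- (1/2) * \<bar>u\<bar>))"
        by (intro integrable_mult_right integrable_exp_abs) auto
      fix u
      have "norm (rot_bose \<delta> u) \<le> C1 * (1 + 1 / sin \<delta>) * exp (- (1/2) * \<bar>u\<bar>)" by (rule C1(2)[OF \<delta>(1,3)])
      also have "\<dots> \<le> C1 * (3 * t) * exp (- (1/2) * \<bar>u\<bar>)"
        using C1(1) \<open>1 + 1 / sin \<delta> \<le> 3 * t\<close> by (intro mult_right_mono mult_left_mono) auto
      finally show "norm (rot_bose \<delta> u * iexp (t * u)) \<le> C1 * (3 * t) * exp (- (1/2) * \<bar>u\<bar>)"
        by (simp add: norm_mult)
    qed
    also have "\<dots> = C1 * 3 * J * t" by (simp add: J_def)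
    finally have "(norm (LBINT u. rot_bose \<delta> u * iexp (t * u)))\<^sup>2 \<le> (C1 * 3 * J * t)\<^sup>2"
      by (intro power_mono) auto
    then have le: "2 * pi * (zeta_sq t * exp (- 2 * \<delta> * t) / (1 + exp (- 2 * pi * t))) \<le> (C1 * 3 * J)\<^sup>2 * t\<^sup>2"
      unfolding rot_bose_fourier[OF \<delta>(1,3)] by (simp add: power_mult_distrib)
    have e1: "exp (- 2 * pi * t) \<le> 1" using t by simp
    have "zeta_sq t * exp (- 2) = zeta_sq t * exp (- 2 * \<delta> * t)" using t by (simp add: \<delta>_def)
    also have "\<dots> \<le> 2 * pi * (zeta_sq t * exp (- 2 * \<delta> * t) / (1 + exp (- 2 * pi * t)))"
    proof -
      have "1 + exp (- 2 * pi * t) \<le> 2 * pi" using e1 pi_gt3 by linarith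
      moreover have "0 < 1 + exp (- 2 * pi * t)" by (simp add: add_pos_pos)
      moreover have "0 \<le> zeta_sq t * exp (- 2 * \<delta> * t)" by simp
      ultimately show ?thesis by (simp add: pos_le_divide_eq mult.commute[of _ "2 * pi"] mult_right_mono mult.commute)
    qed
    also note le
    finally have "zeta_sq t \<le> exp 2 * (C1 * 3 * J)\<^sup>2 * t\<^sup>2" by (simp add: exp_minus field_simps)
    also have "\<dots> \<le> C * t\<^sup>2" unfolding C_def by (intro mult_right_mono) auto
    finally show "zeta_sq t \<le> C * t\<^sup>2" .
  qed
qed

section \<open>Asymptotics of the energy integral\<close>

lemma norm_diff_one_mono:
  fixes u :: complex
  assumes "norm u = 1" "1 \<le> r" "r \<le> R"
  shows "norm (of_real r * u - 1) \<le> norm (of_real R * u - 1)"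
proof -
  have sq: "(norm (of_real x * u - 1))\<^sup>2 = x\<^sup>2 - 2 * x * Re u + 1" for x :: real
  proof -
    have "(norm (of_real x * u - 1))\<^sup>2 = (x * Re u - 1)\<^sup>2 + (x * Im u)\<^sup>2" by (simp add: cmod_power2)
    also have "\<dots> = x\<^sup>2 * ((Re u)\<^sup>2 + (Im u)\<^sup>2) - 2 * x * Re u + 1" by (simp add: power2_eq_square algebra_simps)
    also have "(Re u)\<^sup>2 + (Im u)\<^sup>2 = 1" using assms(1) cmod_power2[of u] by simp
    finally show ?thesis by simp
  qed
  have "Re u \<le> 1" using complex_Re_le_cmod[of u] assms by simp
  then have "0 \<le> (R - r) * (R + r - 2 * Re u)" using assms by (intro mult_nonneg_nonneg) auto
  then have "(norm (of_real r * u - 1))\<^sup>2 \<le> (norm (of_real R * u - 1))\<^sup>2"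
    unfolding sq by (simp add: power2_eq_square algebra_simps)
  then show ?thesis by (rule power2_le_imp_le) simp
qed

text \<open>\<open>(r\<^sup>2 - 1)/|w - 1|\<^sup>2 = 1 + 2 Re(1/(w - 1))\<close> for \<open>|w| = r\<close>, and for \<open>w = r exp(icx)\<close> the function \<open>1/(w - 1)\<close>
has the periodic primitive \<open>Ln(1 - 1/w)/(ic)\<close>, which contributes nothing over a full period.\<close>

lemma poisson_period:
  fixes r c a :: real
  assumes r: "1 < r" and c: "0 < c"
  shows "((\<lambda>x. 1 / (norm (of_real r * cis (c * x) - 1))\<^sup>2) has_integral (2 * pi / c) / (r\<^sup>2 - 1)) {a..a + 2 * pi / c}"
proof -
  define A where "A x = (x + (2 / c) * Im (Ln (1 - cis (- c * x) / of_real r))) / (r\<^sup>2 - 1)" for x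
  have r2: "r\<^sup>2 - 1 > 0" using r by (simp add: power2_eq_square less_1_mult)
  have deriv: "(A has_real_derivative 1 / (norm (of_real r * cis (c * x) - 1))\<^sup>2) (at x within S)" for x S
  proof -
    define w where "w = of_real r * cis (c * x)"
    have nw: "norm w = r" using r by (simp add: w_def norm_mult)
    then have w1: "w \<noteq> 1" "w \<noteq> 0" using r by auto
    have inv: "cis (- c * x) / of_real r = 1 / w" using r by (simp add: w_def divide_simps cis_mult)
    have "Re (1 / w) \<le> norm (1 / w)" by (rule complex_Re_le_cmod)
    also have "\<dots> < 1" using r nw by (simp add: norm_divide)
    finally have nonpos: "1 - cis (- c * x) / of_real r \<notin> \<real>\<^sub>\<le>\<^sub>0"
      unfolding inv by (auto simp: complex_nonpos_Reals_iff)
    have d1: "((\<lambda>x. 1 - cis (- c * x) / of_real r) has_vector_derivative (\<i> * of_real c / w)) (at x within S)"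
    proof -
      have "((\<lambda>x. cis (- c * x)) has_vector_derivative (- of_real c * \<i> * cis (- c * x))) (at x within S)"
      proof -
        have "((\<lambda>z. exp (\<i> * (- of_real c * z))) has_field_derivative (- of_real c * \<i> * exp (\<i> * (- of_real c * of_real x)))) (at (complex_of_real x))"
          by (auto intro!: derivative_eq_intros)
        from has_vector_derivative_real_field[OF this] show ?thesis by (simp add: cis_conv_exp)
      qed
      then have "((\<lambda>x. 1 - (1 / of_real r) * cis (- c * x)) has_vector_derivative (0 - (1 / of_real r) * (- of_real c * \<i> * cis (- c * x)))) (at x within S)"
        by (intro derivative_intros)
      also have "(0 - (1 / of_real r) * (- of_real c * \<i> * cis (- c * x))) = \<i> * of_real c * (cis (- c * x) / of_real r)" by simp
      finally show ?thesis unfolding inv by simp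
    qed
    have "(Ln has_field_derivative inverse (1 - cis (- c * x) / of_real r)) (at (1 - cis (- c * x) / of_real r))"
      using nonpos by (rule has_field_derivative_Ln)
    from field_vector_diff_chain_within[where f = "\<lambda>x. 1 - cis (- c * x) / of_real r", OF d1 has_field_derivative_at_within[OF this]]
    have "((\<lambda>x. Ln (1 - cis (- c * x) / of_real r)) has_vector_derivative (\<i> * of_real c / w) * inverse (1 - cis (- c * x) / of_real r)) (at x within S)"
      by (simp add: o_def)
    also have "(\<i> * of_real c / w) * inverse (1 - cis (- c * x) / of_real r) = \<i> * of_real c / (w - 1)"
      unfolding inv using w1 by (simp add: divide_simps)
    finally have "((\<lambda>x. Im (Ln (1 - cis (- c * x) / of_real r))) has_vector_derivative Im (\<i> * of_real c / (w - 1))) (at x within S)"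
      by (rule bounded_linear.has_vector_derivative[OF bounded_linear_Im])
    then have "((\<lambda>x. Im (Ln (1 - cis (- c * x) / of_real r))) has_real_derivative c * Re (1 / (w - 1))) (at x within S)"
      by (simp add: has_real_derivative_iff_has_vector_derivative Im_divide Re_divide)
    then have "(A has_real_derivative (1 + (2 / c) * (c * Re (1 / (w - 1)))) / (r\<^sup>2 - 1)) (at x within S)"
      unfolding A_def by (intro DERIV_cdivide DERIV_add DERIV_ident DERIV_cmult)
    also have "(1 + (2 / c) * (c * Re (1 / (w - 1)))) / (r\<^sup>2 - 1) = 1 / (norm (w - 1))\<^sup>2"
    proof -
      have n0: "(norm (w - 1))\<^sup>2 > 0" using w1 by simp
      have "Re (1 / (w - 1)) = (Re w - 1) / (norm (w - 1))\<^sup>2" by (simp add: Re_divide cmod_power2)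
      then have "1 + (2 / c) * (c * Re (1 / (w - 1))) = ((norm (w - 1))\<^sup>2 + 2 * (Re w - 1)) / (norm (w - 1))\<^sup>2"
        using c n0 by (simp add: field_simps)
      also have "(norm (w - 1))\<^sup>2 + 2 * (Re w - 1) = (norm w)\<^sup>2 - 1"
        unfolding cmod_power2 by (simp add: power2_eq_square algebra_simps)
      finally show ?thesis using r2 nw by simp
    qed
    finally show ?thesis by (simp add: w_def)
  qed
  have "((\<lambda>x. 1 / (norm (of_real r * cis (c * x) - 1))\<^sup>2) has_integral A (a + 2 * pi / c) - A a) {a..a + 2 * pi / c}"
    using deriv c by (intro fundamental_theorem_of_calculus) (auto simp: has_real_derivative_iff_has_vector_derivative)
  also have "A (a + 2 * pi / c) - A a = (2 * pi / c) / (r\<^sup>2 - 1)"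
  proof -
    have "- (c * (a + 2 * pi / c)) = - c * a - 2 * pi" using c by (simp add: field_simps)
    then have "cis (- c * (a + 2 * pi / c)) = cis (- c * a)"
      by (simp add: complex_eq_iff cos_diff sin_diff)
    then show ?thesis unfolding A_def diff_divide_distrib[symmetric] by simp
  qed
  finally show ?thesis .
qed

text \<open>A primitive of \<open>1/(exp(2\<sigma>y) - 1)\<close>, normalised to vanish at infinity.\<close>

definition bose_prim :: "real \<Rightarrow> real \<Rightarrow> real" where
  "bose_prim \<sigma> y = ln (1 - exp (- 2 * \<sigma> * y)) / (2 * \<sigma>)"

lemma bose_prim_bounds:
  assumes \<sigma>: "\<sigma> > 0" and x: "x > 0" and h: "h > 0"
  shows "h / (exp (2 * \<sigma> * (x + h)) - 1) \<le> bose_prim \<sigma> (x + h) - bose_prim \<sigma> x"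
    and "bose_prim \<sigma> (x + h) - bose_prim \<sigma> x \<le> h / (exp (2 * \<sigma> * x) - 1)"
proof -
  have "\<exists>z. z > x \<and> z < x + h \<and> bose_prim \<sigma> (x + h) - bose_prim \<sigma> x = (x + h - x) * (1 / (exp (2 * \<sigma> * z) - 1))"
  proof (rule MVT2)
    fix y assume "x \<le> y" "y \<le> x + h"
    then have y: "y > 0" using x by simp
    have e: "exp (- 2 * \<sigma> * y) < 1" using y \<sigma> by simp
    have "(bose_prim \<sigma> has_real_derivative (exp (- 2 * \<sigma> * y) * (2 * \<sigma>) / (1 - exp (- 2 * \<sigma> * y))) / (2 * \<sigma>)) (at y)"
      unfolding bose_prim_def using e \<sigma> by (auto intro!: derivative_eq_intros)
    also have "(exp (- 2 * \<sigma> * y) * (2 * \<sigma>) / (1 - exp (- 2 * \<sigma> * y))) / (2 * \<sigma>) = 1 / (exp (2 * \<sigma> * y) - 1)"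
    proof -
      define E where "E = exp (2 * \<sigma> * y)"
      have E: "E > 1" using y \<sigma> by (simp add: E_def)
      have inv: "exp (- 2 * \<sigma> * y) = 1 / E" by (simp add: E_def exp_minus divide_inverse)
      have "(exp (- 2 * \<sigma> * y) * (2 * \<sigma>) / (1 - exp (- 2 * \<sigma> * y))) / (2 * \<sigma>) = (1 / E) / (1 - 1 / E)"
        unfolding inv using \<sigma> by simp
      also have "\<dots> = 1 / (E - 1)" using E by (simp add: divide_simps)
      finally show ?thesis by (simp add: E_def)
    qed
    finally show "(bose_prim \<sigma> has_real_derivative 1 / (exp (2 * \<sigma> * y) - 1)) (at y)" .
  qed (use h in auto)
  then obtain z where z: "x < z" "z < x + h" "bose_prim \<sigma> (x + h) - bose_prim \<sigma> x = h / (exp (2 * \<sigma> * z) - 1)" by auto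
  have "0 < exp (2 * \<sigma> * x) - 1" using \<sigma> x by simp
  moreover have "exp (2 * \<sigma> * x) \<le> exp (2 * \<sigma> * z)" "exp (2 * \<sigma> * z) \<le> exp (2 * \<sigma> * (x + h))"
    using z \<sigma> by auto
  ultimately show "h / (exp (2 * \<sigma> * (x + h)) - 1) \<le> bose_prim \<sigma> (x + h) - bose_prim \<sigma> x"
    "bose_prim \<sigma> (x + h) - bose_prim \<sigma> x \<le> h / (exp (2 * \<sigma> * x) - 1)"
    unfolding z(3) using h by (auto intro!: divide_left_mono mult_pos_pos)
qed

lemma bose_prim_nonpos: "\<sigma> > 0 \<Longrightarrow> y > 0 \<Longrightarrow> bose_prim \<sigma> y \<le> 0"
  unfolding bose_prim_def by (intro divide_nonpos_pos) auto

text \<open>On each period, replacing the radius \<open>exp(\<sigma>x)\<close> by its value at the left (right) end gives an upper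
(lower) bound, evaluated by \<open>poisson_period\<close>. Comparing the period value at one end point with an increment of
\<open>bose_prim\<close> over a neighbouring period makes both sums telescope; the first period of the upper
bound has no predecessor and costs \<open>L/(2\<sigma>)\<close>.\<close>

lemma poisson_integral_bounds:
  fixes \<sigma> c :: real and N :: nat
  assumes \<sigma>: "\<sigma> > 0" and c: "c > 0"
  defines "p \<equiv> \<lambda>x. 1 / (norm (of_real (exp (\<sigma> * x)) * cis (c * x) - 1))\<^sup>2" and "L \<equiv> 2 * pi / c"
  shows "integral {1..1 + real N * L} p \<le> L / (2 * \<sigma>) - bose_prim \<sigma> 1"
    and "bose_prim \<sigma> (1 + real (Suc N) * L) - bose_prim \<sigma> (1 + L) \<le> integral {1..1 + real N * L} p"
proof -
  have L: "L > 0" using c by (simp add: L_def)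
  have ge1: "exp (\<sigma> * x) > 1" if "x \<ge> 1" for x using that \<sigma> by simp
  have nz: "of_real (exp (\<sigma> * x)) * cis (c * x) \<noteq> 1" if "x \<ge> 1" for x
  proof
    assume "of_real (exp (\<sigma> * x)) * cis (c * x) = 1"
    then have "norm (of_real (exp (\<sigma> * x)) * cis (c * x)) = norm (1::complex)" by (rule arg_cong)
    then show False using ge1[OF that] by (auto simp: norm_mult)
  qed
  have cont: "continuous_on {a..b} p" if "a \<ge> 1" for a b
    unfolding p_def using that nz by (intro continuous_intros) auto
  have intg: "p integrable_on {a..b}" if "a \<ge> 1" for a b
    using cont[OF that] by (rule integrable_continuous_interval)
  have up: "integral {a..a + L} p \<le> L / (exp (2 * \<sigma> * a) - 1)" if a: "a \<ge> 1" for a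
  proof -
    note P = poisson_period[OF ge1[OF a] c, of a, folded L_def]
    have "integral {a..a + L} p \<le> L / ((exp (\<sigma> * a))\<^sup>2 - 1)"
    proof (rule has_integral_le[OF integrable_integral[OF intg[OF a]] P])
      fix x assume x: "x \<in> {a..a + L}"
      have "norm (of_real (exp (\<sigma> * a)) * cis (c * x) - 1) \<le> norm (of_real (exp (\<sigma> * x)) * cis (c * x) - 1)"
        using x a \<sigma> by (intro norm_diff_one_mono) auto
      moreover have "0 < norm (of_real (exp (\<sigma> * a)) * cis (c * x) - 1)"
        using norm_triangle_ineq2[of "of_real (exp (\<sigma> * a)) * cis (c * x)" 1] ge1[OF a]
        unfolding norm_mult norm_cis norm_of_real norm_one by linarith
      ultimately show "p x \<le> 1 / (norm (of_real (exp (\<sigma> * a)) * cis (c * x) - 1))\<^sup>2"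
        unfolding p_def by (intro frac_le power_mono) auto
    qed
    then show ?thesis by (simp add: exp_double mult.assoc)
  qed
  have lo: "L / (exp (2 * \<sigma> * (a + L)) - 1) \<le> integral {a..a + L} p" if a: "a \<ge> 1" for a
  proof -
    have a': "a + L \<ge> 1" using a L by simp
    note P = poisson_period[OF ge1[OF a'] c, of a, folded L_def]
    have "L / ((exp (\<sigma> * (a + L)))\<^sup>2 - 1) \<le> integral {a..a + L} p"
    proof (rule has_integral_le[OF P integrable_integral[OF intg[OF a]]])
      fix x assume x: "x \<in> {a..a + L}"
      have "norm (of_real (exp (\<sigma> * x)) * cis (c * x) - 1) \<le> norm (of_real (exp (\<sigma> * (a + L))) * cis (c * x) - 1)"
        using x a \<sigma> by (intro norm_diff_one_mono) auto
      moreover have "0 < norm (of_real (exp (\<sigma> * x)) * cis (c * x) - 1)"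
        using nz[of x] x a by simp
      ultimately show "1 / (norm (of_real (exp (\<sigma> * (a + L))) * cis (c * x) - 1))\<^sup>2 \<le> p x"
        unfolding p_def by (intro frac_le power_mono) auto
    qed
    then show ?thesis by (simp add: exp_double mult.assoc)
  qed
  have step: "integral {1..1 + real (Suc n) * L} p = integral {1..1 + real n * L} p + integral {1 + real n * L..(1 + real n * L) + L} p" for n
  proof -
    have "1 + real (Suc n) * L = (1 + real n * L) + L" by (simp add: algebra_simps)
    moreover have "integral {1..1 + real n * L} p + integral {1 + real n * L..(1 + real n * L) + L} p = integral {1..(1 + real n * L) + L} p"
      using L by (intro Henstock_Kurzweil_Integration.integral_combine intg) auto
    ultimately show ?thesis by (simp only:)
  qed
  have ge: "1 + real n * L \<ge> 1" for n using L by simp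
  have first: "L / (exp (2 * \<sigma>) - 1) \<le> L / (2 * \<sigma>)"
  proof (rule frac_le)
    show "2 * \<sigma> \<le> exp (2 * \<sigma>) - 1" using exp_ge_add_one_self[of "2 * \<sigma>"] by linarith
  qed (use \<sigma> L in auto)
  have U: "integral {1..1 + real (Suc n) * L} p \<le> L / (2 * \<sigma>) + bose_prim \<sigma> (1 + real n * L) - bose_prim \<sigma> 1" for n
  proof (induction n)
    case 0
    show ?case using step[of 0] up[of 1] first by simp
  next
    case (Suc n)
    have e: "1 + real (Suc n) * L = (1 + real n * L) + L" by (simp add: algebra_simps)
    have "integral {1 + real (Suc n) * L..(1 + real (Suc n) * L) + L} p \<le> L / (exp (2 * \<sigma> * (1 + real (Suc n) * L)) - 1)"
      by (rule up[OF ge])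
    also have "\<dots> \<le> bose_prim \<sigma> (1 + real (Suc n) * L) - bose_prim \<sigma> (1 + real n * L)"
      unfolding e using ge[of n] by (intro bose_prim_bounds \<sigma> L) linarith
    finally show ?case using Suc.IH step[of "Suc n"] by linarith
  qed
  show "integral {1..1 + real N * L} p \<le> L / (2 * \<sigma>) - bose_prim \<sigma> 1"
  proof (cases N)
    case 0
    moreover have "0 \<le> L / (2 * \<sigma>)" using \<sigma> L by simp
    ultimately show ?thesis using bose_prim_nonpos[OF \<sigma>, of 1] by simp
  next
    case (Suc n)
    have "bose_prim \<sigma> (1 + real n * L) \<le> 0" using ge[of n] by (intro bose_prim_nonpos \<sigma>) linarith
    then show ?thesis using U[of n] unfolding Suc by linarith
  qed
  show "bose_prim \<sigma> (1 + real (Suc N) * L) - bose_prim \<sigma> (1 + L) \<le> integral {1..1 + real N * L} p"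
  proof (induction N)
    case 0
    then show ?case by simp
  next
    case (Suc n)
    have e: "1 + real (Suc n) * L = (1 + real n * L) + L" "1 + real (Suc (Suc n)) * L = (1 + real (Suc n) * L) + L" by (simp_all add: algebra_simps)
    have "bose_prim \<sigma> (1 + real (Suc (Suc n)) * L) - bose_prim \<sigma> (1 + real (Suc n) * L) \<le> L / (exp (2 * \<sigma> * (1 + real (Suc n) * L)) - 1)"
      unfolding e(2) using ge[of "Suc n"] by (intro bose_prim_bounds \<sigma> L) linarith
    also have "\<dots> \<le> integral {1 + real n * L..(1 + real n * L) + L} p"
      unfolding e(1) by (rule lo[OF ge])
    finally show ?case using Suc.IH step[of n] by linarith
  qed
qed


lemma inverse_square_integrable: "set_integrable lborel {1..} (\<lambda>x::real. 1 / x\<^sup>2)"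
proof -
  have "set_integrable lborel (einterval 1 \<infinity>) (\<lambda>x::real. 1 / x\<^sup>2)"
  proof (rule interval_integral_FTC_nonneg[where F = "\<lambda>x. - (1 / x)" and A = "-1" and B = 0])
    show "((\<lambda>x::real. - (1 / x)) has_real_derivative 1 / x\<^sup>2) (at x)" if "1 < ereal x" for x
      using that by (auto intro!: derivative_eq_intros simp: power2_eq_square)
    show "isCont (\<lambda>x::real. 1 / x\<^sup>2) x" if "1 < ereal x" for x
      using that by (auto intro!: continuous_intros)
    have "((\<lambda>x::real. - (1 / x)) \<longlongrightarrow> - 1) (at_right 1)" by real_asymp
    then show "(((\<lambda>x::real. - (1 / x)) \<circ> real_of_ereal) \<longlongrightarrow> - 1) (at_right 1)"
      unfolding one_ereal_def ereal_tendsto_simps by simp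
    have "((\<lambda>x::real. - (1 / x)) \<longlongrightarrow> 0) at_top" by real_asymp
    then show "(((\<lambda>x::real. - (1 / x)) \<circ> real_of_ereal) \<longlongrightarrow> 0) (at_left \<infinity>)"
      unfolding ereal_tendsto_simps by simp
  qed auto
  moreover have "einterval 1 \<infinity> = {1<..}" by (auto simp: einterval_def)
  ultimately have 1: "set_integrable lborel {1<..} (\<lambda>x::real. 1 / x\<^sup>2)" by simp
  have "set_integrable lborel {1..1} (\<lambda>x::real. 1 / x\<^sup>2)"
    by (rule borel_integrable_atLeastAtMost') (auto intro!: continuous_intros)
  then have 2: "set_integrable lborel {1} (\<lambda>x::real. 1 / x\<^sup>2)" by simp
  have "{1..} = {1<..} \<union> {1::real}" by auto
  then show ?thesis using set_integrable_Un[OF 1 2] by simp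
qed

text \<open>On \<open>[1, \<infinity>)\<close> the kernel differs from \<open>1/(e\<^sup>w - 1)\<close> by the square-integrable \<open>1/w\<close>, which is absorbed by
\<open>2AB \<le> \<eta>A\<^sup>2 + B\<^sup>2/\<eta>\<close>; on \<open>(0, 1)\<close> it is bounded. The parameter \<open>\<eta>\<close> stays free so that it can tend to \<open>0\<close>
with \<open>\<delta>\<close>.\<close>

lemma bose_energy_bounds:
  obtains C where "C > 0"
    "\<And>\<delta> \<eta>. 0 < \<delta> \<Longrightarrow> \<delta> < pi / 2 \<Longrightarrow> 0 < \<eta> \<Longrightarrow>
       bose_energy \<delta> \<le> (1 + \<eta>) * (pi / (sin \<delta> * cos \<delta>) - bose_prim (sin \<delta>) 1) + C * (1 + 1 / \<eta>)"
    "\<And>\<delta> \<eta>. 0 < \<delta> \<Longrightarrow> \<delta> < pi / 2 \<Longrightarrow> 0 < \<eta> \<Longrightarrow> \<eta> < 1 \<Longrightarrow> cos \<delta> > 1 / 2 \<Longrightarrow>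
       bose_energy \<delta> \<ge> (1 - \<eta>) * (- bose_prim (sin \<delta>) 17) - C * (1 / \<eta>)"
proof -
  obtain C0 where C0: "C0 > 0" "\<And>z. norm z \<le> 2 \<Longrightarrow> norm (bose z) \<le> C0" by (rule bose_bound_ball) blast
  define J where "J = (LBINT x:{1..}. 1 / x\<^sup>2 :: real)"
  have J0: "J \<ge> 0" unfolding J_def set_lebesgue_integral_def by (intro integral_nonneg_AE) auto
  define C where "C = C0\<^sup>2 + J"
  have key: "bose_energy \<delta> \<le> (1 + \<eta>) * (pi / (sin \<delta> * cos \<delta>) - bose_prim (sin \<delta>) 1) + C * (1 + 1 / \<eta>)
     \<and> (\<eta> < 1 \<longrightarrow> cos \<delta> > 1 / 2 \<longrightarrow> bose_energy \<delta> \<ge> (1 - \<eta>) * (- bose_prim (sin \<delta>) 17) - C * (1 / \<eta>))"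
    if \<delta>: "0 < \<delta>" "\<delta> < pi / 2" and \<eta>: "0 < \<eta>" for \<delta> \<eta>
  proof -
    define \<sigma> where "\<sigma> = sin \<delta>"
    define c where "c = cos \<delta>"
    have \<sigma>: "\<sigma> > 0" using \<delta> by (auto simp: \<sigma>_def intro!: sin_gt_zero)
    have c: "c > 0" using \<delta> by (auto simp: c_def intro!: cos_gt_zero)
    define L where "L = 2 * pi / c"
    have L: "L > 0" using c by (simp add: L_def)
    define \<omega> where "\<omega> = cis (pi / 2 - \<delta>)"
    have \<omega>: "\<omega> = Complex \<sigma> c" by (simp add: \<omega>_def \<sigma>_def c_def complex_eq_iff cos_diff sin_diff)
    have n\<omega>: "norm \<omega> = 1" by (simp add: \<omega>_def)
    define b where "b x = (norm (bose (of_real x * \<omega>)))\<^sup>2" for x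
    define p where "p x = 1 / (norm (of_real (exp (\<sigma> * x)) * cis (c * x) - 1))\<^sup>2" for x
    have bint: "set_integrable lborel {0<..} b"
      using bose_energy_integrable[OF \<delta>] by (simp add: b_def[abs_def] \<omega>_def)
    have pm [measurable]: "p \<in> borel_measurable borel" unfolding p_def cis_conv_exp by measurable
    have b_eq: "norm (1 / (of_real (exp (\<sigma> * x)) * cis (c * x) - 1) - 1 / (of_real x * \<omega>)) = norm (bose (of_real x * \<omega>))" if x: "x \<ge> 1" for x
    proof -
      have e: "exp (of_real x * \<omega>) = of_real (exp (\<sigma> * x)) * cis (c * x)"
        by (simp add: \<omega> exp_eq_polar mult.commute)
      have "of_real x * \<omega> \<noteq> 0" using x n\<omega> by auto
      moreover have "exp (of_real x * \<omega>) \<noteq> 1" using x \<sigma> by (intro exp_ne_1) (auto simp: \<omega> complex_eq_iff)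
      ultimately show ?thesis by (simp add: bose_eq e[symmetric])
    qed
    have ineq: "b x \<le> (1 + \<eta>) * p x + (1 + 1 / \<eta>) * (1 / x\<^sup>2)" "b x \<ge> (1 - \<eta>) * p x - (1 / \<eta>) * (1 / x\<^sup>2)"
      "p x \<le> 2 * b x + 2 * (1 / x\<^sup>2)" if x: "x \<ge> 1" for x
    proof -
      define X where "X = 1 / (of_real (exp (\<sigma> * x)) * cis (c * x) - 1)"
      define Y where "Y = 1 / (of_real x * \<omega>)"
      define A where "A = norm X"
      define B where "B = norm Y"
      define D where "D = norm (bose (of_real x * \<omega>))"
      have D': "D = norm (X - Y)" unfolding D_def X_def Y_def b_eq[OF x] ..
      have t: "D \<le> A + B" "A \<le> D + B" "B \<le> D + A" unfolding A_def B_def D'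
        using norm_triangle_ineq4[of X Y] norm_triangle_sub[of X Y] norm_triangle_sub[of Y X] norm_minus_commute[of X Y]
        by linarith+
      have nn: "A \<ge> 0" "B \<ge> 0" "D \<ge> 0" by (simp_all add: A_def B_def D_def)
      have A: "p x = A\<^sup>2" by (simp add: p_def A_def X_def norm_divide power_divide)
      have B: "1 / x\<^sup>2 = B\<^sup>2" using x by (simp add: B_def Y_def norm_divide norm_mult n\<omega> power_divide)
      have D: "b x = D\<^sup>2" by (simp add: b_def D_def)
      have am: "2 * A * B \<le> \<eta> * A\<^sup>2 + (1 / \<eta>) * B\<^sup>2"
      proof -
        have "0 \<le> (\<eta> * A - B)\<^sup>2 / \<eta>" using \<eta> by simp
        also have "\<dots> = \<eta> * A\<^sup>2 + (1 / \<eta>) * B\<^sup>2 - 2 * A * B" using \<eta> by (simp add: field_simps power2_eq_square)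
        finally show ?thesis by simp
      qed
      have "D\<^sup>2 \<le> (A + B)\<^sup>2" using t nn by (intro power_mono) auto
      then show "b x \<le> (1 + \<eta>) * p x + (1 + 1 / \<eta>) * (1 / x\<^sup>2)"
        unfolding A B D using am by (simp add: power2_sum algebra_simps)
      have "\<bar>A - B\<bar> \<le> \<bar>D\<bar>" using t nn by auto
      then have "(A - B)\<^sup>2 \<le> D\<^sup>2" by (simp only: abs_le_square_iff)
      then have "A\<^sup>2 + B\<^sup>2 - 2 * A * B \<le> D\<^sup>2" by (simp add: power2_diff)
      then show "b x \<ge> (1 - \<eta>) * p x - (1 / \<eta>) * (1 / x\<^sup>2)"
        unfolding A B D using am zero_le_power2[of B] left_diff_distrib[of 1 \<eta> "A\<^sup>2"] by linarith
      have "A\<^sup>2 \<le> (D + B)\<^sup>2" using t nn by (intro power_mono) auto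
      moreover have "(D + B)\<^sup>2 \<le> 2 * D\<^sup>2 + 2 * B\<^sup>2" using zero_le_power2[of "D - B"] by (simp add: power2_sum power2_diff)
      ultimately show "p x \<le> 2 * b x + 2 * (1 / x\<^sup>2)" unfolding A B D by linarith
    qed
    have b1: "set_integrable lborel {1..} b" by (rule set_integrable_subset[OF bint]) auto
    have b0: "set_integrable lborel {0<..<1} b" by (rule set_integrable_subset[OF bint]) auto
    note J1 = inverse_square_integrable
    have p0: "p x \<ge> 0" for x by (simp add: p_def)
    have p1: "set_integrable lborel {1..} p"
    proof (rule set_integrable_bound[where f = "\<lambda>x. 2 * b x + 2 * (1 / x\<^sup>2)"])
      show "set_integrable lborel {1..} (\<lambda>x. 2 * b x + 2 * (1 / x\<^sup>2))"
        using b1 J1 by (intro set_integral_add(1) set_integrable_mult_right) auto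
      show "AE x in lborel. x \<in> {1..} \<longrightarrow> norm (p x) \<le> norm (2 * b x + 2 * (1 / x\<^sup>2))"
        using ineq(3) p0 by (intro AE_I2) (auto intro: order_trans[OF _ abs_ge_self])
    qed (simp add: set_borel_measurable_def)
    define T where "T = (LBINT x:{1..}. p x)"
    have T0: "T \<ge> 0" unfolding T_def set_lebesgue_integral_def using p0 by (intro integral_nonneg_AE) auto
    have I_eq: "(LBINT x:{1..1 + real N * L}. p x) = integral {1..1 + real N * L} p" for N
      by (rule set_borel_integral_eq_integral(2)) (rule set_integrable_subset[OF p1], auto)
    have lim: "(\<lambda>N. integral {1..1 + real N * L} p) \<longlonglongrightarrow> T"
      unfolding I_eq[symmetric] T_def set_lebesgue_integral_def
    proof (rule integral_dominated_convergence)
      show "integrable lborel (\<lambda>x. indicator {1..} x *\<^sub>R p x)" using p1 by (simp add: set_integrable_def)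
      show "AE x in lborel. (\<lambda>N. indicator {1..1 + real N * L} x *\<^sub>R p x) \<longlonglongrightarrow> indicator {1..} x *\<^sub>R p x"
      proof (intro AE_I2 tendsto_eventually)
        fix x :: real
        obtain n0 :: nat where "\<bar>x\<bar> / L < real n0" using reals_Archimedean2 by blast
        then have n0: "\<bar>x\<bar> < real n0 * L" using L by (simp add: divide_less_eq)
        show "\<forall>\<^sub>F N in sequentially. indicator {1..1 + real N * L} x *\<^sub>R p x = indicator {1..} x *\<^sub>R p x"
        proof (rule eventually_sequentiallyI[of n0])
          fix N assume "n0 \<le> N"
          then have "real n0 * L \<le> real N * L" using L by (intro mult_right_mono) auto
          then have "x < 1 + real N * L" using n0 by linarith
          then show "indicator {1..1 + real N * L} x *\<^sub>R p x = indicator {1..} x *\<^sub>R p x" by (auto simp: indicator_def)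
        qed
      qed
      show "AE x in lborel. norm (indicator {1..1 + real N * L} x *\<^sub>R p x) \<le> indicator {1..} x *\<^sub>R p x" for N
        using p0 by (intro AE_I2) (auto simp: indicator_def)
    qed simp_all
    have Tup: "T \<le> L / (2 * \<sigma>) - bose_prim \<sigma> 1"
      using poisson_integral_bounds(1)[OF \<sigma> c] unfolding L_def[symmetric] p_def[symmetric]
      by (intro LIMSEQ_le_const2[OF lim]) auto
    have Tlo: "- bose_prim \<sigma> (1 + L) \<le> T"
    proof (rule LIMSEQ_le[OF _ lim])
      have "(\<lambda>N. bose_prim \<sigma> (1 + real (Suc N) * L) - bose_prim \<sigma> (1 + L)) \<longlonglongrightarrow> 0 - bose_prim \<sigma> (1 + L)"
        unfolding bose_prim_def using \<sigma> L by real_asymp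
      then show "(\<lambda>N. bose_prim \<sigma> (1 + real (Suc N) * L) - bose_prim \<sigma> (1 + L)) \<longlonglongrightarrow> - bose_prim \<sigma> (1 + L)" by simp
      show "\<exists>N. \<forall>n\<ge>N. bose_prim \<sigma> (1 + real (Suc n) * L) - bose_prim \<sigma> (1 + L) \<le> integral {1..1 + real n * L} p"
        using poisson_integral_bounds(2)[OF \<sigma> c] unfolding L_def[symmetric] p_def[symmetric] by auto
    qed
    have E: "bose_energy \<delta> = (LBINT x:{0<..<1}. b x) + (LBINT x:{1..}. b x)"
    proof -
      have U: "{0<..} = {0<..<1} \<union> {1::real..}" by auto
      have "bose_energy \<delta> = (LBINT x:{0<..}. b x)" by (simp add: bose_energy_def b_def \<omega>_def)
      also have "\<dots> = (LBINT x:{0<..<1}. b x) + (LBINT x:{1..}. b x)"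
        unfolding U by (rule set_integral_Un[OF _ b0 b1]) auto
      finally show ?thesis .
    qed
    have e0: "0 \<le> (LBINT x:{0<..<1}. b x)"
      unfolding set_lebesgue_integral_def by (intro integral_nonneg_AE) (auto simp: b_def)
    have e1: "(LBINT x:{0<..<1}. b x) \<le> C0\<^sup>2"
    proof -
      have "(LBINT x:{0<..<1}. b x) \<le> (LBINT x:{0<..<1::real}. C0\<^sup>2)"
      proof (rule set_integral_mono[OF b0])
        show "b x \<le> C0\<^sup>2" if "x \<in> {0<..<1}" for x
          unfolding b_def using that by (intro power_mono C0(2)) (auto simp: norm_mult n\<omega>)
      qed (simp add: set_integrable_def)
      also have "\<dots> = C0\<^sup>2" by (simp add: set_lebesgue_integral_def)
      finally show ?thesis .
    qed
    have up: "(LBINT x:{1..}. b x) \<le> (1 + \<eta>) * T + (1 + 1 / \<eta>) * J"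
    proof -
      have i: "set_integrable lborel {1..} (\<lambda>x. (1 + \<eta>) * p x)" "set_integrable lborel {1..} (\<lambda>x. (1 + 1 / \<eta>) * (1 / x\<^sup>2))"
        using p1 J1 by (auto intro!: set_integrable_mult_right simp del: times_divide_eq_right)
      have "(LBINT x:{1..}. b x) \<le> (LBINT x:{1..}. (1 + \<eta>) * p x + (1 + 1 / \<eta>) * (1 / x\<^sup>2))"
        using ineq(1) by (intro set_integral_mono b1 set_integral_add(1) i) auto
      also have "\<dots> = (1 + \<eta>) * T + (1 + 1 / \<eta>) * J"
        unfolding set_integral_add(2)[OF i] T_def J_def set_integral_mult_right ..
      finally show ?thesis .
    qed
    have lo: "(LBINT x:{1..}. b x) \<ge> (1 - \<eta>) * T - (1 / \<eta>) * J"
    proof -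
      have i: "set_integrable lborel {1..} (\<lambda>x. (1 - \<eta>) * p x)" "set_integrable lborel {1..} (\<lambda>x. (1 / \<eta>) * (1 / x\<^sup>2))"
        using p1 J1 by (auto intro!: set_integrable_mult_right simp del: times_divide_eq_right times_divide_eq_left)
      have "(LBINT x:{1..}. b x) \<ge> (LBINT x:{1..}. (1 - \<eta>) * p x - (1 / \<eta>) * (1 / x\<^sup>2))"
        using ineq(2) by (intro set_integral_mono b1 set_integral_diff(1) i) auto
      also have "(LBINT x:{1..}. (1 - \<eta>) * p x - (1 / \<eta>) * (1 / x\<^sup>2)) = (1 - \<eta>) * T - (1 / \<eta>) * J"
        unfolding set_integral_diff(2)[OF i] T_def J_def set_integral_mult_right ..
      finally show ?thesis .
    qed
    have L2: "L / (2 * \<sigma>) = pi / (\<sigma> * c)" by (simp add: L_def)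
    have "bose_energy \<delta> \<le> C0\<^sup>2 + ((1 + \<eta>) * (L / (2 * \<sigma>) - bose_prim \<sigma> 1) + (1 + 1 / \<eta>) * J)"
    proof -
      have "(1 + \<eta>) * T \<le> (1 + \<eta>) * (L / (2 * \<sigma>) - bose_prim \<sigma> 1)" using \<eta> Tup by (intro mult_left_mono) auto
      then show ?thesis unfolding E using e1 up by linarith
    qed
    also have "\<dots> \<le> (1 + \<eta>) * (L / (2 * \<sigma>) - bose_prim \<sigma> 1) + C * (1 + 1 / \<eta>)"
    proof -
      have "0 \<le> C0\<^sup>2 * (1 / \<eta>)" using \<eta> by simp
      then show ?thesis by (simp add: C_def algebra_simps)
    qed
    finally have 1: "bose_energy \<delta> \<le> (1 + \<eta>) * (pi / (\<sigma> * c) - bose_prim \<sigma> 1) + C * (1 + 1 / \<eta>)" unfolding L2 .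
    have 2: "bose_energy \<delta> \<ge> (1 - \<eta>) * (- bose_prim \<sigma> 17) - C * (1 / \<eta>)" if "\<eta> < 1" "c > 1 / 2"
    proof -
      have "L \<le> 2 * pi / (1 / 2)" unfolding L_def using that(2) by (intro divide_left_mono) auto
      \<comment> \<open>\<open>1 + 4\<pi> < 17\<close>: a bound for the period free of \<open>\<delta>\<close> keeps the limit below elementary\<close>
      then have "1 + L \<le> 17" using pi_less_4 by simp
      then have "bose_prim \<sigma> (1 + L) \<le> bose_prim \<sigma> 17"
        unfolding bose_prim_def using \<sigma> L by (intro divide_right_mono ln_mono) auto
      then have Tlo: "- bose_prim \<sigma> 17 \<le> T" using Tlo by linarith
      have "0 \<le> C0\<^sup>2 * (1 / \<eta>)" using \<eta> by simp
      moreover have "(1 - \<eta>) * (- bose_prim \<sigma> 17) \<le> (1 - \<eta>) * T" using that Tlo by (intro mult_left_mono) auto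
      moreover have "C * (1 / \<eta>) = C0\<^sup>2 * (1 / \<eta>) + (1 / \<eta>) * J" by (simp add: C_def algebra_simps)
      ultimately show ?thesis unfolding E using e0 lo by linarith
    qed
    show ?thesis using 1 2 by (simp add: \<sigma>_def c_def L_def)
  qed
  have "C > 0" using C0 J0 by (simp add: C_def add_pos_nonneg)
  then show ?thesis using key by (intro that[of C]) blast+
qed

lemma bose_energy_asymp:
  "((\<lambda>\<delta>. bose_energy \<delta> * (2 * \<delta>) / ln (1 / \<delta>)) \<longlongrightarrow> 1) (at_right 0)"
proof -
  obtain C where C: "C > 0"
    "\<And>\<delta> \<eta>. 0 < \<delta> \<Longrightarrow> \<delta> < pi / 2 \<Longrightarrow> 0 < \<eta> \<Longrightarrow>
       bose_energy \<delta> \<le> (1 + \<eta>) * (pi / (sin \<delta> * cos \<delta>) - bose_prim (sin \<delta>) 1) + C * (1 + 1 / \<eta>)"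
    "\<And>\<delta> \<eta>. 0 < \<delta> \<Longrightarrow> \<delta> < pi / 2 \<Longrightarrow> 0 < \<eta> \<Longrightarrow> \<eta> < 1 \<Longrightarrow> cos \<delta> > 1 / 2 \<Longrightarrow>
       bose_energy \<delta> \<ge> (1 - \<eta>) * (- bose_prim (sin \<delta>) 17) - C * (1 / \<eta>)"
    by (rule bose_energy_bounds) blast
  have ev: "eventually (\<lambda>\<delta>::real. 0 < \<delta> \<and> \<delta> < 1) (at_right 0)"
    by (auto simp: eventually_at_right_field intro: exI[of _ 1])
  have "eventually (\<lambda>\<delta>::real. cos \<delta> > 1 / 2) (at_right 0)" by real_asymp
  then have ev': "eventually (\<lambda>\<delta>::real. 0 < \<delta> \<and> \<delta> < 1 \<and> cos \<delta> > 1 / 2) (at_right 0)"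
    using ev by eventually_elim auto
  have pi1: "\<delta> < pi / 2" if "\<delta> < 1" for \<delta> :: real using that pi_gt3 by simp
  have mono: "a * (2 * \<delta>) / ln (1 / \<delta>) \<le> b * (2 * \<delta>) / ln (1 / \<delta>)" if "a \<le> b" "0 < \<delta>" "\<delta> < 1" for a b \<delta> :: real
    using that by (intro divide_right_mono mult_right_mono) (auto simp: ln_div)
  \<comment> \<open>with \<open>\<eta> = sqrt \<delta>\<close> the error \<open>1/\<eta>\<close> is still \<open>o(1/\<delta>)\<close>\<close>
  show ?thesis
  proof (rule tendsto_sandwich)
    show "\<forall>\<^sub>F \<delta> in at_right 0. bose_energy \<delta> * (2 * \<delta>) / ln (1 / \<delta>) \<le>
       ((1 + sqrt \<delta>) * (pi / (sin \<delta> * cos \<delta>) - bose_prim (sin \<delta>) 1) + C * (1 + 1 / sqrt \<delta>)) * (2 * \<delta>) / ln (1 / \<delta>)"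
      using ev by eventually_elim (rule mono[OF C(2)], use pi1 in auto)
    show "\<forall>\<^sub>F \<delta> in at_right 0. bose_energy \<delta> * (2 * \<delta>) / ln (1 / \<delta>) \<ge>
       ((1 - sqrt \<delta>) * (- bose_prim (sin \<delta>) 17) - C * (1 / sqrt \<delta>)) * (2 * \<delta>) / ln (1 / \<delta>)"
      using ev' by eventually_elim (rule mono[OF C(3)], use pi1 in auto)
    show "((\<lambda>\<delta>. ((1 + sqrt \<delta>) * (pi / (sin \<delta> * cos \<delta>) - bose_prim (sin \<delta>) 1) + C * (1 + 1 / sqrt \<delta>)) * (2 * \<delta>) / ln (1 / \<delta>)) \<longlongrightarrow> 1) (at_right 0)"
      unfolding bose_prim_def by real_asymp
    show "((\<lambda>\<delta>. ((1 - sqrt \<delta>) * (- bose_prim (sin \<delta>) 17) - C * (1 / sqrt \<delta>)) * (2 * \<delta>) / ln (1 / \<delta>)) \<longlongrightarrow> 1) (at_right 0)"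
      unfolding bose_prim_def by real_asymp
  qed
qed

section \<open>Laplace transforms of the squared zeta function\<close>

definition zeta_laplace :: "real \<Rightarrow> real" where
  "zeta_laplace \<delta> = (LBINT t:{0..}. zeta_sq t * exp (- 2 * \<delta> * t))"

definition zeta_laplace1 :: "real \<Rightarrow> real" where
  "zeta_laplace1 \<delta> = (LBINT t:{0..}. zeta_sq t * t * exp (- 2 * \<delta> * t))"

lemma zeta_laplace_integrable:
  assumes \<delta>: "\<delta> > 0"
  shows "set_integrable lborel {0..} (\<lambda>t. zeta_sq t * exp (- 2 * \<delta> * t))"
proof -
  define \<delta>' where "\<delta>' = min \<delta> 1"
  have \<delta>': "0 < \<delta>'" "\<delta>' < pi / 2" "\<delta>' \<le> \<delta>" using \<delta> pi_gt3 by (auto simp: \<delta>'_def min_def)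
  note I = integrable_mult_right[OF zeta_energy_integrable[OF \<delta>'(1,2)], of 2]
  show ?thesis unfolding set_integrable_def
  proof (rule Bochner_Integration.integrable_bound[OF I])
    have "indicator {0..} t *\<^sub>R (zeta_sq t * exp (- 2 * \<delta> * t)) \<le> 2 * (zeta_sq t * exp (- 2 * \<delta>' * t) / (1 + exp (- 2 * pi * t)))" for t
    proof (cases "t \<ge> 0")
      case True
      have "exp (- 2 * \<delta> * t) \<le> exp (- 2 * \<delta>' * t)" using \<delta>' True by (simp add: mult_right_mono)
      moreover have "1 / 2 \<le> 1 / (1 + exp (- 2 * pi * t))" using True by (intro divide_left_mono) (auto intro: add_pos_pos)
      ultimately have "zeta_sq t * exp (- 2 * \<delta> * t) * (1 / 2) \<le> zeta_sq t * exp (- 2 * \<delta>' * t) * (1 / (1 + exp (- 2 * pi * t)))"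
        by (intro mult_mono) auto
      then show ?thesis using True by (simp add: mult_ac)
    next
      case False
      have "0 < 1 + exp (- 2 * pi * t)" by (simp add: add_pos_pos)
      then show ?thesis using False by simp
    qed
    then show "AE t in lborel. norm (indicator {0..} t *\<^sub>R (zeta_sq t * exp (- 2 * \<delta> * t)))
       \<le> norm (2 * (zeta_sq t * exp (- 2 * \<delta>' * t) / (1 + exp (- 2 * pi * t))))"
      by (intro AE_I2) (auto simp: indicator_def intro: order_trans[OF _ abs_ge_self])
  qed simp
qed

lemma zeta_laplace1_integrable:
  assumes \<delta>: "\<delta> > 0"
  shows "set_integrable lborel {0..} (\<lambda>t. zeta_sq t * t * exp (- 2 * \<delta> * t))"
proof (rule set_integrable_bound)
  have "\<delta> / 2 > 0" using \<delta> by simp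
  from set_integrable_mult_right[OF zeta_laplace_integrable[OF this], of "1 / \<delta>"]
  show "set_integrable lborel {0..} (\<lambda>t. (1 / \<delta>) * (zeta_sq t * exp (- 2 * (\<delta> / 2) * t)))" by blast
  have le: "zeta_sq t * t * exp (- 2 * \<delta> * t) \<le> (1 / \<delta>) * (zeta_sq t * exp (- 2 * (\<delta> / 2) * t))" if t: "t \<ge> 0" for t
  proof -
    have "\<delta> * t \<le> exp (\<delta> * t)" using exp_ge_add_one_self[of "\<delta> * t"] by linarith
    then have "t \<le> (1 / \<delta>) * exp (\<delta> * t)" using \<delta> by (simp add: field_simps)
    then have "t * exp (- 2 * \<delta> * t) \<le> (1 / \<delta>) * exp (\<delta> * t) * exp (- 2 * \<delta> * t)" by (intro mult_right_mono) auto
    also have "\<dots> = (1 / \<delta>) * exp (- 2 * (\<delta> / 2) * t)" by (simp add: mult.assoc mult_exp_exp)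
    finally have "zeta_sq t * (t * exp (- 2 * \<delta> * t)) \<le> zeta_sq t * ((1 / \<delta>) * exp (- 2 * (\<delta> / 2) * t))"
      by (intro mult_left_mono) auto
    then show ?thesis by (simp add: mult_ac)
  qed
  show "AE t in lborel. t \<in> {0..} \<longrightarrow> norm (zeta_sq t * t * exp (- 2 * \<delta> * t)) \<le> norm ((1 / \<delta>) * (zeta_sq t * exp (- 2 * (\<delta> / 2) * t)))"
  proof (intro AE_I2 impI)
    fix t :: real assume "t \<in> {0..}"
    then have t: "t \<ge> 0" by simp
    then have "0 \<le> zeta_sq t * t * exp (- 2 * \<delta> * t)" by simp
    then show "norm (zeta_sq t * t * exp (- 2 * \<delta> * t)) \<le> norm ((1 / \<delta>) * (zeta_sq t * exp (- 2 * (\<delta> / 2) * t)))"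
      unfolding real_norm_def using le[OF t] by linarith
  qed
qed (simp add: set_borel_measurable_def)

text \<open>The energy formula has the weight \<open>1/(1 + exp(-2\<pi>t))\<close> and runs over all real \<open>t\<close>. For \<open>\<delta> \<le> 1\<close> the part \<open>t < 0\<close> is
dominated by its value at \<open>\<delta> = 1\<close>, and on \<open>t \<ge> 0\<close> the weight differs from \<open>1\<close> by at most \<open>exp(-2\<pi>t)\<close>.\<close>

lemma zeta_laplace_bose_energy:
  obtains K where "\<And>\<delta>. 0 < \<delta> \<Longrightarrow> \<delta> \<le> 1 \<Longrightarrow> \<bar>zeta_laplace \<delta> - bose_energy \<delta>\<bar> \<le> K"
proof -
  define W where "W \<delta> t = zeta_sq t * exp (- 2 * \<delta> * t) / (1 + exp (- 2 * pi * t))" for \<delta> t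
  have den: "1 + exp (- 2 * pi * t) > 0" for t by (simp add: add_pos_pos)
  have W0: "W \<delta> t \<ge> 0" for \<delta> t using den[of t] by (simp add: W_def)
  have pi2: "\<delta> < pi / 2" if "\<delta> \<le> 1" for \<delta> using that pi_gt3 by simp
  have Wint: "set_integrable lborel A (W \<delta>)" if "0 < \<delta>" "\<delta> \<le> 1" "A \<in> sets borel" for \<delta> A
    using zeta_energy_integrable[OF that(1) pi2[OF that(2)]] that(3)
    unfolding W_def[abs_def] set_integrable_def by (intro integrable_mult_indicator) auto
  define K1 where "K1 = (LBINT t:{..<0}. W 1 t)"
  have K10: "K1 \<ge> 0" unfolding K1_def set_lebesgue_integral_def using W0 by (intro integral_nonneg_AE) auto
  have L10: "zeta_laplace 1 \<ge> 0" unfolding zeta_laplace_def set_lebesgue_integral_def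
    by (intro integral_nonneg_AE) (auto simp: indicator_def)
  show ?thesis
  proof (rule that[of "K1 + zeta_laplace 1"])
    fix \<delta> :: real assume \<delta>: "0 < \<delta>" "\<delta> \<le> 1"
    have U: "{..<0::real} \<union> {0..} = UNIV" by auto
    have E: "bose_energy \<delta> = (LBINT t:{..<0}. W \<delta> t) + (LBINT t:{0..}. W \<delta> t)"
      using set_integral_Un[OF _ Wint[OF \<delta>, of "{..<0}"] Wint[OF \<delta>, of "{0..}"]] zeta_energy_eq[OF \<delta>(1) pi2[OF \<delta>(2)]]
      unfolding U W_def[symmetric] by (simp add: set_lebesgue_integral_def disjoint_iff)
    have 1: "0 \<le> (LBINT t:{..<0}. W \<delta> t)" unfolding set_lebesgue_integral_def using W0 by (intro integral_nonneg_AE) auto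
    have 2: "(LBINT t:{..<0}. W \<delta> t) \<le> K1"
      unfolding K1_def
    proof (rule set_integral_mono[OF Wint[OF \<delta>] Wint])
      fix t :: real assume "t \<in> {..<0}"
      then have "\<delta> * (- t) \<le> 1 * (- t)" using \<delta> by (intro mult_right_mono) auto
      then have "exp (- 2 * \<delta> * t) \<le> exp (- 2 * 1 * t)" by simp
      then show "W \<delta> t \<le> W 1 t" unfolding W_def using den[of t] by (intro divide_right_mono mult_left_mono) auto
    qed auto
    have 3: "(LBINT t:{0..}. W \<delta> t) \<le> zeta_laplace \<delta>"
      unfolding zeta_laplace_def
    proof (rule set_integral_mono[OF Wint[OF \<delta>] zeta_laplace_integrable[OF \<delta>(1)]])
      fix t :: real
      have "zeta_sq t * exp (- 2 * \<delta> * t) / (1 + exp (- 2 * pi * t)) \<le> zeta_sq t * exp (- 2 * \<delta> * t) / 1"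
        using den[of t] by (intro divide_left_mono) auto
      then show "W \<delta> t \<le> zeta_sq t * exp (- 2 * \<delta> * t)" by (simp add: W_def)
    qed auto
    have 4: "zeta_laplace \<delta> \<le> (LBINT t:{0..}. W \<delta> t) + zeta_laplace 1"
    proof -
      have i: "set_integrable lborel {0..} (W \<delta>)" by (rule Wint[OF \<delta>]) simp
      note j = zeta_laplace_integrable[OF zero_less_one]
      have "zeta_laplace \<delta> \<le> (LBINT t:{0..}. W \<delta> t + zeta_sq t * exp (- 2 * 1 * t))"
        unfolding zeta_laplace_def
      proof (rule set_integral_mono[OF zeta_laplace_integrable[OF \<delta>(1)] set_integral_add(1)[OF i j]])
        fix t :: real assume t: "t \<in> {0..}"
        have "zeta_sq t * exp (- 2 * \<delta> * t) - W \<delta> t = zeta_sq t * (exp (- 2 * \<delta> * t) * (exp (- 2 * pi * t) / (1 + exp (- 2 * pi * t))))"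
          using den[of t] by (simp add: W_def field_simps)
        also have "\<dots> \<le> zeta_sq t * (1 * exp (- 2 * 1 * t))"
        proof (intro mult_left_mono mult_mono)
          have "exp (- 2 * pi * t) / (1 + exp (- 2 * pi * t)) \<le> exp (- 2 * pi * t) / 1"
            using den[of t] by (intro divide_left_mono) auto
          also have "\<dots> \<le> exp (- 2 * 1 * t)"
          proof -
            have "1 * t \<le> pi * t" using t pi_gt3 by (intro mult_right_mono) auto
            then show ?thesis by simp
          qed
          finally show "exp (- 2 * pi * t) / (1 + exp (- 2 * pi * t)) \<le> exp (- 2 * 1 * t)" .
        qed (use t \<delta> den[of t] in auto)
        finally show "zeta_sq t * exp (- 2 * \<delta> * t) \<le> W \<delta> t + zeta_sq t * exp (- 2 * 1 * t)" by simp
      qed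
      also have "\<dots> = (LBINT t:{0..}. W \<delta> t) + zeta_laplace 1"
        unfolding set_integral_add(2)[OF i j] zeta_laplace_def ..
      finally show ?thesis .
    qed
    show "\<bar>zeta_laplace \<delta> - bose_energy \<delta>\<bar> \<le> K1 + zeta_laplace 1"
      unfolding E using 1 2 3 4 K10 L10 by linarith
  qed
qed

lemma zeta_laplace_asymp:
  "((\<lambda>\<delta>. zeta_laplace \<delta> * (2 * \<delta>) / ln (1 / \<delta>)) \<longlongrightarrow> 1) (at_right 0)"
proof -
  obtain K where K: "\<And>\<delta>. 0 < \<delta> \<Longrightarrow> \<delta> \<le> 1 \<Longrightarrow> \<bar>zeta_laplace \<delta> - bose_energy \<delta>\<bar> \<le> K"
    by (rule zeta_laplace_bose_energy) blast
  have "((\<lambda>\<delta>. (zeta_laplace \<delta> - bose_energy \<delta>) * (2 * \<delta> / ln (1 / \<delta>))) \<longlongrightarrow> 0) (at_right 0)"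
  proof (rule Lim_null_comparison)
    have "eventually (\<lambda>\<delta>::real. 0 < \<delta> \<and> \<delta> < 1) (at_right 0)"
      by (auto simp: eventually_at_right_field intro: exI[of _ 1])
    then show "\<forall>\<^sub>F \<delta> in at_right 0. norm ((zeta_laplace \<delta> - bose_energy \<delta>) * (2 * \<delta> / ln (1 / \<delta>))) \<le> K * (2 * \<delta> / ln (1 / \<delta>))"
    proof eventually_elim
      case (elim \<delta>)
      then have "ln (1 / \<delta>) > 0" by (simp add: ln_div)
      then have p: "2 * \<delta> / ln (1 / \<delta>) \<ge> 0" using elim by simp
      show ?case using mult_right_mono[OF K[of \<delta>] p] elim abs_of_nonneg[OF p]
        by (simp only: norm_mult real_norm_def abs_mult less_imp_le)
    qed
    show "((\<lambda>\<delta>. K * (2 * \<delta> / ln (1 / \<delta>))) \<longlongrightarrow> 0) (at_right 0)" by real_asymp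
  qed
  from tendsto_add[OF this bose_energy_asymp] show ?thesis
    by (simp add: left_diff_distrib diff_divide_distrib)
qed

lemma zeta_laplace_scaled_asymp:
  assumes c: "c > 0"
  shows "((\<lambda>\<delta>. zeta_laplace (c * \<delta>) * (2 * \<delta>) / ln (1 / \<delta>)) \<longlongrightarrow> 1 / c) (at_right 0)"
proof -
  have lim: "filterlim (\<lambda>\<delta>. c * \<delta>) (at_right 0) (at_right (0::real))" using c by real_asymp
  have 1: "((\<lambda>\<delta>. zeta_laplace (c * \<delta>) * (2 * (c * \<delta>)) / ln (1 / (c * \<delta>))) \<longlongrightarrow> 1) (at_right 0)"
    by (rule filterlim_compose[OF zeta_laplace_asymp lim])
  have 2: "((\<lambda>\<delta>. ln (1 / (c * \<delta>)) / ln (1 / \<delta>) / c) \<longlongrightarrow> 1 / c) (at_right 0)"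
    using c by real_asymp (simp add: divide_inverse)
  have "((\<lambda>\<delta>. zeta_laplace (c * \<delta>) * (2 * (c * \<delta>)) / ln (1 / (c * \<delta>)) * (ln (1 / (c * \<delta>)) / ln (1 / \<delta>) / c)) \<longlongrightarrow> 1 * (1 / c)) (at_right 0)"
    by (rule tendsto_mult[OF 1 2])
  moreover have "eventually (\<lambda>\<delta>. ln (1 / (c * \<delta>)) > 0) (at_right 0)" using c by real_asymp
  then have "eventually (\<lambda>\<delta>. zeta_laplace (c * \<delta>) * (2 * (c * \<delta>)) / ln (1 / (c * \<delta>)) * (ln (1 / (c * \<delta>)) / ln (1 / \<delta>) / c)
      = zeta_laplace (c * \<delta>) * (2 * \<delta>) / ln (1 / \<delta>)) (at_right 0)"
  proof eventually_elim
    case (elim \<delta>)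
    define l where "l = ln (1 / (c * \<delta>))"
    have "l \<noteq> 0" using elim by (simp add: l_def)
    then have "zeta_laplace (c * \<delta>) * (2 * (c * \<delta>)) / l * (l / ln (1 / \<delta>) / c) = zeta_laplace (c * \<delta>) * (2 * \<delta>) / ln (1 / \<delta>)"
      using c by simp
    then show ?case by (simp only: l_def)
  qed
  ultimately show ?thesis using tendsto_cong by fastforce
qed

text \<open>Convexity of \<open>exp\<close>: for \<open>x \<le> y\<close> the chord \<open>exp(-x) - exp(-y)\<close> lies between \<open>(y - x) exp(-y)\<close> and \<open>(y - x) exp(-x)\<close>,
applied with \<open>x = 2\<delta>t\<close> and \<open>y = 2c\<delta>t\<close> under the integral.\<close>

lemma zeta_laplace_diff_bounds:
  assumes \<delta>: "\<delta> > 0" and c: "c > 1"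
  shows "zeta_laplace \<delta> - zeta_laplace (c * \<delta>) \<le> 2 * (c - 1) * \<delta> * zeta_laplace1 \<delta>"
    and "2 * (c - 1) * \<delta> * zeta_laplace1 (c * \<delta>) \<le> zeta_laplace \<delta> - zeta_laplace (c * \<delta>)"
proof -
  have c\<delta>: "c * \<delta> > 0" using \<delta> c by simp
  note i = zeta_laplace_integrable[OF \<delta>] and j = zeta_laplace_integrable[OF c\<delta>]
  have D: "zeta_laplace \<delta> - zeta_laplace (c * \<delta>) = (LBINT t:{0..}. zeta_sq t * exp (- 2 * \<delta> * t) - zeta_sq t * exp (- 2 * (c * \<delta>) * t))"
    unfolding zeta_laplace_def by (rule set_integral_diff(2)[OF i j, symmetric])
  have exp_diff_le: "exp (- x) - exp (- y) \<le> (y - x) * exp (- x)" "(y - x) * exp (- y) \<le> exp (- x) - exp (- y)" for x y :: real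
  proof -
    have "(1 + (x - y)) * exp (- x) \<le> exp (x - y) * exp (- x)" by (intro mult_right_mono) (auto simp: exp_ge_add_one_self)
    then show "exp (- x) - exp (- y) \<le> (y - x) * exp (- x)" by (simp add: mult_exp_exp algebra_simps)
    have "(1 + (y - x)) * exp (- y) \<le> exp (y - x) * exp (- y)" by (intro mult_right_mono) (auto simp: exp_ge_add_one_self)
    then show "(y - x) * exp (- y) \<le> exp (- x) - exp (- y)" by (simp add: mult_exp_exp algebra_simps)
  qed
  show "zeta_laplace \<delta> - zeta_laplace (c * \<delta>) \<le> 2 * (c - 1) * \<delta> * zeta_laplace1 \<delta>"
    unfolding D zeta_laplace1_def set_integral_mult_right[symmetric]
  proof (rule set_integral_mono[OF set_integral_diff(1)[OF i j] set_integrable_mult_right[OF zeta_laplace1_integrable[OF \<delta>]]])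
    fix t :: real
    have "zeta_sq t * (exp (- (2 * \<delta> * t)) - exp (- (2 * (c * \<delta>) * t))) \<le> zeta_sq t * ((2 * (c * \<delta>) * t - 2 * \<delta> * t) * exp (- (2 * \<delta> * t)))"
      by (intro mult_left_mono exp_diff_le) auto
    then show "zeta_sq t * exp (- 2 * \<delta> * t) - zeta_sq t * exp (- 2 * (c * \<delta>) * t) \<le> 2 * (c - 1) * \<delta> * (zeta_sq t * t * exp (- 2 * \<delta> * t))"
      by (simp add: algebra_simps)
  qed
  show "2 * (c - 1) * \<delta> * zeta_laplace1 (c * \<delta>) \<le> zeta_laplace \<delta> - zeta_laplace (c * \<delta>)"
    unfolding D zeta_laplace1_def set_integral_mult_right[symmetric]
  proof (rule set_integral_mono[OF set_integrable_mult_right[OF zeta_laplace1_integrable[OF c\<delta>]] set_integral_diff(1)[OF i j]])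
    fix t :: real
    have "zeta_sq t * ((2 * (c * \<delta>) * t - 2 * \<delta> * t) * exp (- (2 * (c * \<delta>) * t))) \<le> zeta_sq t * (exp (- (2 * \<delta> * t)) - exp (- (2 * (c * \<delta>) * t)))"
      by (intro mult_left_mono exp_diff_le) auto
    then show "2 * (c - 1) * \<delta> * (zeta_sq t * t * exp (- 2 * (c * \<delta>) * t)) \<le> zeta_sq t * exp (- 2 * \<delta> * t) - zeta_sq t * exp (- 2 * (c * \<delta>) * t)"
      by (simp add: algebra_simps)
  qed
qed

text \<open>A monotone density argument: by \<open>zeta_laplace_diff_bounds\<close> the quotients of \<open>zeta_laplace\<close> between \<open>\<delta>\<close> and \<open>c\<delta>\<close> and
between \<open>\<delta>/c\<close> and \<open>\<delta>\<close> enclose the integral, with limits \<open>1/c\<close> and \<open>c\<close>; then \<open>c\<close> is taken close to \<open>1\<close>.\<close>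

lemma zeta_laplace1_asymp:
  "((\<lambda>\<delta>. zeta_laplace1 \<delta> * (4 * \<delta>\<^sup>2) / ln (1 / \<delta>)) \<longlongrightarrow> 1) (at_right 0)"
proof (rule order_tendstoI)
  have ev: "eventually (\<lambda>\<delta>::real. 0 < \<delta> \<and> \<delta> < 1) (at_right 0)"
    by (auto simp: eventually_at_right_field intro: exI[of _ 1])
  define q where "q c \<delta> = zeta_laplace (c * \<delta>) * (2 * \<delta>) / ln (1 / \<delta>)" for c \<delta>
  have lim: "((\<lambda>\<delta>. q c \<delta>) \<longlongrightarrow> 1 / c) (at_right 0)" if "c > 0" for c
    unfolding q_def by (rule zeta_laplace_scaled_asymp[OF that])
  have lim1: "((\<lambda>\<delta>. q 1 \<delta>) \<longlongrightarrow> 1) (at_right 0)" using lim[of 1] by simp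
  {
    fix a :: real assume a: "a < 1"
    \<comment> \<open>any \<open>c > 1\<close> with \<open>1/c > a\<close> would do; the maximum covers negative \<open>a\<close>\<close>
    define c where "c = 2 / (1 + max a 0)"
    have c: "c > 1" "1 / c > a" using a by (auto simp: c_def max_def field_simps)
    have "((\<lambda>\<delta>. (q 1 \<delta> - q c \<delta>) / (c - 1)) \<longlongrightarrow> (1 - 1 / c) / (c - 1)) (at_right 0)"
      using c by (intro tendsto_intros lim1 lim) auto
    also have "(1 - 1 / c) / (c - 1) = 1 / c" using c by (simp add: field_simps)
    finally have "eventually (\<lambda>\<delta>. a < (q 1 \<delta> - q c \<delta>) / (c - 1)) (at_right 0)"
      using c by (simp add: order_tendstoD)
    then show "eventually (\<lambda>\<delta>. a < zeta_laplace1 \<delta> * (4 * \<delta>\<^sup>2) / ln (1 / \<delta>)) (at_right 0)"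
      using ev
    proof eventually_elim
      case (elim \<delta>)
      define l where "l = ln (1 / \<delta>)"
      have l: "l > 0" using elim by (simp add: l_def ln_div)
      have "(zeta_laplace \<delta> * (2 * \<delta>) / l - zeta_laplace (c * \<delta>) * (2 * \<delta>) / l) / (c - 1) = (zeta_laplace \<delta> - zeta_laplace (c * \<delta>)) * (2 * \<delta> / l / (c - 1))"
        by (simp add: diff_divide_distrib left_diff_distrib)
      also have "\<dots> \<le> 2 * (c - 1) * \<delta> * zeta_laplace1 \<delta> * (2 * \<delta> / l / (c - 1))"
        using elim c l by (intro mult_right_mono zeta_laplace_diff_bounds) auto
      also have "\<dots> = zeta_laplace1 \<delta> * (4 * \<delta>\<^sup>2) / l"
      proof -
        obtain k where k: "c - 1 = k" "k \<noteq> 0" using c by auto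
        show ?thesis unfolding k(1) using k(2) by (simp add: power2_eq_square)
      qed
      finally show ?case using elim unfolding l_def q_def by simp
    qed
  }
  {
    fix a :: real assume a: "a > 1"
    define c where "c = (1 + a) / 2"
    have c: "c > 1" "c < a" using a by (auto simp: c_def)
    have "((\<lambda>\<delta>. (q (1 / c) \<delta> - q 1 \<delta>) * (c / (c - 1))) \<longlongrightarrow> (1 / (1 / c) - 1) * (c / (c - 1))) (at_right 0)"
      using c by (intro tendsto_intros lim1 lim) auto
    also have "(1 / (1 / c) - 1) * (c / (c - 1)) = c" using c by (simp add: field_simps)
    finally have "eventually (\<lambda>\<delta>. (q (1 / c) \<delta> - q 1 \<delta>) * (c / (c - 1)) < a) (at_right 0)"
      using c by (simp add: order_tendstoD)
    then show "eventually (\<lambda>\<delta>. zeta_laplace1 \<delta> * (4 * \<delta>\<^sup>2) / ln (1 / \<delta>) < a) (at_right 0)"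
      using ev
    proof eventually_elim
      case (elim \<delta>)
      define l where "l = ln (1 / \<delta>)"
      have l: "l > 0" using elim by (simp add: l_def ln_div)
      have b: "2 * (c - 1) * (\<delta> / c) * zeta_laplace1 \<delta> \<le> zeta_laplace ((1 / c) * \<delta>) - zeta_laplace \<delta>"
        using zeta_laplace_diff_bounds(2)[of "\<delta> / c" c] elim c by simp
      have "zeta_laplace1 \<delta> * (4 * \<delta>\<^sup>2) / l = 2 * (c - 1) * (\<delta> / c) * zeta_laplace1 \<delta> * (2 * \<delta> / l * (c / (c - 1)))"
      proof -
        obtain k where k: "c - 1 = k" "k \<noteq> 0" using c by auto
        show ?thesis unfolding k(1) using k(2) c by (simp add: power2_eq_square)
      qed
      also have "\<dots> \<le> (zeta_laplace ((1 / c) * \<delta>) - zeta_laplace \<delta>) * (2 * \<delta> / l * (c / (c - 1)))"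
        using elim c l b by (intro mult_right_mono) auto
      also have "\<dots> = (zeta_laplace ((1 / c) * \<delta>) * (2 * \<delta>) / l - zeta_laplace \<delta> * (2 * \<delta>) / l) * (c / (c - 1))"
        by (simp add: diff_divide_distrib left_diff_distrib)
      finally show ?case using elim unfolding l_def q_def by simp
    qed
  }
qed

definition zeta_trunc1 :: "real \<Rightarrow> real \<Rightarrow> real" where
  "zeta_trunc1 m x = (LBINT t:{0..m}. zeta_sq t * t * exp (- 2 * t / x))"

text \<open>Beyond \<open>m = a x ln x\<close> one half of the exponent already gives \<open>exp(-t/x) \<le> x\<^bsup>-a\<^esup>\<close>, while the other half keeps the
integral convergent, of the order of the transform at \<open>1/(2x)\<close>.\<close>

lemma zeta_trunc1_asymp:
  assumes a: "a > 0"
  shows "((\<lambda>x. zeta_trunc1 (a * x * ln x) x * 4 / (x\<^sup>2 * ln x)) \<longlongrightarrow> 1) at_top"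
proof -
  have f1: "filterlim (\<lambda>x::real. 1 / x) (at_right 0) at_top" by real_asymp
  have f2: "filterlim (\<lambda>x::real. 1 / (2 * x)) (at_right 0) at_top" by real_asymp
  have e1: "((\<lambda>x. zeta_laplace1 (1 / x) * (4 * (1 / x)\<^sup>2) / ln (1 / (1 / x))) \<longlongrightarrow> 1) at_top"
    by (rule filterlim_compose[OF zeta_laplace1_asymp f1])
  have e2: "((\<lambda>x. zeta_laplace1 (1 / (2 * x)) * (4 * (1 / (2 * x))\<^sup>2) / ln (1 / (1 / (2 * x)))) \<longlongrightarrow> 1) at_top"
    by (rule filterlim_compose[OF zeta_laplace1_asymp f2])
  have e3: "((\<lambda>x. 4 * x powr (- a) * (ln (2 * x) / ln x)) \<longlongrightarrow> 0) at_top" using a by real_asymp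
  have ev: "eventually (\<lambda>x::real. x > 1) at_top" by (rule eventually_gt_at_top)
  have up: "zeta_trunc1 (a * x * ln x) x \<le> zeta_laplace1 (1 / x)"
    and lo: "zeta_laplace1 (1 / x) \<le> zeta_trunc1 (a * x * ln x) x + x powr (- a) * zeta_laplace1 (1 / (2 * x))" if x: "x > 1" for x
  proof -
    define m where "m = a * x * ln x"
    have m: "m \<ge> 0" using a x by (simp add: m_def)
    have x0: "1 / x > 0" "1 / (2 * x) > 0" using x by auto
    note i = zeta_laplace1_integrable[OF x0(1)] and j = zeta_laplace1_integrable[OF x0(2)]
    have i1: "set_integrable lborel {0..m} (\<lambda>t. zeta_sq t * t * exp (- 2 * (1 / x) * t))" by (rule set_integrable_subset[OF i]) auto
    have i2: "set_integrable lborel {m<..} (\<lambda>t. zeta_sq t * t * exp (- 2 * (1 / x) * t))" by (rule set_integrable_subset[OF i]) (use m in auto)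
    have j2: "set_integrable lborel {m<..} (\<lambda>t. zeta_sq t * t * exp (- 2 * (1 / (2 * x)) * t))" by (rule set_integrable_subset[OF j]) (use m in auto)
    have U: "{0..} = {0..m} \<union> {m<..}" using m by auto
    have split: "zeta_laplace1 (1 / x) = zeta_trunc1 m x + (LBINT t:{m<..}. zeta_sq t * t * exp (- 2 * (1 / x) * t))"
      unfolding zeta_laplace1_def U by (subst set_integral_Un[OF _ i1 i2]) (auto simp: zeta_trunc1_def)
    have "0 \<le> (LBINT t:{m<..}. zeta_sq t * t * exp (- 2 * (1 / x) * t))"
      unfolding set_lebesgue_integral_def using m by (intro integral_nonneg_AE) (auto simp: indicator_def)
    then show "zeta_trunc1 (a * x * ln x) x \<le> zeta_laplace1 (1 / x)" using split by (simp add: m_def)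
    have "(LBINT t:{m<..}. zeta_sq t * t * exp (- 2 * (1 / x) * t)) \<le> (LBINT t:{m<..}. x powr (- a) * (zeta_sq t * t * exp (- 2 * (1 / (2 * x)) * t)))"
    proof (rule set_integral_mono[OF i2 set_integrable_mult_right[OF j2]])
      fix t assume t: "t \<in> {m<..}"
      have "a * ln x \<le> t / x" using t x by (simp add: m_def field_simps)
      then have "exp (- (t / x)) \<le> x powr (- a)" using x by (simp add: powr_def)
      then have "exp (- (t / x)) * exp (- (t / x)) \<le> x powr (- a) * exp (- (t / x))" by (intro mult_right_mono) auto
      then have "exp (- 2 * (1 / x) * t) \<le> x powr (- a) * exp (- 2 * (1 / (2 * x)) * t)" by (simp add: mult_exp_exp)
      then have "(zeta_sq t * t) * exp (- 2 * (1 / x) * t) \<le> (zeta_sq t * t) * (x powr (- a) * exp (- 2 * (1 / (2 * x)) * t))"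
        using t m by (intro mult_left_mono) auto
      then show "zeta_sq t * t * exp (- 2 * (1 / x) * t) \<le> x powr (- a) * (zeta_sq t * t * exp (- 2 * (1 / (2 * x)) * t))" by (simp only: mult_ac)
    qed
    also have "\<dots> \<le> x powr (- a) * zeta_laplace1 (1 / (2 * x))"
      unfolding set_integral_mult_right zeta_laplace1_def
    proof (intro mult_left_mono)
      show "(LBINT t:{m<..}. zeta_sq t * t * exp (- 2 * (1 / (2 * x)) * t)) \<le> (LBINT t:{0..}. zeta_sq t * t * exp (- 2 * (1 / (2 * x)) * t))"
        unfolding set_lebesgue_integral_def using j j2 m unfolding set_integrable_def
        by (intro integral_mono) (auto simp: indicator_def)
    qed simp
    finally show "zeta_laplace1 (1 / x) \<le> zeta_trunc1 (a * x * ln x) x + x powr (- a) * zeta_laplace1 (1 / (2 * x))"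
      using split by (simp add: m_def)
  qed
  show ?thesis
  proof (rule tendsto_sandwich)
    show "eventually (\<lambda>x. zeta_trunc1 (a * x * ln x) x * 4 / (x\<^sup>2 * ln x) \<le> zeta_laplace1 (1 / x) * (4 * (1 / x)\<^sup>2) / ln (1 / (1 / x))) at_top"
      using ev
    proof eventually_elim
      case (elim x)
      have "zeta_laplace1 (1 / x) * (4 * (1 / x)\<^sup>2) / ln (1 / (1 / x)) = zeta_laplace1 (1 / x) * 4 / (x\<^sup>2 * ln x)"
        by (simp add: power_divide)
      moreover have "zeta_trunc1 (a * x * ln x) x * 4 / (x\<^sup>2 * ln x) \<le> zeta_laplace1 (1 / x) * 4 / (x\<^sup>2 * ln x)"
        using up[OF elim] elim by (intro divide_right_mono mult_right_mono) auto
      ultimately show ?case by simp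
    qed
    show "eventually (\<lambda>x. zeta_laplace1 (1 / x) * (4 * (1 / x)\<^sup>2) / ln (1 / (1 / x)) -
        zeta_laplace1 (1 / (2 * x)) * (4 * (1 / (2 * x))\<^sup>2) / ln (1 / (1 / (2 * x))) * (4 * x powr (- a) * (ln (2 * x) / ln x))
        \<le> zeta_trunc1 (a * x * ln x) x * 4 / (x\<^sup>2 * ln x)) at_top"
      using ev
    proof eventually_elim
      case (elim x)
      have l: "ln (2 * x) \<noteq> 0" "ln x > 0" using elim by auto
      have 1: "zeta_laplace1 (1 / x) * (4 * (1 / x)\<^sup>2) / ln (1 / (1 / x)) = zeta_laplace1 (1 / x) * (4 / (x\<^sup>2 * ln x))"
        by (simp add: power_divide)
      have 2: "zeta_laplace1 (1 / (2 * x)) * (4 * (1 / (2 * x))\<^sup>2) / ln (1 / (1 / (2 * x))) * (4 * x powr (- a) * (ln (2 * x) / ln x))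
         = x powr (- a) * zeta_laplace1 (1 / (2 * x)) * (4 / (x\<^sup>2 * ln x))"
        using l by (simp add: power_divide power_mult_distrib)
      have "(zeta_laplace1 (1 / x) - x powr (- a) * zeta_laplace1 (1 / (2 * x))) * (4 / (x\<^sup>2 * ln x)) \<le> zeta_trunc1 (a * x * ln x) x * (4 / (x\<^sup>2 * ln x))"
        using lo[OF elim] l by (intro mult_right_mono) auto
      then show ?case unfolding 1 2 by (simp add: left_diff_distrib diff_divide_distrib)
    qed
    show "((\<lambda>x. zeta_laplace1 (1 / x) * (4 * (1 / x)\<^sup>2) / ln (1 / (1 / x)) -
        zeta_laplace1 (1 / (2 * x)) * (4 * (1 / (2 * x))\<^sup>2) / ln (1 / (1 / (2 * x))) * (4 * x powr (- a) * (ln (2 * x) / ln x))) \<longlongrightarrow> 1) at_top"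
      using tendsto_diff[OF e1 tendsto_mult[OF e2 e3]] by simp
  qed (rule e1)
qed

section \<open>The integral defining the ladder\<close>

definition ladder_int :: "real \<Rightarrow> real \<Rightarrow> real" where
  "ladder_int a x = integral {0..ladder_mu a x} (\<lambda>t. zeta_sq t * exp (- 2 * t / x))"

text \<open>The derivative of \<open>ladder_int a\<close>: \<open>a ln x + a\<close> is the derivative of the upper limit \<open>a x ln x\<close>.\<close>

definition ladder_dens :: "real \<Rightarrow> real \<Rightarrow> real" where
  "ladder_dens a x = zeta_sq (ladder_mu a x) * exp (- 2 * ladder_mu a x / x) * (a * ln x + a)
     + 2 / x\<^sup>2 * zeta_trunc1 (ladder_mu a x) x"

lemma ladder_mu_pos: "a > 0 \<Longrightarrow> x > 1 \<Longrightarrow> ladder_mu a x > 0"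
  by (simp add: ladder_mu_def)

lemma ladder_mu_deriv:
  assumes "x > 0" shows "(ladder_mu a has_real_derivative (a * ln x + a)) (at x)"
  unfolding ladder_mu_def using assms by (auto intro!: derivative_eq_intros)

lemma zeta_trunc1_integral: "zeta_trunc1 m x = integral {0..m} (\<lambda>t. zeta_sq t * t * exp (- 2 * t / x))"
  unfolding zeta_trunc1_def
  by (rule set_borel_integral_eq_integral(2), rule borel_integrable_atLeastAtMost')
     (auto intro!: continuous_intros continuous_zeta_sq simp: divide_inverse)

text \<open>Rescaling to the fixed interval \<open>[0, 1]\<close> moves the variable end point into the integrand.\<close>

lemma continuous_zeta_trunc1:
  assumes m: "continuous_on S m" and S: "\<And>x. x \<in> S \<Longrightarrow> m x > 0" "\<And>x. x \<in> S \<Longrightarrow> x \<noteq> 0"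
  shows "continuous_on S (\<lambda>x. zeta_trunc1 (m x) x)"
proof -
  define g where "g t x = zeta_sq t * t * exp (- 2 * t / x)" for t x
  have eq: "zeta_trunc1 (m x) x = m x * integral (cbox 0 1) (\<lambda>v. g (m x * v) x)" if x: "x \<in> S" for x
  proof -
    have "zeta_trunc1 (m x) x = m x * (LBINT v. indicator {0..m x} (m x * v) *\<^sub>R g (m x * v) x)"
      unfolding zeta_trunc1_def set_lebesgue_integral_def g_def
      using lborel_integral_real_affine[of "m x" "\<lambda>t. indicator {0..m x} t *\<^sub>R (zeta_sq t * t * exp (- 2 * t / x))" 0] S(1)[OF x]
      by simp
    also have "(LBINT v. indicator {0..m x} (m x * v) *\<^sub>R g (m x * v) x) = (LBINT v:{0..1}. g (m x * v) x)"
      unfolding set_lebesgue_integral_def using S(1)[OF x]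
      by (intro Bochner_Integration.integral_cong) (auto simp: indicator_def mult_le_cancel_left2 zero_le_mult_iff)
    also have "\<dots> = integral {0..1} (\<lambda>v. g (m x * v) x)"
      unfolding g_def using S(2)[OF x]
      by (intro set_borel_integral_eq_integral(2) borel_integrable_atLeastAtMost')
         (auto intro!: continuous_intros continuous_on_compose2[OF continuous_zeta_sq[of UNIV]])
    finally show ?thesis by simp
  qed
  have "continuous_on S (\<lambda>x. m x * integral (cbox 0 1) (\<lambda>v. g (m x * v) x))"
  proof (intro continuous_on_mult m integral_continuous_on_param)
    have mm: "continuous_on (S \<times> cbox 0 1) (\<lambda>z. m (fst z))"
      by (rule continuous_on_compose2[OF m]) (auto intro!: continuous_intros)
    show "continuous_on (S \<times> cbox 0 1) (\<lambda>(x, v). g (m x * v) x)"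
      unfolding g_def case_prod_unfold using S(2)
      by (intro continuous_on_mult continuous_on_compose2[OF continuous_zeta_sq[of UNIV]] continuous_intros mm) auto
  qed
  then show ?thesis by (rule continuous_on_eq) (simp add: eq)
qed

lemma continuous_ladder_dens:
  assumes a: "a > 0"
  shows "continuous_on {1<..} (ladder_dens a)"
proof -
  have mu: "continuous_on {1<..} (ladder_mu a)"
    unfolding ladder_mu_def by (intro continuous_intros) auto
  have "continuous_on {1<..} (\<lambda>x. zeta_trunc1 (ladder_mu a x) x)"
    by (rule continuous_zeta_trunc1[OF mu]) (use a ladder_mu_pos in auto)
  then show ?thesis unfolding ladder_dens_def
    by (intro continuous_intros mu continuous_on_compose2[OF continuous_zeta_sq[of UNIV] mu]) auto
qed

text \<open>The integral is a function of the parameter \<open>x\<close> and of the upper limit \<open>m\<close>, differentiable as a function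
of two variables; the chain rule along \<open>m = ladder_mu a x\<close> gives the two terms.\<close>

lemma ladder_int_deriv:
  assumes a: "a > 0" and x: "x > 1"
  shows "(ladder_int a has_real_derivative ladder_dens a x) (at x)"
proof -
  define h where "h y t = zeta_sq t * exp (- 2 * t / y)" for y t
  define K where "K y m = integral {0..m} (h y)" for y m
  have conth: "continuous_on A (h y)" if "y \<noteq> 0" for y A
    unfolding h_def using that by (intro continuous_intros continuous_zeta_sq) auto
  have contg: "continuous_on A (\<lambda>z. h (fst z) (snd z))" if "A \<subseteq> {0<..} \<times> UNIV" for A
    unfolding h_def using that
    by (intro continuous_intros continuous_on_compose2[OF continuous_zeta_sq[of UNIV]]) auto
  define m where "m = ladder_mu a x"
  have m: "m > 0" using ladder_mu_pos[OF a x] by (simp add: m_def)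
  have d1: "((\<lambda>y. K y m) has_derivative (\<lambda>t. (2 / x\<^sup>2 * zeta_trunc1 m x) * t)) (at x within {0<..})"
  proof -
    have "((\<lambda>y. integral (cbox 0 m) (h y)) has_field_derivative integral (cbox 0 m) ((\<lambda>y t. 2 / y\<^sup>2 * (zeta_sq t * t * exp (- 2 * t / y))) x)) (at x within {0<..})"
    proof (rule leibniz_rule_field_derivative)
      show "((\<lambda>y. h y t) has_field_derivative 2 / y\<^sup>2 * (zeta_sq t * t * exp (- 2 * t / y))) (at y within {0<..})" if "y \<in> {0<..}" for y t
        unfolding h_def using that by (auto intro!: derivative_eq_intros simp: power2_eq_square)
      show "h y integrable_on cbox 0 m" if "y \<in> {0<..}" for y
        using that by (intro integrable_continuous conth) auto
      show "continuous_on ({0<..} \<times> cbox 0 m) (\<lambda>(y, t). 2 / y\<^sup>2 * (zeta_sq t * t * exp (- 2 * t / y)))"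
        unfolding case_prod_unfold by (intro continuous_intros continuous_on_compose2[OF continuous_zeta_sq[of UNIV]]) auto
    qed (use x in auto)
    then show ?thesis unfolding K_def zeta_trunc1_integral has_field_derivative_def
      by (simp only: box_real integral_mult_right)
  qed
  have d2: "((\<lambda>m. K y m) has_derivative blinfun_apply (blinfun_scaleR_left (h y m))) (at m within {0<..})"
    if y: "y \<in> {0<..}" and m: "m \<in> {0<..}" for y m
  proof -
    have "((\<lambda>m. integral {0..m} (h y)) has_vector_derivative h y m) (at m within {0..m + 1})"
      using y m by (intro integral_has_vector_derivative conth) auto
    then have "((\<lambda>m. integral {0..m} (h y)) has_vector_derivative h y m) (at m)"
      using at_within_interior[of m "{0..m + 1}"] m by simp
    then have "((\<lambda>m. K y m) has_vector_derivative h y m) (at m within {0<..})"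
      unfolding K_def by (rule has_vector_derivative_at_within)
    then show ?thesis by (simp add: has_vector_derivative_def)
  qed
  have "((\<lambda>(y, m). K y m) has_derivative (\<lambda>(ty, tm). (2 / x\<^sup>2 * zeta_trunc1 m x) * ty + blinfun_apply (blinfun_scaleR_left (h x m)) tm)) (at (x, m) within {0<..} \<times> {0<..})"
  proof (rule has_derivative_partialsI[OF d1 d2])
    have "continuous_on ({0<..} \<times> {0<..}) (\<lambda>z. blinfun_scaleR_left (h (fst z) (snd z)))"
      by (intro bounded_linear.continuous_on[OF bounded_linear_blinfun_scaleR_left] contg) auto
    then show "continuous (at (x, m) within {0<..} \<times> {0<..}) (\<lambda>(y, m). blinfun_scaleR_left (h y m))"
      using x m by (simp add: continuous_on_eq_continuous_within case_prod_unfold)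
  qed (use m in auto)
  moreover have "at (x, m) within {0<..} \<times> {0<..} = at (x, m)"
    using x m by (intro at_within_open) (auto intro!: open_Times)
  ultimately have D: "((\<lambda>(y, m). K y m) has_derivative (\<lambda>(ty, tm). (2 / x\<^sup>2 * zeta_trunc1 m x) * ty + tm * h x m)) (at (x, m))"
    by simp
  have "(ladder_mu a has_derivative (\<lambda>t. (a * ln x + a) * t)) (at x)"
    using ladder_mu_deriv[of x a] x by (simp add: has_field_derivative_def)
  then have P: "((\<lambda>y. (y, ladder_mu a y)) has_derivative (\<lambda>t. (t, (a * ln x + a) * t))) (at x)"
    by (intro has_derivative_Pair has_derivative_ident)
  have "((\<lambda>y. case (y, ladder_mu a y) of (y, m) \<Rightarrow> K y m) has_derivative
      (\<lambda>t. case (t, (a * ln x + a) * t) of (ty, tm) \<Rightarrow> (2 / x\<^sup>2 * zeta_trunc1 m x) * ty + tm * h x m)) (at x)"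
    by (rule has_derivative_compose[OF P]) (use D in \<open>simp add: m_def\<close>)
  moreover have "(\<lambda>y. case (y, ladder_mu a y) of (y, m) \<Rightarrow> K y m) = ladder_int a"
    by (simp add: fun_eq_iff ladder_int_def K_def h_def[abs_def])
  moreover have "(\<lambda>t. case (t, (a * ln x + a) * t) of (ty, tm) \<Rightarrow> (2 / x\<^sup>2 * zeta_trunc1 m x) * ty + tm * h x m) = (*) (ladder_dens a x)"
    by (simp add: fun_eq_iff ladder_dens_def m_def h_def algebra_simps)
  ultimately show ?thesis unfolding has_field_derivative_def by simp
qed

text \<open>The boundary term is at most \<open>(8 x ln x)\<^sup>2 x\<^sup>-\<^sup>1\<^sup>4\<close> up to constants and logarithms, since \<open>7 \<le> a \<le> 8\<close>; the
main term is \<open>zeta_trunc1_asymp\<close>.\<close>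

lemma ladder_dens_asymp:
  assumes a: "7 \<le> a" "a \<le> 8"
  shows "((\<lambda>x. ladder_dens a x / ln x) \<longlongrightarrow> 1 / 2) at_top"
proof -
  obtain C where C: "C > 0" "\<And>t. t \<ge> 1 \<Longrightarrow> zeta_sq t \<le> C * t\<^sup>2" by (rule zeta_sq_poly_bound) blast
  have main: "((\<lambda>x. zeta_trunc1 (a * x * ln x) x * 4 / (x\<^sup>2 * ln x)) \<longlongrightarrow> 1) at_top"
    by (rule zeta_trunc1_asymp) (use a in simp)
  have bdry: "((\<lambda>x. zeta_sq (ladder_mu a x) * exp (- 2 * ladder_mu a x / x) * (a * ln x + a) / ln x) \<longlongrightarrow> 0) at_top"
  proof (rule Lim_null_comparison)
    show "\<forall>\<^sub>F x in at_top. norm (zeta_sq (ladder_mu a x) * exp (- 2 * ladder_mu a x / x) * (a * ln x + a) / ln x)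
        \<le> C * (8 * x * ln x)\<^sup>2 * x powr (- 14) * (8 * ln x + 8) / ln x"
      using eventually_ge_at_top[of "exp 1"]
    proof eventually_elim
      case (elim x)
      have x: "x \<ge> 1" using elim exp_ge_add_one_self[of 1] by linarith
      have l: "ln x \<ge> 1" using elim x by (simp add: ln_ge_iff)
      have "1 \<le> x * ln x" using mult_mono[OF x l] x by simp
      then have "1 * 1 \<le> a * (x * ln x)" using a by (intro mult_mono) auto
      then have mu: "1 \<le> ladder_mu a x" "ladder_mu a x \<le> 8 * x * ln x"
        using a x l by (auto simp: ladder_mu_def mult.assoc intro!: mult_right_mono)
      have "zeta_sq (ladder_mu a x) \<le> C * (ladder_mu a x)\<^sup>2" by (rule C(2)[OF mu(1)])
      also have "\<dots> \<le> C * (8 * x * ln x)\<^sup>2" using C(1) mu by (intro mult_left_mono power_mono) auto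
      finally have z: "zeta_sq (ladder_mu a x) \<le> C * (8 * x * ln x)\<^sup>2" .
      have e: "exp (- 2 * ladder_mu a x / x) \<le> x powr (- 14)"
      proof -
        have "14 * ln x \<le> 2 * a * ln x" using a l by (intro mult_right_mono) auto
        then show ?thesis using x by (simp add: ladder_mu_def powr_def)
      qed
      have p: "a * ln x + a \<le> 8 * ln x + 8" using a l by (intro add_mono mult_right_mono) auto
      have "zeta_sq (ladder_mu a x) * exp (- 2 * ladder_mu a x / x) * (a * ln x + a) / ln x \<le> C * (8 * x * ln x)\<^sup>2 * x powr (- 14) * (8 * ln x + 8) / ln x"
        using l a C(1) by (intro divide_right_mono mult_mono z e p) auto
      moreover have "0 \<le> zeta_sq (ladder_mu a x) * exp (- 2 * ladder_mu a x / x) * (a * ln x + a) / ln x"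
        using l a by (intro divide_nonneg_nonneg mult_nonneg_nonneg) auto
      ultimately show ?case by simp
    qed
    show "((\<lambda>x. C * (8 * x * ln x)\<^sup>2 * x powr (- 14) * (8 * ln x + 8) / ln x) \<longlongrightarrow> 0) at_top"
      by real_asymp
  qed
  have "((\<lambda>x. zeta_sq (ladder_mu a x) * exp (- 2 * ladder_mu a x / x) * (a * ln x + a) / ln x
      + zeta_trunc1 (a * x * ln x) x * 4 / (x\<^sup>2 * ln x) / 2) \<longlongrightarrow> 0 + 1 / 2) at_top"
    by (intro tendsto_add bdry tendsto_divide main tendsto_const) auto
  moreover have "2 / x\<^sup>2 * Z / l = Z * 4 / (x\<^sup>2 * l) / 2" for x Z l :: real by simp
  ultimately show ?thesis by (simp only: ladder_dens_def ladder_mu_def add_divide_distrib add_0)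
qed

lemma jacobs_ladder_eq:
  assumes "jacobs_ladder a T0 \<phi>" and T: "T \<ge> T0" and mu: "ladder_mu a (\<phi> T) \<ge> 0"
  shows "ladder_int a (\<phi> T) = integral {0..T} zeta_sq"
proof -
  have "T0 > 0" and pos: "\<phi> T > 0" and
    eq: "(LBINT t=0..ladder_mu a (\<phi> T). (norm (hardy_Z t))\<^sup>2 * exp (- (2 / \<phi> T) * t)) = (LBINT t=0..T. (norm (hardy_Z t))\<^sup>2)"
    using assms by (auto simp: jacobs_ladder_def)
  have z: "(norm (hardy_Z t))\<^sup>2 = zeta_sq t" for t by (simp add: norm_hardy_Z_squared zeta_sq_def)
  have "(LBINT t=0..ladder_mu a (\<phi> T). zeta_sq t * exp (- (2 / \<phi> T) * t)) = integral {0..ladder_mu a (\<phi> T)} (\<lambda>t. zeta_sq t * exp (- (2 / \<phi> T) * t))"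
    unfolding zero_ereal_def using mu
    by (intro interval_integral_eq_integral borel_integrable_atLeastAtMost') (use pos in \<open>auto intro!: continuous_intros continuous_zeta_sq\<close>)
  moreover have "(LBINT t=0..T. zeta_sq t) = integral {0..T} zeta_sq"
    unfolding zero_ereal_def using T \<open>T0 > 0\<close>
    by (intro interval_integral_eq_integral borel_integrable_atLeastAtMost') (auto intro!: continuous_zeta_sq)
  ultimately show ?thesis using eq unfolding z ladder_int_def by simp
qed

section \<open>The Chebyshev weight\<close>

lemma chebyshev_T_cos: "poly (chebyshev_T n) (cos x) = cos (real n * x)"
proof (induction n rule: chebyshev_T.induct)
  case (3 n)
  have "cos (real (Suc (Suc n)) * x) = cos (real (Suc n) * x + x)" by (simp add: algebra_simps)
  also have "\<dots> = 2 * cos x * cos (real (Suc n) * x) - cos (real (Suc n) * x - x)"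
    by (simp add: cos_add cos_diff)
  also have "cos (real (Suc n) * x - x) = cos (real n * x)" by (simp add: algebra_simps)
  finally show ?case using 3 by simp
qed auto

definition cheb_weight :: "nat \<Rightarrow> real \<Rightarrow> real" where
  "cheb_weight n u = (poly (chebyshev_T n) u)\<^sup>2 / sqrt (1 - u\<^sup>2)"

text \<open>With \<open>u = cos \<theta>\<close> the weight becomes \<open>cos\<^sup>2(n\<theta>) d\<theta>\<close>; this is its primitive, written in \<open>u\<close>. It is continuous up
to the end points, where the weight itself is unbounded.\<close>

definition cheb_prim :: "nat \<Rightarrow> real \<Rightarrow> real" where
  "cheb_prim n u = - (arccos u / 2) - sin (2 * real n * arccos u) / (4 * real n)"

lemma cheb_weight_nonneg: "-1 < u \<Longrightarrow> u < 1 \<Longrightarrow> cheb_weight n u \<ge> 0"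
  unfolding cheb_weight_def by (intro divide_nonneg_nonneg) (auto simp: abs_square_le_1 abs_le_iff)

lemma sqrt_one_minus_sq_pos: "-1 < u \<Longrightarrow> u < 1 \<Longrightarrow> sqrt (1 - u\<^sup>2) > (0::real)"
  by (simp add: abs_square_less_1 abs_less_iff)

lemma cheb_prim_deriv:
  assumes n: "n \<ge> 1" and u: "-1 < u" "u < 1"
  shows "(cheb_prim n has_real_derivative cheb_weight n u) (at u)"
proof -
  have s: "sqrt (1 - u\<^sup>2) > 0" using u by (rule sqrt_one_minus_sq_pos)
  have "(cheb_prim n has_real_derivative
      - (inverse (- sqrt (1 - u\<^sup>2)) / 2) - (cos (2 * real n * arccos u) * (2 * real n * inverse (- sqrt (1 - u\<^sup>2)))) / (4 * real n)) (at u)"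
    unfolding cheb_prim_def using u n by (auto intro!: derivative_eq_intros)
  also have "- (inverse (- sqrt (1 - u\<^sup>2)) / 2) - (cos (2 * real n * arccos u) * (2 * real n * inverse (- sqrt (1 - u\<^sup>2)))) / (4 * real n)
      = (1 + cos (2 * (real n * arccos u))) / 2 / sqrt (1 - u\<^sup>2)"
    using n s by (simp add: field_simps)
  also have "\<dots> = (cos (real n * arccos u))\<^sup>2 / sqrt (1 - u\<^sup>2)"
    by (simp add: cos_double_cos)
  also have "cos (real n * arccos u) = poly (chebyshev_T n) u"
    using chebyshev_T_cos[of n "arccos u"] u by simp
  finally show ?thesis by (simp add: cheb_weight_def)
qed

lemma continuous_cheb_prim: "n \<ge> 1 \<Longrightarrow> continuous_on {-1..1} (cheb_prim n)"
  unfolding cheb_prim_def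
  by (intro continuous_intros continuous_on_arccos') auto

lemma continuous_cheb_weight: "continuous_on {-1<..<1} (cheb_weight n)"
  unfolding cheb_weight_def
  using sqrt_one_minus_sq_pos by (intro continuous_intros) force+

lemma cheb_prim_ends: "n \<ge> 1 \<Longrightarrow> cheb_prim n 1 = 0" "n \<ge> 1 \<Longrightarrow> cheb_prim n (-1) = - pi / 2"
  by (simp_all add: cheb_prim_def)

text \<open>Composing the primitive with \<open>x\<close> gives integrability up to the singular end points and the value
of the integral in one step, because the integrand is nonnegative.\<close>

lemma cheb_substitution:
  fixes x x' :: "real \<Rightarrow> real"
  assumes n: "n \<ge> 1" and AB: "A < B"
    and cont: "continuous_on {A..B} x"
    and deriv: "\<And>t. t \<in> {A<..<B} \<Longrightarrow> (x has_real_derivative x' t) (at t)"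
    and cont': "continuous_on {A<..<B} x'"
    and nonneg: "\<And>t. t \<in> {A<..<B} \<Longrightarrow> x' t \<ge> 0"
    and range: "\<And>t. t \<in> {A<..<B} \<Longrightarrow> T < x t \<and> x t < T + 2"
    and ends: "x A = T" "x B = T + 2"
  shows "set_integrable lborel {A<..<B} (\<lambda>t. cheb_weight n (x t - T - 1) * x' t)"
    and "(LBINT t:{A<..<B}. cheb_weight n (x t - T - 1) * x' t) = pi / 2"
    and "continuous_on {A<..<B} (\<lambda>t. cheb_weight n (x t - T - 1) * x' t)"
proof -
  have ei: "einterval (ereal A) (ereal B) = {A<..<B}" by (auto simp: einterval_def)
  have contx: "continuous_on {A<..<B} x" by (rule continuous_on_subset[OF cont]) auto
  show contf: "continuous_on {A<..<B} (\<lambda>t. cheb_weight n (x t - T - 1) * x' t)"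
    using range by (intro continuous_intros cont' contx continuous_on_compose2[OF continuous_cheb_weight]) force+
  have in_range: "x t - T - 1 \<in> {-1..1}" if "t \<in> {A..B}" for t
  proof -
    have "t = A \<or> t = B \<or> t \<in> {A<..<B}" using that by auto
    then show ?thesis using range[of t] ends by (elim disjE) auto
  qed
  have contp: "continuous_on {A..B} (\<lambda>t. cheb_prim n (x t - T - 1))"
    using in_range by (intro continuous_on_compose2[OF continuous_cheb_prim[OF n]] continuous_intros cont) auto
  have limA: "((\<lambda>t. cheb_prim n (x t - T - 1)) \<longlongrightarrow> cheb_prim n (-1)) (at_right A)"
    using continuous_on_Icc_at_rightD[OF contp AB] ends by simp
  have limB: "((\<lambda>t. cheb_prim n (x t - T - 1)) \<longlongrightarrow> cheb_prim n 1) (at_left B)"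
    using continuous_on_Icc_at_leftD[OF contp AB] ends by simp
  have prim: "((\<lambda>t. cheb_prim n (x t - T - 1)) has_real_derivative cheb_weight n (x t - T - 1) * x' t) (at t)"
    if t: "t \<in> {A<..<B}" for t
  proof -
    have "((\<lambda>t. x t - T - 1) has_real_derivative x' t) (at t)"
      using deriv[OF t] by (auto intro!: derivative_eq_intros)
    from DERIV_chain2[OF cheb_prim_deriv[OF n] this] range[OF t] show ?thesis by simp
  qed
  have contf': "isCont (\<lambda>t. cheb_weight n (x t - T - 1) * x' t) t" if "t \<in> {A<..<B}" for t
    using contf that by (simp add: continuous_on_eq_continuous_at)
  have f0: "0 \<le> cheb_weight n (x t - T - 1) * x' t" if "t \<in> {A<..<B}" for t
    using range[OF that] nonneg[OF that] by (intro mult_nonneg_nonneg cheb_weight_nonneg) auto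
  have AB': "ereal A < ereal B" using AB by simp
  have limA': "(((\<lambda>t. cheb_prim n (x t - T - 1)) \<circ> real_of_ereal) \<longlongrightarrow> cheb_prim n (-1)) (at_right (ereal A))"
    unfolding ereal_tendsto_simps by (rule limA)
  have limB': "(((\<lambda>t. cheb_prim n (x t - T - 1)) \<circ> real_of_ereal) \<longlongrightarrow> cheb_prim n 1) (at_left (ereal B))"
    unfolding ereal_tendsto_simps by (rule limB)
  note R = interval_integral_FTC_nonneg[OF AB' prim contf' _ limA' limB']
  show "set_integrable lborel {A<..<B} (\<lambda>t. cheb_weight n (x t - T - 1) * x' t)"
    using R(1) f0 unfolding ei by simp
  show "(LBINT t:{A<..<B}. cheb_weight n (x t - T - 1) * x' t) = pi / 2"
    using R(2) f0 AB cheb_prim_ends[OF n] by (simp add: interval_lebesgue_integral_def ei)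
qed

section \<open>Regularity of the ladder and the asymptotic formula\<close>

text \<open>The ladder is only known to be a monotone solution of \<open>G(\<phi>(s)) = F(s)\<close>; its regularity is inherited from
\<open>F\<close> through the strictly increasing \<open>G\<close>.\<close>

lemma implicit_inverse_isCont:
  fixes G F \<phi> :: "real \<Rightarrow> real"
  assumes mono: "strict_mono_on {X0..} G"
    and F: "isCont F t" and t: "t > T1" and \<phi>: "\<And>s. s \<ge> T1 \<Longrightarrow> \<phi> s > X0" and eq: "\<And>s. s \<ge> T1 \<Longrightarrow> G (\<phi> s) = F s"
  shows "isCont \<phi> t"
proof -
  have lt: "G x < G y \<longleftrightarrow> x < y" if "x \<ge> X0" "y \<ge> X0" for x y
    using strict_mono_on_less[OF mono] that by simp
  have "(\<phi> \<longlongrightarrow> \<phi> t) (at t)"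
  proof (rule order_tendstoI)
    have ev: "eventually (\<lambda>s. s > T1) (at t)" by (rule order_tendstoD(1)[OF tendsto_ident_at t])
    have Ft: "(F \<longlongrightarrow> F t) (at t)" using F by (simp add: isCont_def)
    {
      fix a assume a: "a < \<phi> t"
      define b where "b = max a X0"
      have b: "b \<ge> X0" "b < \<phi> t" "a \<le> b" using a \<phi>[of t] t by (auto simp: b_def)
      have "G b < F t" using lt[of b "\<phi> t"] b eq[of t] t by auto
      from order_tendstoD(1)[OF Ft this] ev show "eventually (\<lambda>s. a < \<phi> s) (at t)"
      proof eventually_elim
        case (elim s)
        then have "G b < G (\<phi> s)" using eq[of s] by simp
        then show ?case using lt[of b "\<phi> s"] b \<phi>[of s] elim by auto
      qed
    }
    {
      fix a assume a: "\<phi> t < a"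
      have aX: "a \<ge> X0" using a \<phi>[of t] t by auto
      have "F t < G a" using lt[of "\<phi> t" a] a aX \<phi>[of t] eq[of t] t by auto
      from order_tendstoD(2)[OF Ft this] ev show "eventually (\<lambda>s. \<phi> s < a) (at t)"
      proof eventually_elim
        case (elim s)
        then have "G (\<phi> s) < G a" using eq[of s] by simp
        then show ?case using lt[of "\<phi> s" a] aX \<phi>[of s] elim by auto
      qed
    }
  qed
  then show ?thesis by (simp add: isCont_def)
qed

lemma implicit_inverse_deriv:
  fixes G F \<phi> :: "real \<Rightarrow> real"
  assumes G: "(G has_real_derivative g) (at (\<phi> t))" and g: "g \<noteq> 0"
    and F: "(F has_real_derivative f) (at t)" and cont: "isCont \<phi> t"
    and t: "t > T1" and eq: "\<And>s. s \<ge> T1 \<Longrightarrow> G (\<phi> s) = F s"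
  shows "(\<phi> has_real_derivative f / g) (at t)"
proof -
  obtain q where q: "\<And>z. G z - G (\<phi> t) = q z * (z - \<phi> t)" "isCont q (\<phi> t)" "q (\<phi> t) = g"
    using G unfolding CARAT_DERIV by blast
  have ql: "((\<lambda>s. q (\<phi> s)) \<longlongrightarrow> g) (at t)"
    using isCont_tendsto_compose[OF q(2)] cont q(3) by (simp add: isCont_def)
  have "((\<lambda>s. ((F s - F t) / (s - t)) / q (\<phi> s)) \<longlongrightarrow> f / g) (at t)"
    using F g by (intro tendsto_divide ql) (simp_all add: has_field_derivative_iff)
  moreover have "eventually (\<lambda>s. ((F s - F t) / (s - t)) / q (\<phi> s) = (\<phi> s - \<phi> t) / (s - t)) (at t)"
  proof -
    have "eventually (\<lambda>s. s > T1) (at t)" by (rule order_tendstoD(1)[OF tendsto_ident_at t])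
    moreover have "eventually (\<lambda>s. q (\<phi> s) \<noteq> 0) (at t)" using tendsto_imp_eventually_ne[OF ql g] .
    ultimately show ?thesis
    proof eventually_elim
      case (elim s)
      have "F s - F t = q (\<phi> s) * (\<phi> s - \<phi> t)" using q(1)[of "\<phi> s"] eq[of s] eq[of t] elim t by simp
      then show ?case using elim by simp
    qed
  qed
  ultimately have "((\<lambda>s. (\<phi> s - \<phi> t) / (s - t)) \<longlongrightarrow> f / g) (at t)"
    by (rule Lim_transform_eventually)
  then show ?thesis by (simp add: has_field_derivative_iff)
qed

text \<open>Since \<open>G' > 0\<close> beyond some \<open>X0\<close>, and \<open>\<phi>\<close> eventually exceeds \<open>X0\<close>, the ladder is eventually the inverse of \<open>G\<close>
applied to the integral of \<open>Z\<^sup>2\<close>.\<close>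

lemma ladder_regular:
  assumes a: "a \<in> {7..8}" and J: "jacobs_ladder a T0 \<phi>"
  obtains T1 where "T1 \<ge> T0" "\<And>t. t \<ge> T1 \<Longrightarrow> \<phi> t > 1" "\<And>t. t \<ge> T1 \<Longrightarrow> ladder_dens a (\<phi> t) > 0"
    "\<And>t. t > T1 \<Longrightarrow> isCont \<phi> t"
    "\<And>t. t > T1 \<Longrightarrow> (\<phi> has_real_derivative zeta_sq t / ladder_dens a (\<phi> t)) (at t)"
proof -
  have a': "7 \<le> a" "a \<le> 8" "a > 0" using a by auto
  have J': "T0 > 0" "filterlim \<phi> at_top at_top" using J by (auto simp: jacobs_ladder_def)
  have "eventually (\<lambda>x. ladder_dens a x / ln x > 0) at_top"
    by (rule order_tendstoD[OF ladder_dens_asymp[OF a'(1,2)]]) simp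
  then have "eventually (\<lambda>x. ladder_dens a x > 0 \<and> x > 1) at_top"
    using eventually_gt_at_top[of 1] by eventually_elim (auto simp: zero_less_divide_iff)
  then obtain X0 where X0: "\<And>x. x \<ge> X0 \<Longrightarrow> ladder_dens a x > 0 \<and> x > 1"
    by (auto simp: eventually_at_top_linorder)
  define G where "G = ladder_int a"
  define F where "F s = integral {0..s} zeta_sq" for s
  have mono: "strict_mono_on {X0..} G"
  proof (rule strict_mono_onI)
    fix x y assume xy: "x \<in> {X0..}" "y \<in> {X0..}" "x < y"
    show "G x < G y"
    proof (rule DERIV_pos_imp_increasing[OF xy(3)])
      fix z assume "x \<le> z" "z \<le> y"
      then have "z \<ge> X0" using xy by simp
      then show "\<exists>d. (G has_real_derivative d) (at z) \<and> d > 0"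
        unfolding G_def using ladder_int_deriv[OF a'(3)] X0 by blast
    qed
  qed
  obtain T2 where T2: "\<And>t. t \<ge> T2 \<Longrightarrow> \<phi> t > X0"
    using J'(2) by (auto simp: filterlim_at_top_dense eventually_at_top_linorder)
  define T1 where "T1 = max T0 T2"
  have T1: "T1 \<ge> T0" "T1 > 0" "\<And>t. t \<ge> T1 \<Longrightarrow> \<phi> t > X0" using T2 J' by (auto simp: T1_def)
  have phi1: "\<phi> t > 1" "ladder_dens a (\<phi> t) > 0" if "t \<ge> T1" for t
    using X0[of "\<phi> t"] T1(3)[OF that] by auto
  have eq: "G (\<phi> s) = F s" if "s \<ge> T1" for s
    unfolding G_def F_def using that T1 ladder_mu_pos[OF a'(3) phi1(1)[OF that]]
    by (intro jacobs_ladder_eq[OF J]) auto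
  have dF: "(F has_real_derivative zeta_sq t) (at t)" if "t > T1" for t
  proof -
    have "((\<lambda>s. integral {0..s} zeta_sq) has_vector_derivative zeta_sq t) (at t within {0..t + 1})"
      using that T1(2) by (intro integral_has_vector_derivative continuous_zeta_sq) auto
    then show ?thesis unfolding F_def[abs_def]
      using at_within_interior[of t "{0..t + 1}"] that T1(2) by (simp add: has_real_derivative_iff_has_vector_derivative)
  qed
  have cont: "isCont \<phi> t" if "t > T1" for t
    by (rule implicit_inverse_isCont[OF mono DERIV_isCont[OF dF[OF that]] that T1(3) eq])
  have "(\<phi> has_real_derivative zeta_sq t / ladder_dens a (\<phi> t)) (at t)" if t: "t > T1" for t
  proof (rule implicit_inverse_deriv[OF _ _ dF[OF t] cont[OF t] t eq])
    show "(G has_real_derivative ladder_dens a (\<phi> t)) (at (\<phi> t))"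
      unfolding G_def using phi1(1)[of t] t by (intro ladder_int_deriv a') auto
  qed (use phi1(2)[of t] t in auto)
  then show ?thesis using that[of T1] T1 phi1 cont by blast
qed

text \<open>For \<open>y \<in> [2T, 2T + 4]\<close> the factor \<open>ln y\<close> lies between \<open>ln T\<close> and \<open>ln (2T + 4) \<sim> ln T\<close>, so the pointwise
asymptotics \<open>ladder_dens_asymp\<close> is uniform on the whole window.\<close>

lemma ladder_dens_uniform:
  assumes a: "a \<in> {7..8}" and \<epsilon>: "0 < \<epsilon>"
  shows "eventually (\<lambda>T. \<forall>y\<in>{2 * T..2 * T + 4}. (1 - \<epsilon>) * ln T \<le> 2 * ladder_dens a y \<and> 2 * ladder_dens a y \<le> (1 + \<epsilon>) * ln T) at_top"
proof -
  define \<eta> where "\<eta> = min (\<epsilon> / 3) 1"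
  have \<eta>: "0 < \<eta>" "\<eta> \<le> 1" "\<eta> \<le> \<epsilon> / 3" using \<epsilon> by (auto simp: \<eta>_def)
  have "(1 + \<eta>) * (1 + \<eta>) = 1 + 2 * \<eta> + \<eta> * \<eta>" by (simp add: algebra_simps)
  moreover have "\<eta> * \<eta> \<le> \<eta>" using \<eta> by (simp add: mult_left_le)
  ultimately have \<eta>2: "(1 + \<eta>) * (1 + \<eta>) \<le> 1 + \<epsilon>" using \<eta> by linarith
  have lim: "((\<lambda>x. ladder_dens a x / ln x) \<longlongrightarrow> 1 / 2) at_top" using a by (intro ladder_dens_asymp) auto
  have "eventually (\<lambda>x. (1 - \<eta>) / 2 < ladder_dens a x / ln x \<and> ladder_dens a x / ln x < (1 + \<eta>) / 2 \<and> x > 1) at_top"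
    using \<eta> by (intro eventually_conj order_tendstoD[OF lim] eventually_gt_at_top) auto
  then obtain Y where Y: "\<And>x. x \<ge> Y \<Longrightarrow> (1 - \<eta>) / 2 < ladder_dens a x / ln x \<and> ladder_dens a x / ln x < (1 + \<eta>) / 2 \<and> x > 1"
    by (auto simp: eventually_at_top_linorder)
  have "((\<lambda>T::real. ln (2 * T + 4) / ln T) \<longlongrightarrow> 1) at_top" by real_asymp
  then have "eventually (\<lambda>T::real. ln (2 * T + 4) / ln T < 1 + \<eta>) at_top"
    using \<eta> by (intro order_tendstoD) auto
  then show ?thesis using eventually_ge_at_top[of Y] eventually_gt_at_top[of 1]
  proof eventually_elim
    case (elim T)
    then have lT: "ln T > 0" by simp
    show ?case
    proof
      fix y assume y: "y \<in> {2 * T..2 * T + 4}"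
      then have yY: "y \<ge> Y" using elim by auto
      have ly: "ln y > 0" using Y[OF yY] by simp
      have 1: "(1 - \<eta>) * ln y \<le> 2 * ladder_dens a y" "2 * ladder_dens a y \<le> (1 + \<eta>) * ln y"
        using Y[OF yY] ly by (auto simp: field_simps)
      have "ln T \<le> ln y" using y elim by (intro ln_mono) auto
      then have "(1 - \<eta>) * ln T \<le> (1 - \<eta>) * ln y" using \<eta> by (intro mult_left_mono) auto
      moreover have "(1 - \<epsilon>) * ln T \<le> (1 - \<eta>) * ln T" using \<eta> lT by (intro mult_right_mono) auto
      ultimately have lo: "(1 - \<epsilon>) * ln T \<le> 2 * ladder_dens a y" using 1 by linarith
      have "ln y \<le> ln (2 * T + 4)" using y elim by (intro ln_mono) auto
      also have "\<dots> \<le> (1 + \<eta>) * ln T" using elim lT by (simp add: divide_less_eq)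
      finally have "(1 + \<eta>) * ln y \<le> (1 + \<eta>) * ((1 + \<eta>) * ln T)" using \<eta> by (intro mult_left_mono) auto
      also have "\<dots> = ((1 + \<eta>) * (1 + \<eta>)) * ln T" by simp
      also have "\<dots> \<le> (1 + \<epsilon>) * ln T" using \<eta>2 lT by (intro mult_right_mono) auto
      finally show "(1 - \<epsilon>) * ln T \<le> 2 * ladder_dens a y \<and> 2 * ladder_dens a y \<le> (1 + \<epsilon>) * ln T"
        using lo 1 by linarith
    qed
  qed
qed

text \<open>The integrand is \<open>2 G'(\<phi>(t))\<close> times the Chebyshev weight composed with \<open>\<phi>\<^sub>1(t) - T - 1\<close> and multiplied by
\<open>\<phi>\<^sub>1'(t)\<close>; the first factor is squeezed by \<open>ladder_dens_uniform\<close> and the rest integrates to \<open>\<pi>/2\<close>.\<close>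

lemma chebyshev_zeta_integral_bounds:
  assumes a: "a \<in> {7..8}" and J: "jacobs_ladder a T0 \<phi>" and n: "n \<ge> 1" and \<epsilon>: "0 < \<epsilon>"
  shows "eventually (\<lambda>T. (1 - \<epsilon>) * (pi / 2 * ln T) \<le> chebyshev_zeta_integral n T0 (\<lambda>t. \<phi> t / 2) T
     \<and> chebyshev_zeta_integral n T0 (\<lambda>t. \<phi> t / 2) T \<le> (1 + \<epsilon>) * (pi / 2 * ln T)) at_top"
proof -
  have a': "a > 0" using a by auto
  obtain T1 where T1: "T1 \<ge> T0" "\<And>t. t \<ge> T1 \<Longrightarrow> \<phi> t > 1" "\<And>t. t \<ge> T1 \<Longrightarrow> ladder_dens a (\<phi> t) > 0"
    "\<And>t. t > T1 \<Longrightarrow> isCont \<phi> t"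
    "\<And>t. t > T1 \<Longrightarrow> (\<phi> has_real_derivative zeta_sq t / ladder_dens a (\<phi> t)) (at t)"
    using ladder_regular[OF a J] by blast
  have mono: "strict_mono_on {T0..} \<phi>" and top: "filterlim \<phi> at_top at_top" using J by (auto simp: jacobs_ladder_def)
  define x where "x t = \<phi> t / 2" for t
  have xmono: "strict_mono_on {T0..} x"
    using mono unfolding x_def strict_mono_on_def by simp
  have inj: "inj_on x {T0..}" by (rule strict_mono_on_imp_inj_on[OF xmono])
  define T2 where "T2 = T1 + 1"
  have xcont: "continuous_on {T2..} x" unfolding x_def
    using T1(4) by (intro continuous_at_imp_continuous_on ballI) (auto simp: T2_def intro!: continuous_intros)
  have surj: "\<exists>t\<ge>T2. x t = S" if S: "S \<ge> x T2" for S
  proof -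
    have "eventually (\<lambda>t. \<phi> t \<ge> 2 * S \<and> t \<ge> T2) at_top"
      using top by (intro eventually_conj eventually_ge_at_top) (auto simp: filterlim_at_top)
    then obtain t where t: "t \<ge> T2" "x t \<ge> S" by (auto simp: eventually_at_top_linorder x_def)
    have "\<exists>s\<ge>T2. s \<le> t \<and> x s = S"
      by (rule IVT') (use S t continuous_on_subset[OF xcont] in auto)
    then show ?thesis by blast
  qed
  have inv: "inv_into {T0..} x S \<ge> T2 \<and> x (inv_into {T0..} x S) = S" if S: "S \<ge> x T2" for S
  proof -
    obtain t where t: "t \<ge> T2" "x t = S" using surj[OF S] by blast
    then have "t \<in> {T0..}" using T1(1) by (simp add: T2_def)
    then show ?thesis using inv_into_f_f[OF inj, of t] t by auto
  qed
  have "eventually (\<lambda>T. T \<ge> x T2 \<and> T > 1 \<and> (\<forall>y\<in>{2 * T..2 * T + 4}. (1 - \<epsilon>) * ln T \<le> 2 * ladder_dens a y \<and> 2 * ladder_dens a y \<le> (1 + \<epsilon>) * ln T)) at_top"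
    by (intro eventually_conj eventually_ge_at_top eventually_gt_at_top ladder_dens_uniform a \<epsilon>)
  then show ?thesis
  proof eventually_elim
    case (elim T)
    define A where "A = inv_into {T0..} x T"
    define B where "B = inv_into {T0..} x (T + 2)"
    have A: "A \<ge> T2" "x A = T" and B: "B \<ge> T2" "x B = T + 2"
      using inv[of T] inv[of "T + 2"] elim by (auto simp: A_def B_def)
    have ge: "A \<ge> T0" "B \<ge> T0" using A B T1(1) by (auto simp: T2_def)
    have lt: "x s < x t \<longleftrightarrow> s < t" if "s \<ge> T0" "t \<ge> T0" for s t
      using strict_mono_on_less[OF xmono] that by simp
    have AB: "A < B" using lt[OF ge] A B by simp
    define x' where "x' t = zeta_sq t / (2 * ladder_dens a (\<phi> t))" for t
    have tT: "t > T1" "t \<ge> T0" if "t \<in> {A<..<B}" for t using that A(1) T1(1) by (auto simp: T2_def)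
    have range: "T < x t \<and> x t < T + 2" if "t \<in> {A<..<B}" for t
      using lt[OF ge(1) tT(2)[OF that]] lt[OF tT(2)[OF that] ge(2)] that A B by auto
    have cphi: "continuous_on {A<..<B} \<phi>" using T1(4) tT by (intro continuous_at_imp_continuous_on ballI) auto
    have cdens: "continuous_on {A<..<B} (\<lambda>t. ladder_dens a (\<phi> t))"
      by (rule continuous_on_compose2[OF continuous_ladder_dens[OF a'] cphi]) (use T1(2) tT in force)
    have dpos: "ladder_dens a (\<phi> t) > 0" if "t \<in> {A<..<B}" for t using T1(3) tT[OF that] by auto
    define f where "f t = cheb_weight n (x t - T - 1) * x' t" for t
    have "continuous_on {A..B} x" by (rule continuous_on_subset[OF xcont]) (use A in auto)
    moreover have "(x has_real_derivative x' t) (at t)" if "t \<in> {A<..<B}" for t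
      using DERIV_cdivide[OF T1(5)[OF tT(1)[OF that]], of 2] by (simp add: x_def[abs_def] x'_def mult.commute)
    moreover have "continuous_on {A<..<B} x'" unfolding x'_def
      by (intro continuous_intros continuous_zeta_sq cdens) (use dpos in force)
    moreover have "x' t \<ge> 0" if "t \<in> {A<..<B}" for t using dpos[OF that] by (simp add: x'_def)
    ultimately have sub: "set_integrable lborel {A<..<B} f" "(LBINT t:{A<..<B}. f t) = pi / 2" "continuous_on {A<..<B} f"
      unfolding f_def using range A(2) B(2) cheb_substitution[OF n AB, of x x' T] by blast+
    have f0: "f t \<ge> 0" if "t \<in> {A<..<B}" for t
      unfolding f_def x'_def using range[OF that] dpos[OF that] by (intro mult_nonneg_nonneg cheb_weight_nonneg) auto
    define h where "h t = cheb_weight n (x t - T - 1) * zeta_sq t" for t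
    have hf: "h t = f t * (2 * ladder_dens a (\<phi> t))" if "t \<in> {A<..<B}" for t
      using dpos[OF that] by (simp add: h_def f_def x'_def)
    have dens: "(1 - \<epsilon>) * ln T \<le> 2 * ladder_dens a (\<phi> t)" "2 * ladder_dens a (\<phi> t) \<le> (1 + \<epsilon>) * ln T" if "t \<in> {A<..<B}" for t
      using elim range[OF that] by (auto simp: x_def)
    have hlo: "((1 - \<epsilon>) * ln T) * f t \<le> h t" and hup: "h t \<le> ((1 + \<epsilon>) * ln T) * f t" if "t \<in> {A<..<B}" for t
      using mult_right_mono[OF dens(1)[OF that] f0[OF that]] mult_right_mono[OF dens(2)[OF that] f0[OF that]]
      unfolding hf[OF that] by (simp_all only: mult.commute[of "f t"])
    have h0: "h t \<ge> 0" if "t \<in> {A<..<B}" for t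
      unfolding hf[OF that] using f0[OF that] dpos[OF that] by simp
    have hint: "set_integrable lborel {A<..<B} h"
    proof (rule set_integrable_bound[OF set_integrable_mult_right[OF sub(1), of "(1 + \<epsilon>) * ln T"]])
      have "continuous_on {A<..<B} (\<lambda>t. f t * (2 * ladder_dens a (\<phi> t)))"
        by (intro continuous_intros sub cdens)
      then have "continuous_on {A<..<B} h" by (rule continuous_on_eq) (simp add: hf)
      then show "set_borel_measurable lborel {A<..<B} h"
        unfolding set_borel_measurable_def
        using borel_measurable_continuous_on_indicator[of "{A<..<B}" h] by simp
      show "AE t in lborel. t \<in> {A<..<B} \<longrightarrow> norm (h t) \<le> norm ((1 + \<epsilon>) * ln T * f t)"
        using hup h0 by (intro AE_I2 impI) (force intro: order_trans[OF _ abs_ge_self])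
    qed
    have I: "chebyshev_zeta_integral n T0 (\<lambda>t. \<phi> t / 2) T = (LBINT t:{A<..<B}. h t)"
      using AB unfolding chebyshev_zeta_integral_def x_def[symmetric] A_def[symmetric] B_def[symmetric]
      by (simp add: interval_lebesgue_integral_def einterval_def h_def cheb_weight_def zeta_sq_def greaterThanLessThan_def greaterThan_def lessThan_def Collect_conj_eq[symmetric])
    have "((1 - \<epsilon>) * ln T) * (pi / 2) \<le> (LBINT t:{A<..<B}. h t)"
      unfolding sub(2)[symmetric] set_integral_mult_right[symmetric]
      by (intro set_integral_mono set_integrable_mult_right sub hint hlo)
    moreover have "(LBINT t:{A<..<B}. h t) \<le> ((1 + \<epsilon>) * ln T) * (pi / 2)"
      unfolding sub(2)[symmetric] set_integral_mult_right[symmetric]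
      by (intro set_integral_mono set_integrable_mult_right sub hint hup)
    ultimately show ?case unfolding I by (simp add: mult_ac)
  qed
qed

theorem mainTheorem3:
  fixes a T0 :: real and \<phi> \<phi>\<^sub>1 :: "real \<Rightarrow> real" and n :: nat
  assumes "a \<in> {7..8}"
    and "jacobs_ladder a T0 \<phi>"
    and "\<And>t. \<phi>\<^sub>1 t = \<phi> t / 2"
    and "n \<ge> 1"
  shows "asymp_equiv (chebyshev_zeta_integral n T0 \<phi>\<^sub>1) at_top (\<lambda>T. pi / 2 * ln T)"
proof -
  have \<phi>1: "\<phi>\<^sub>1 = (\<lambda>t. \<phi> t / 2)" using assms(3) by (simp add: fun_eq_iff)
  show ?thesis unfolding \<phi>1
  proof (rule asymp_equivI', rule tendstoI)
    fix e :: real assume e: "e > 0"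
    have "e / 2 > 0" using e by simp
    from chebyshev_zeta_integral_bounds[OF assms(1,2,4) this] eventually_gt_at_top[of 1]
    show "eventually (\<lambda>T. dist (chebyshev_zeta_integral n T0 (\<lambda>t. \<phi> t / 2) T / (pi / 2 * ln T)) 1 < e) at_top"
    proof eventually_elim
      case (elim T)
      define b where "b = pi / 2 * ln T"
      define I where "I = chebyshev_zeta_integral n T0 (\<lambda>t. \<phi> t / 2) T"
      have b: "b > 0" using elim by (simp add: b_def)
      have "(1 - e / 2) * b \<le> I" "I \<le> (1 + e / 2) * b" using elim by (auto simp: b_def I_def)
      then have "1 - e / 2 \<le> I / b" "I / b \<le> 1 + e / 2" using b by (auto simp: pos_le_divide_eq pos_divide_le_eq)
      then have "dist (I / b) 1 < e" using e by (simp add: dist_real_def abs_less_iff)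
      then show ?case by (simp add: b_def I_def)
    qed
  qed
qed

end
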